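(* Let $\mathbb{K}$ be a field and let $\Delta$ be a simplicial complex on the vertex set $X=\{x_1,\dots,x_n\}$. Then $\Delta$ is initially Cohen--Macaulay (over $\mathbb{K}$) if and only if for every face $F\in\Delta$, $$\widetilde{H}_i(\mathrm{link}_\Delta(F);\mathbb{K})=0\quad\text{for all } i<\mathrm{indim}\,\Delta-|F|.$$
   Context: Let $R=\mathbb{K}[x_1,\dots,x_n]$ with the standard grading and $M=(x_1,\dots,x_n)$. The Stanley--Reisner ideal $I_\Delta\subset R$ is generated by the monomials $\prod_{x_i\in F}x_i$ for $F$ a minimal non-face of $\Delta$, and $\mathbb{K}[\Delta]=R/I_\Delta$. The initial dimension of a module $N$ is $\mathrm{indim}\,N=\inf\{\dim R/P\mid P\in\mathrm{Ass}_R N\}$, and $\mathrm{indim}\,\Delta=\mathrm{indim}\,\mathbb{K}[\Delta]-1$, i.e. the minimum dimension of a facet of $\Delta$ (where $\dim F=|F|-1$). The complex $\Delta$ is initially Cohen--Macaulay over $\mathbb{K}$ if $\mathrm{depth}\,\mathbb{K}[\Delta]=\mathrm{indim}\,\mathbb{K}[\Delta]$ (or $\mathbb{K}[\Delta]=0$), depth being taken with respect to $M$. For a face $F\in\Delta$, $\mathrm{link}_\Delta(F)=\{F'\in\Delta\mid F'\cap F=\emptyset,\ F'\cup F\in\Delta\}$. $\widetilde{H}_i(-;\mathbb{K})$ is reduced simplicial homology with coefficients in $\mathbb{K}$ (with $\widetilde H_{-1}(\{\emptyset\};\mathbb{K})=\mathbb{K}$). *)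

theory Defs
  imports
    "HOL-Algebra.QuotRing"
    "HOL-Algebra.Module"
    "HOL-Algebra.Elementary_Groups"
    "HOL-Library.Poly_Mapping"
    "HOL-Library.Extended_Real"
begin

section \<open>Krull dimension, associated primes, depth\<close>

text \<open>
  The supremum is taken in \<^typ>\<open>enat\<close>, so the zero ring gets dimension 0; below, the dimension
  is only used for quotients by prime ideals.
\<close>

definition krull_dim :: "('a, 'b) ring_scheme \<Rightarrow> enat" where
  "krull_dim R = Sup {enat r | r. \<exists>P :: nat \<Rightarrow> 'a set.
     (\<forall>i\<le>r. primeideal (P i) R) \<and> (\<forall>i<r. P i \<subset> P (Suc i))}"

definition associated_primes ::
    "('a, 'c) ring_scheme \<Rightarrow> ('a, 'b, 'd) module_scheme \<Rightarrow> 'a set set" where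
  "associated_primes R N =
     {P. primeideal P R \<and>
         (\<exists>x \<in> carrier N. P = {r \<in> carrier R. r \<odot>\<^bsub>N\<^esub> x = \<zero>\<^bsub>N\<^esub>})}"

text \<open>The infimum over the empty set, i.e. for the zero module, is \<^term>\<open>\<infinity> :: enat\<close>.\<close>

definition indim :: "('a, 'c) ring_scheme \<Rightarrow> ('a, 'b, 'd) module_scheme \<Rightarrow> enat" where
  "indim R N = (INF P \<in> associated_primes R N. krull_dim (R Quot P))"

text \<open>The submodule \<open>(f\<^sub>1, \<dots>, f\<^sub>r) N\<close> of \<open>N\<close>, for a list of ring elements.\<close>

definition list_smult :: "'a list \<Rightarrow> ('a, 'b, 'd) module_scheme \<Rightarrow> 'b set" where
  "list_smult fs N =
     {\<Oplus>\<^bsub>N\<^esub>j\<in>{..<length fs}. (fs ! j) \<odot>\<^bsub>N\<^esub> x j | x. x \<in> {..<length fs} \<rightarrow> carrier N}"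

text \<open>
  The first condition says that each \<open>f\<^sub>i\<close> is a nonzerodivisor on
  \<open>N / (f\<^sub>1, \<dots>, f\<^sub>i\<^sub>-\<^sub>1) N\<close>, the second one that \<open>N / (f\<^sub>1, \<dots>, f\<^sub>r) N \<noteq> 0\<close>.
\<close>

definition regular_sequence :: "('a, 'b, 'd) module_scheme \<Rightarrow> 'a list \<Rightarrow> bool" where
  "regular_sequence N fs \<longleftrightarrow>
     (\<forall>i<length fs. \<forall>x \<in> carrier N.
        (fs ! i) \<odot>\<^bsub>N\<^esub> x \<in> list_smult (take i fs) N \<longrightarrow> x \<in> list_smult (take i fs) N) \<and>
     list_smult fs N \<noteq> carrier N"

definition depth :: "'a set \<Rightarrow> ('a, 'b, 'd) module_scheme \<Rightarrow> enat" where
  "depth I N = Sup {enat (length fs) | fs. set fs \<subseteq> I \<and> regular_sequence N fs}"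

text \<open>The residue class ring \<open>R / I\<close> as a module over \<open>R\<close>.\<close>

definition quotient_module :: "('a, 'c) ring_scheme \<Rightarrow> 'a set \<Rightarrow> ('a, 'a set) module" where
  "quotient_module R I =
     ring.extend (R Quot I) (module.fields (\<lambda>r A. (I +>\<^bsub>R\<^esub> r) \<otimes>\<^bsub>R Quot I\<^esub> A))"


section \<open>Simplicial complexes and Stanley--Reisner rings\<close>

text \<open>
  The vertex \<open>x\<^sub>i\<close> is represented by its index \<open>i\<close>. Neither the void complex \<open>{}\<close> nor vertices
  \<open>i\<close> with \<open>{i} \<notin> \<Delta>\<close> are excluded.
\<close>

definition simplicial_complex_on :: "'v set \<Rightarrow> 'v set set \<Rightarrow> bool" where
  "simplicial_complex_on X \<Delta> \<longleftrightarrow> (\<forall>F \<in> \<Delta>. F \<subseteq> X \<and> (\<forall>G. G \<subseteq> F \<longrightarrow> G \<in> \<Delta>))"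

definition minimal_nonfaces :: "'v set \<Rightarrow> 'v set set \<Rightarrow> 'v set set" where
  "minimal_nonfaces X \<Delta> = {F. F \<subseteq> X \<and> F \<notin> \<Delta> \<and> (\<forall>G. G \<subset> F \<longrightarrow> G \<in> \<Delta>)}"

definition link :: "'v set set \<Rightarrow> 'v set \<Rightarrow> 'v set set" where
  "link \<Delta> F = {F' \<in> \<Delta>. F' \<inter> F = {} \<and> F' \<union> F \<in> \<Delta>}"

text \<open>
  Polynomials are finitely supported functions from exponent vectors to coefficients, with the
  convolution product of \<open>Poly_Mapping\<close>.
\<close>

type_synonym 'k mpoly = "(nat \<Rightarrow>\<^sub>0 nat) \<Rightarrow>\<^sub>0 'k"

definition var :: "nat \<Rightarrow> 'k::field mpoly" where
  "var i = Poly_Mapping.single (Poly_Mapping.single i 1) 1"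

definition polynomial_ring :: "'k::field itself \<Rightarrow> nat \<Rightarrow> 'k mpoly ring" where
  "polynomial_ring _ n =
     \<lparr>carrier = {p. \<forall>m \<in> Poly_Mapping.keys p. Poly_Mapping.keys m \<subseteq> {1..n}},
      monoid.mult = (*), one = 1, ring.zero = 0, add = (+)\<rparr>"

definition irrelevant_ideal :: "'k::field itself \<Rightarrow> nat \<Rightarrow> 'k mpoly set" where
  "irrelevant_ideal K n = Idl\<^bsub>polynomial_ring K n\<^esub> (var ` {1..n})"

definition stanley_reisner_ideal ::
    "'k::field itself \<Rightarrow> nat \<Rightarrow> nat set set \<Rightarrow> 'k mpoly set" where
  "stanley_reisner_ideal K n \<Delta> =
     Idl\<^bsub>polynomial_ring K n\<^esub> ((\<lambda>F. \<Prod>i\<in>F. var i) ` minimal_nonfaces {1..n} \<Delta>)"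

text \<open>The Stanley--Reisner ring, with its structure of a module over the polynomial ring.\<close>

definition stanley_reisner_ring ::
    "'k::field itself \<Rightarrow> nat \<Rightarrow> nat set set \<Rightarrow> ('k mpoly, 'k mpoly set) module" where
  "stanley_reisner_ring K n \<Delta> =
     quotient_module (polynomial_ring K n) (stanley_reisner_ideal K n \<Delta>)"

text \<open>
  For the void complex this is \<^term>\<open>\<infinity> :: ereal\<close>, for \<^term>\<open>{{}} :: nat set set\<close> it is \<open>-1\<close>.
\<close>

definition indim_complex :: "'k::field itself \<Rightarrow> nat \<Rightarrow> nat set set \<Rightarrow> ereal" where
  "indim_complex K n \<Delta> =
     ereal_of_enat (indim (polynomial_ring K n) (stanley_reisner_ring K n \<Delta>)) - 1"

definition initially_cohen_macaulay :: "'k::field itself \<Rightarrow> nat \<Rightarrow> nat set set \<Rightarrow> bool" where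
  "initially_cohen_macaulay K n \<Delta> \<longleftrightarrow>
     depth (irrelevant_ideal K n) (stanley_reisner_ring K n \<Delta>) =
       indim (polynomial_ring K n) (stanley_reisner_ring K n \<Delta>) \<or>
     carrier (stanley_reisner_ring K n \<Delta>) = {\<zero>\<^bsub>stanley_reisner_ring K n \<Delta>\<^esub>}"


section \<open>Reduced simplicial homology\<close>

text \<open>
  Faces are oriented by the order of their vertices. The empty face, of dimension \<open>-1\<close>, is part
  of the chain complex, which makes it the augmented one.
\<close>

definition simplicial_chains :: "'v set set \<Rightarrow> int \<Rightarrow> ('v set \<Rightarrow>\<^sub>0 'k::field) set" where
  "simplicial_chains \<Delta> i =
     {c. \<forall>F \<in> Poly_Mapping.keys c. F \<in> \<Delta> \<and> finite F \<and> int (card F) = i + 1}"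

definition simplicial_boundary ::
    "('v::linorder set \<Rightarrow>\<^sub>0 'k::field) \<Rightarrow> ('v set \<Rightarrow>\<^sub>0 'k)" where
  "simplicial_boundary c =
     (\<Sum>F \<in> Poly_Mapping.keys c. \<Sum>v \<in> F.
        Poly_Mapping.single (F - {v}) ((-1) ^ card {w \<in> F. w < v} * Poly_Mapping.lookup c F))"

definition simplicial_cycle_group ::
    "'v::linorder set set \<Rightarrow> int \<Rightarrow> ('v set \<Rightarrow>\<^sub>0 'k::field) monoid" where
  "simplicial_cycle_group \<Delta> i =
     \<lparr>carrier = {c \<in> simplicial_chains \<Delta> i. simplicial_boundary c = 0},
      monoid.mult = (+), one = 0\<rparr>"

text \<open>
  Only the additive group of the vector space of cycles modulo boundaries is recorded; this is
  enough to express its vanishing.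
\<close>

definition reduced_homology ::
    "'k::field itself \<Rightarrow> 'v::linorder set set \<Rightarrow> int \<Rightarrow> ('v set \<Rightarrow>\<^sub>0 'k) set monoid" where
  "reduced_homology _ \<Delta> i =
     simplicial_cycle_group \<Delta> i Mod (simplicial_boundary ` simplicial_chains \<Delta> (i + 1))"

end

theory Submission
  imports Defs
begin

text \<open>
  The depth of \<open>N = K[\<Delta>]\<close> is detected by the Koszul complex on \<open>x\<^sub>1, \<dots>, x\<^sub>n\<close>: the existence of a
  regular sequence of length \<open>d\<close> in \<open>M\<close> is equivalent to \<open>H\<^sup>i(x; N) = 0\<close> for all \<open>i < d\<close>. In one
  direction one divides by a nonzerodivisor \<open>f \<in> M\<close>, which kills the Koszul cohomology; in the other
  one, prime avoidance turns \<open>H\<^sup>0(x; N) = 0\<close> into the existence of such an \<open>f\<close>. The strand of degree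
  \<open>a\<close> of the Koszul complex of \<open>K[\<Delta>]\<close> is contractible if some \<open>a\<^sub>v > 0\<close>; otherwise, with
  \<open>T = {v. a\<^sub>v = -1}\<close>, it is the cochain complex of the restriction of \<open>\<Delta>\<close> to the complement of \<open>T\<close>,
  shifted by the size of \<open>T\<close>. The exact sequences relating a complex, the deletion of a vertex and its link turn
  the vanishing conditions on restrictions into those on links, and linear duality turns cohomology
  into homology. So depth at least \<open>d\<close> means that \<open>H\<^sub>i(link F)\<close> vanishes for \<open>i < d - 1 - |F|\<close>.

  The associated primes of \<open>K[\<Delta>]\<close> are the ideals \<open>(x\<^sub>v : v \<notin> F)\<close> for facets \<open>F\<close>, with coordinate rings of
  dimension \<open>|F|\<close>, so the initial dimension is the least size of a facet. Facets have link \<open>{\<emptyset>}\<close>,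
  whence depth never exceeds it.
\<close>


section \<open>Koszul cochains and regular sequences\<close>

text \<open>A regular sequence may consist of inhomogeneous elements, so after one division the
  ideal need not be monomial and the multigrading is lost. The homological part therefore runs over
  arbitrary ideals \<open>J\<close> of a Noetherian ring; the multigrading enters only for the face
  ideal itself. Nonzerodivisors are taken from all of \<open>M\<close>, as over a finite field
  combinations of the variables with constant coefficients need not suffice. In this part no
  quotient module is formed: cochains take values in the ring and identities hold modulo
  \<open>J\<close>, so that every exact sequence becomes an explicit construction of cochains.
  Degrees are counted by the size of a set, which avoids negative indices; the shift by one to
  dimensions is made only in the comparison with homology. The dimension of a coordinate ring is
  bounded above without transcendence bases: counting monomials produces an algebraic relation, and
  a chain of primes of excessive length would contradict it.\<close>

definition osign :: "'v::linorder \<Rightarrow> 'v set \<Rightarrow> 'a::comm_ring_1" where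
  "osign v S = (-1) ^ card {w \<in> S. w < v}"

lemma osign_sq [simp]: "osign v S * osign v S = 1"
  by (simp add: osign_def flip: power_mult_distrib)

lemma osign_sq_left [simp]: "osign v S * (osign v S * a) = a"
  by (simp flip: mult.assoc)

lemma osign_singleton [simp]: "osign v {v} = 1"
proof -
  have "{w \<in> {v}. w < v} = {}" by auto
  then show ?thesis unfolding osign_def by (simp only: card.empty power_0)
qed

text \<open>For \<open>a < b\<close>, deleting \<open>a\<close> lowers the number of elements below
  \<open>b\<close> by one, while deleting \<open>b\<close> leaves the number below \<open>a\<close>
  unchanged. This sign makes the differentials square to zero.\<close>

lemma osign_anticomm:
  assumes "finite S" "v \<in> S" "w \<in> S" "v \<noteq> w"
  shows "(osign v S :: 'a::comm_ring_1) * osign w (S - {v}) = - (osign w S * osign v (S - {w}))"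
proof -
  have main: "(osign a S :: 'a) * osign b (S - {a}) = - (osign b S * osign a (S - {b}))"
    if "a \<in> S" "b \<in> S" "a < b" for a b
  proof -
    have "{u \<in> S - {b}. u < a} = {u \<in> S. u < a}"
      using that by auto
    moreover have "card {u \<in> S. u < b} = Suc (card {u \<in> S - {a}. u < b})"
    proof -
      have "{u \<in> S. u < b} = insert a {u \<in> S - {a}. u < b}"
        using that by auto
      then show ?thesis using \<open>finite S\<close> by simp
    qed
    ultimately show ?thesis by (simp add: osign_def)
  qed
  show ?thesis
    using main[of v w] main[of w v] assms by (cases "v < w") auto
qed

text \<open>Exchanging the two summations would only give s = -s, which says nothing in
  characteristic 2; the induction cancels each pair against its reverse.\<close>

lemma sum_antisymmetric_pairs:
  fixes g :: "'v \<Rightarrow> 'v \<Rightarrow> 'a::comm_ring_1"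
  assumes "finite S" and "\<And>v w. v \<in> S \<Longrightarrow> w \<in> S \<Longrightarrow> v \<noteq> w \<Longrightarrow> g v w = - g w v"
  shows "(\<Sum>v\<in>S. \<Sum>w\<in>S - {v}. g v w) = 0"
  using assms
proof (induction S rule: finite_induct)
  case empty
  then show ?case by simp
next
  case (insert a S)
  have IH: "(\<Sum>v\<in>S. \<Sum>w\<in>S - {v}. g v w) = 0"
    by (rule insert.IH) (rule insert.prems, auto)
  have "(\<Sum>v\<in>S. \<Sum>w\<in>insert a S - {v}. g v w) = (\<Sum>v\<in>S. g v a + (\<Sum>w\<in>S - {v}. g v w))"
  proof (rule sum.cong)
    fix v assume "v \<in> S"
    then have "insert a S - {v} = insert a (S - {v})" using insert.hyps by auto
    then show "(\<Sum>w\<in>insert a S - {v}. g v w) = g v a + (\<Sum>w\<in>S - {v}. g v w)"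
      using insert.hyps by simp
  qed simp
  also have "\<dots> = (\<Sum>v\<in>S. g v a)"
    using IH by (simp add: sum.distrib)
  also have "\<dots> = - (\<Sum>w\<in>S. g a w)"
    unfolding sum_negf[symmetric] using insert.hyps(2)
    by (intro sum.cong insert.prems) auto
  finally show ?case using insert.hyps by simp
qed

text \<open>With \<open>z\<close> read as the sum of all \<open>z S\<close> e_S in the exterior
  algebra, this is the coefficient at e_S of left multiplication by the sum of all
  \<open>x v\<close> e_v.\<close>

definition koszul_d :: "('v::linorder \<Rightarrow> 'a::comm_ring_1) \<Rightarrow> ('v set \<Rightarrow> 'a) \<Rightarrow> 'v set \<Rightarrow> 'a" where
  "koszul_d x z S = (\<Sum>v\<in>S. osign v S * x v * z (S - {v}))"

lemma koszul_d_koszul_d: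
  assumes "finite S"
  shows "koszul_d x (koszul_d x z) S = 0"
proof -
  have "koszul_d x (koszul_d x z) S = (\<Sum>v\<in>S. \<Sum>w\<in>S - {v}.
      (osign v S * osign w (S - {v})) * (x v * x w * z (S - {v} - {w})))"
    by (simp add: koszul_d_def sum_distrib_left mult_ac)
  also have "\<dots> = 0"
  proof (rule sum_antisymmetric_pairs[OF assms])
    fix v w assume "v \<in> S" "w \<in> S" "v \<noteq> w"
    then show "osign v S * osign w (S - {v}) * (x v * x w * z (S - {v} - {w})) =
      - (osign w S * osign v (S - {w}) * (x w * x v * z (S - {w} - {v})))"
      unfolding osign_anticomm[OF assms \<open>v \<in> S\<close> \<open>w \<in> S\<close> \<open>v \<noteq> w\<close>]
      by (simp add: Diff_insert2 [symmetric] insert_commute mult_ac)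
  qed
  finally show ?thesis .
qed

lemma koszul_d_diff: "koszul_d x (\<lambda>S. y S - z S) S = koszul_d x y S - koszul_d x z S"
  by (simp add: koszul_d_def sum_subtractf algebra_simps)

lemma koszul_d_mult: "koszul_d x (\<lambda>S. c * z S) S = c * koszul_d x z S"
  by (simp add: koszul_d_def sum_distrib_left mult_ac)

text \<open>Contraction with the dual basis vector of \<open>u\<close>.\<close>

definition koszul_h :: "'v::linorder \<Rightarrow> ('v set \<Rightarrow> 'a::comm_ring_1) \<Rightarrow> 'v set \<Rightarrow> 'a" where
  "koszul_h u z S = (if u \<in> S then 0 else osign u (insert u S) * z (insert u S))"

lemma sign_rearrange:
  fixes a b c d :: "'a::comm_ring_1"
  assumes "b * c = - (a * d)" "a * a = 1" "c * c = 1"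
  shows "a * b = - (d * c)"
proof -
  have "a * b = a * (b * c) * c"
    using assms(3) by (simp add: mult.assoc)
  also have "\<dots> = - ((a * a) * d * c)"
    unfolding assms(1) by (simp add: mult.assoc)
  finally show ?thesis
    using assms(2) by simp
qed

text \<open>The anticommutator of an exterior multiplication and a contraction is a scalar, here
  \<open>x u\<close>; so multiplication by \<open>x u\<close> is null-homotopic. With
  \<open>x\<close> constantly 1 the same identity contracts cones.\<close>

lemma koszul_homotopy:
  assumes "finite S"
  shows "koszul_d x (koszul_h u z) S + koszul_h u (koszul_d x z) S = x u * z S"
proof (cases "u \<in> S")
  case True
  have "koszul_d x (koszul_h u z) S = (\<Sum>v\<in>S. if v = u then x u * z S else 0)"
    unfolding koszul_d_def
    using True by (intro sum.cong) (auto simp: koszul_h_def insert_absorb mult_ac)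
  then show ?thesis
    using True assms by (simp add: koszul_h_def)
next
  case False
  have "koszul_h u (koszul_d x z) S = osign u (insert u S) * (osign u (insert u S) * x u * z S
      + (\<Sum>v\<in>S. osign v (insert u S) * x v * z (insert u S - {v})))"
    using False assms by (simp add: koszul_h_def koszul_d_def)
  also have "\<dots> = x u * z S + (\<Sum>v\<in>S. osign u (insert u S) * osign v (insert u S) * x v * z (insert u S - {v}))"
    by (simp add: algebra_simps sum_distrib_left)
  also have "(\<Sum>v\<in>S. osign u (insert u S) * osign v (insert u S) * x v * z (insert u S - {v})) =
     (\<Sum>v\<in>S. - (osign v S * x v * koszul_h u z (S - {v})))"
  proof (rule sum.cong)
    fix v assume v: "v \<in> S"
    with False have uv: "u \<noteq> v" by auto
    have eq: "insert u S - {v} = insert u (S - {v})" "insert u S - {u} = S" using uv False by auto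
    have "(osign v (insert u S) :: 'b) * osign u (insert u (S - {v})) = - (osign u (insert u S) * osign v S)"
      using osign_anticomm[of "insert u S" v u, where 'a='b] assms v uv eq by simp
    then have *: "(osign u (insert u S) :: 'b) * osign v (insert u S)
        = - (osign v S * osign u (insert u (S - {v})))"
      by (rule sign_rearrange) simp_all
    show "osign u (insert u S) * osign v (insert u S) * x v * z (insert u S - {v}) =
      - (osign v S * x v * koszul_h u z (S - {v}))"
      unfolding * using False by (simp add: koszul_h_def eq mult_ac)
  qed simp
  finally show ?thesis by (simp add: koszul_d_def[of x "koszul_h u z"] sum_negf)
qed

text \<open>Polynomials in the variables of \<open>X\<close> form only a subset of their type. A
  subset closed under the operations of the type keeps type-class arithmetic available; the passage
  to structures with explicit carriers is made separately.\<close>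

locale comm_subring =
  fixes C :: "'a::comm_ring_1 set"
  assumes one_mem: "1 \<in> C"
    and add_mem: "a \<in> C \<Longrightarrow> b \<in> C \<Longrightarrow> a + b \<in> C"
    and mult_mem: "a \<in> C \<Longrightarrow> b \<in> C \<Longrightarrow> a * b \<in> C"
    and uminus_mem: "a \<in> C \<Longrightarrow> - a \<in> C"
begin

lemma zero_mem: "0 \<in> C"
  using add_mem[OF one_mem uminus_mem[OF one_mem]] by simp

lemma diff_mem: "a \<in> C \<Longrightarrow> b \<in> C \<Longrightarrow> a - b \<in> C"
  using add_mem[of a "- b"] uminus_mem[of b] by simp

lemma sum_mem: "(\<And>i. i \<in> A \<Longrightarrow> f i \<in> C) \<Longrightarrow> sum f A \<in> C"
  by (induction A rule: infinite_finite_induct) (auto intro: zero_mem add_mem)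

lemma neg_one_power_mem: "(-1) ^ k \<in> C"
  by (induction k) (auto intro: one_mem mult_mem uminus_mem)

lemma osign_mem: "osign v S \<in> C"
  unfolding osign_def by (rule neg_one_power_mem)

definition is_ideal :: "'a set \<Rightarrow> bool" where
  "is_ideal J \<longleftrightarrow> J \<subseteq> C \<and> 0 \<in> J \<and> (\<forall>a\<in>J. \<forall>b\<in>J. a + b \<in> J) \<and> (\<forall>r\<in>C. \<forall>a\<in>J. r * a \<in> J)"

lemma is_idealD:
  assumes "is_ideal J"
  shows "\<And>a. a \<in> J \<Longrightarrow> a \<in> C" "0 \<in> J" "\<And>a b. a \<in> J \<Longrightarrow> b \<in> J \<Longrightarrow> a + b \<in> J"
    "\<And>r a. r \<in> C \<Longrightarrow> a \<in> J \<Longrightarrow> r * a \<in> J" "\<And>r a. r \<in> C \<Longrightarrow> a \<in> J \<Longrightarrow> a * r \<in> J"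
    "\<And>a. a \<in> J \<Longrightarrow> - a \<in> J" "\<And>a b. a \<in> J \<Longrightarrow> b \<in> J \<Longrightarrow> a - b \<in> J"
proof -
  note J = assms[unfolded is_ideal_def]
  show "\<And>a. a \<in> J \<Longrightarrow> a \<in> C" "0 \<in> J" and add: "\<And>a b. a \<in> J \<Longrightarrow> b \<in> J \<Longrightarrow> a + b \<in> J"
    and mult: "\<And>r a. r \<in> C \<Longrightarrow> a \<in> J \<Longrightarrow> r * a \<in> J"
    using J by blast+
  then show "\<And>r a. r \<in> C \<Longrightarrow> a \<in> J \<Longrightarrow> a * r \<in> J"
    by (simp add: mult.commute)
  show um: "\<And>a. a \<in> J \<Longrightarrow> - a \<in> J"
    using mult[OF uminus_mem[OF one_mem]] by simp
  then show "\<And>a b. a \<in> J \<Longrightarrow> b \<in> J \<Longrightarrow> a - b \<in> J"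
    using add by (metis diff_conv_add_uminus)
qed

lemma ideal_sum_mem: "is_ideal J \<Longrightarrow> (\<And>i. i \<in> A \<Longrightarrow> f i \<in> J) \<Longrightarrow> sum f A \<in> J"
  by (induction A rule: infinite_finite_induct) (auto intro: is_idealD)

definition adjoin :: "'a set \<Rightarrow> 'a \<Rightarrow> 'a set" where
  "adjoin J f = {a + r * f | a r. a \<in> J \<and> r \<in> C}"

lemma adjoinI: "a \<in> J \<Longrightarrow> r \<in> C \<Longrightarrow> a + r * f \<in> adjoin J f"
  by (auto simp: adjoin_def)

lemma adjoin_ideal:
  assumes "is_ideal J" "f \<in> C"
  shows "is_ideal (adjoin J f)"
  unfolding is_ideal_def
proof (intro conjI ballI)
  show "adjoin J f \<subseteq> C"
    using assms by (auto simp: adjoin_def intro: add_mem mult_mem is_idealD)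
  show "0 \<in> adjoin J f"
    using adjoinI[of 0 J 0 f] assms by (simp add: is_idealD zero_mem)
next
  fix a b assume "a \<in> adjoin J f" "b \<in> adjoin J f"
  then obtain a' r b' s where *: "a = a' + r * f" "b = b' + s * f" "a' \<in> J" "b' \<in> J" "r \<in> C" "s \<in> C"
    by (auto simp: adjoin_def)
  have eq: "a + b = (a' + b') + (r + s) * f"
    by (simp add: * algebra_simps)
  show "a + b \<in> adjoin J f"
    unfolding eq using adjoinI[of "a' + b'" J "r + s" f] * assms by (simp add: is_idealD add_mem)
next
  fix r a assume r: "r \<in> C" and "a \<in> adjoin J f"
  then obtain a' s where *: "a = a' + s * f" "a' \<in> J" "s \<in> C"
    by (auto simp: adjoin_def)
  have eq: "r * a = r * a' + (r * s) * f"
    by (simp add: * algebra_simps)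
  show "r * a \<in> adjoin J f"
    unfolding eq using adjoinI[of "r * a'" J "r * s" f] * r assms by (simp add: is_idealD mult_mem)
qed

lemma subset_adjoin: "J \<subseteq> adjoin J f"
  using adjoinI[of _ J 0 f] zero_mem by auto

lemma adjoin_self: "is_ideal J \<Longrightarrow> f \<in> adjoin J f"
  using adjoinI[of 0 J 1 f] one_mem is_idealD(2) by auto

definition nonzerodivisor_mod :: "'a \<Rightarrow> 'a set \<Rightarrow> bool" where
  "nonzerodivisor_mod f J \<longleftrightarrow> (\<forall>g\<in>C. f * g \<in> J \<longrightarrow> g \<in> J)"

text \<open>The condition that the last quotient be nonzero is kept apart: the Koszul argument
  concerns the nonzerodivisor conditions only, and properness is dealt with in the comparison with
  \<open>regular_sequence\<close>.\<close>

fun regular_mod :: "'a set \<Rightarrow> 'a list \<Rightarrow> bool" where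
  "regular_mod J [] = True"
| "regular_mod J (f # fs) = (nonzerodivisor_mod f J \<and> regular_mod (adjoin J f) fs)"

end

section \<open>Koszul exactness modulo an ideal\<close>

locale koszul = comm_subring C for C :: "'a::comm_ring_1 set" +
  fixes X :: "'v::linorder set" and x :: "'v \<Rightarrow> 'a"
  assumes finite_X: "finite X" and x_mem: "v \<in> X \<Longrightarrow> x v \<in> C"
begin

lemma finite_subset_X: "S \<subseteq> X \<Longrightarrow> finite S"
  using finite_X finite_subset by blast

text \<open>Cochains of degree \<open>i\<close> are functions on all sets of which only the values at subsets of
  \<open>X\<close> of size \<open>i\<close> matter, so the primitive \<open>y\<close> needs no separate case for \<open>i = 0\<close>.\<close>

definition koszul_exact :: "nat \<Rightarrow> 'a set \<Rightarrow> bool" where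
  "koszul_exact i J \<longleftrightarrow> (\<forall>z. (\<forall>S. z S \<in> C) \<and> (\<forall>S\<subseteq>X. card S = Suc i \<longrightarrow> koszul_d x z S \<in> J) \<longrightarrow>
     (\<exists>y. (\<forall>S. y S \<in> C) \<and> (\<forall>S\<subseteq>X. card S = i \<longrightarrow> z S - koszul_d x y S \<in> J)))"

text \<open>The coefficients range over \<open>C\<close>, not over constants, so this is the whole
  ideal generated by the \<open>x v\<close>.\<close>

definition linear_forms :: "'a set" where
  "linear_forms = {\<Sum>v\<in>X. r v * x v | r. \<forall>v\<in>X. r v \<in> C}"

lemma koszul_d_mem:
  assumes "is_ideal J" "S \<subseteq> X" "\<And>v. v \<in> S \<Longrightarrow> z (S - {v}) \<in> J"
  shows "koszul_d x z S \<in> J"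
  unfolding koszul_d_def using assms
  by (intro ideal_sum_mem is_idealD(4)[OF assms(1)] mult_mem osign_mem x_mem) auto

lemma ideal_C: "is_ideal C"
  unfolding is_ideal_def using add_mem mult_mem zero_mem by auto

text \<open>At the empty set a coboundary is an empty sum, and at \<open>{v}\<close> the
  differential of \<open>z\<close> is \<open>x v * z {}\<close>. So exactness in degree 0 means that
  no nonzero class modulo \<open>J\<close> is killed by all \<open>x v\<close>.\<close>

lemma koszul_exact_0:
  "is_ideal J \<Longrightarrow> koszul_exact 0 J \<longleftrightarrow> (\<forall>g\<in>C. (\<forall>v\<in>X. x v * g \<in> J) \<longrightarrow> g \<in> J)"
proof
  assume J: "is_ideal J" and ex: "koszul_exact 0 J"
  show "\<forall>g\<in>C. (\<forall>v\<in>X. x v * g \<in> J) \<longrightarrow> g \<in> J"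
  proof (intro ballI impI)
    fix g assume g: "g \<in> C" "\<forall>v\<in>X. x v * g \<in> J"
    have "\<exists>y. (\<forall>S. y S \<in> C) \<and> (\<forall>S\<subseteq>X. card S = 0 \<longrightarrow> (\<lambda>_. g) S - koszul_d x y S \<in> J)"
    proof (rule ex[unfolded koszul_exact_def, rule_format], intro conjI allI impI)
      fix S assume "S \<subseteq> X" "card S = Suc 0"
      then obtain v where "S = {v}" "v \<in> X" by (auto simp: card_Suc_eq)
      then show "koszul_d x (\<lambda>_. g) S \<in> J"
        using g by (simp add: koszul_d_def)
    qed (use g in auto)
    then show "g \<in> J" by (auto simp: koszul_d_def dest: spec[of _ "{}"])
  qed
next
  assume J: "is_ideal J" and a: "\<forall>g\<in>C. (\<forall>v\<in>X. x v * g \<in> J) \<longrightarrow> g \<in> J"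
  show "koszul_exact 0 J"
    unfolding koszul_exact_def
  proof (intro allI impI, elim conjE)
    fix z assume z: "\<forall>S. z S \<in> C" "\<forall>S\<subseteq>X. card S = Suc 0 \<longrightarrow> koszul_d x z S \<in> J"
    have "x v * z {} \<in> J" if "v \<in> X" for v
      using z(2)[rule_format, of "{v}"] that by (simp add: koszul_d_def)
    then have "z {} \<in> J" using a z by blast
    moreover have "S = {}" if "S \<subseteq> X" "card S = 0" for S
      using that finite_subset_X by auto
    ultimately have "\<forall>S\<subseteq>X. card S = 0 \<longrightarrow> z S - koszul_d x (\<lambda>_. 0) S \<in> J"
      by (auto simp: koszul_d_def)
    then show "\<exists>y. (\<forall>S. y S \<in> C) \<and> (\<forall>S\<subseteq>X. card S = 0 \<longrightarrow> z S - koszul_d x y S \<in> J)"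
      using zero_mem by (intro exI[of _ "\<lambda>_. 0"]) auto
  qed
qed

text \<open>As a combination of the \<open>x v\<close>, \<open>f\<close> acts null-homotopically, so
  the connecting map from degree \<open>i - 1\<close> modulo \<open>adjoin J f\<close> to degree
  \<open>i\<close> modulo \<open>J\<close> is onto. For \<open>i = 0\<close> there is no previous
  degree, and \<open>ex\<close> is phrased accordingly.\<close>

lemma koszul_exact_lift:
  assumes J: "is_ideal J" and f: "f \<in> linear_forms" and nzd: "nonzerodivisor_mod f J"
    and ex: "\<And>k. i = Suc k \<Longrightarrow> koszul_exact k (adjoin J f)"
  shows "koszul_exact i J"
  unfolding koszul_exact_def
proof (intro allI impI, elim conjE)
  fix z assume z: "\<forall>S. z S \<in> C" "\<forall>S\<subseteq>X. card S = Suc i \<longrightarrow> koszul_d x z S \<in> J"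
  obtain r where r: "f = (\<Sum>v\<in>X. r v * x v)" "\<And>v. v \<in> X \<Longrightarrow> r v \<in> C"
    using f by (auto simp: linear_forms_def)
  have fC: "f \<in> C" unfolding r using r(2) x_mem by (intro sum_mem mult_mem) auto
  \<comment> \<open>The image of \<open>z\<close> under the homotopy for \<open>f\<close>; as
    \<open>z\<close> is a cocycle modulo \<open>J\<close>, the differential of \<open>w\<close>
    agrees with \<open>f * z\<close> modulo \<open>J\<close>.\<close>
  define w where "w S = (\<Sum>v\<in>X. r v * koszul_h v z S)" for S
  have w: "w S \<in> C" for S
    unfolding w_def koszul_h_def using r(2) z by (auto intro!: sum_mem mult_mem simp: osign_mem zero_mem)
  have dw: "koszul_d x w S - f * z S \<in> J" if S: "S \<subseteq> X" "card S = i" for S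
  proof -
    have fin: "finite S" using S finite_subset_X by auto
    have "koszul_d x w S = (\<Sum>v\<in>X. r v * koszul_d x (koszul_h v z) S)"
      unfolding koszul_d_def w_def sum_distrib_left by (subst sum.swap) (simp add: mult_ac)
    also have "\<dots> = (\<Sum>v\<in>X. r v * (x v * z S - koszul_h v (koszul_d x z) S))"
    proof (rule sum.cong)
      fix v
      have "koszul_d x (koszul_h v z) S = x v * z S - koszul_h v (koszul_d x z) S"
        using koszul_homotopy[OF fin, of x v z] by (simp add: eq_diff_eq)
      then show "r v * koszul_d x (koszul_h v z) S = r v * (x v * z S - koszul_h v (koszul_d x z) S)"
        by simp
    qed simp
    also have "\<dots> = f * z S - (\<Sum>v\<in>X. r v * koszul_h v (koszul_d x z) S)"
      by (simp add: r(1) right_diff_distrib sum_subtractf sum_distrib_right mult.assoc)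
    finally have "koszul_d x w S - f * z S = - (\<Sum>v\<in>X. r v * koszul_h v (koszul_d x z) S)"
      by simp
    also have "\<dots> \<in> J"
    proof (rule is_idealD(6)[OF J], rule ideal_sum_mem[OF J], rule is_idealD(4)[OF J])
      fix v assume v: "v \<in> X"
      then show "r v \<in> C" by (rule r)
      show "koszul_h v (koszul_d x z) S \<in> J"
        using v S fin z(2)[rule_format, of "insert v S"]
        by (auto simp: koszul_h_def intro!: is_idealD(2,4)[OF J] osign_mem)
    qed
    finally show ?thesis .
  qed
  show "\<exists>y. (\<forall>S. y S \<in> C) \<and> (\<forall>S\<subseteq>X. card S = i \<longrightarrow> z S - koszul_d x y S \<in> J)"
  proof (cases i)
    case 0
    have "z S \<in> J" if S: "S \<subseteq> X" "card S = i" for S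
    proof -
      have "S = {}" using S 0 finite_subset_X by auto
      then have "- (f * z S) \<in> J" using dw[OF S] by (simp add: koszul_d_def)
      then have "f * z S \<in> J" using is_idealD(6)[OF J] by fastforce
      then show ?thesis using nzd z by (simp add: nonzerodivisor_mod_def)
    qed
    then show ?thesis
      using zero_mem by (intro exI[of _ "\<lambda>_. 0"]) (auto simp: koszul_d_def)
  next
    case (Suc k)
    let ?J = "adjoin J f"
    have J': "is_ideal ?J" by (rule adjoin_ideal[OF J fC])
    have "koszul_d x w S \<in> ?J" if "S \<subseteq> X" "card S = Suc k" for S
      using adjoinI[OF dw[of S], of "z S" f] that Suc z by (simp add: mult.commute)
    then obtain u where u: "\<forall>S. u S \<in> C" "\<forall>S\<subseteq>X. card S = k \<longrightarrow> w S - koszul_d x u S \<in> ?J"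
      using ex[OF Suc] w unfolding koszul_exact_def by blast
    have "\<forall>S. \<exists>t. t \<in> C \<and> (S \<subseteq> X \<and> card S = k \<longrightarrow> w S - koszul_d x u S - f * t \<in> J)"
    proof
      fix S
      show "\<exists>t. t \<in> C \<and> (S \<subseteq> X \<and> card S = k \<longrightarrow> w S - koszul_d x u S - f * t \<in> J)"
      proof (cases "S \<subseteq> X \<and> card S = k")
        case True
        then obtain a t where "w S - koszul_d x u S = a + t * f" "a \<in> J" "t \<in> C"
          using u by (auto simp: adjoin_def)
        then show ?thesis by (intro exI[of _ t]) (simp add: mult.commute)
      qed (use zero_mem in blast)
    qed
    then obtain t where t: "\<And>S. t S \<in> C"
      "\<And>S. S \<subseteq> X \<Longrightarrow> card S = k \<Longrightarrow> w S - koszul_d x u S - f * t S \<in> J"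
      by metis
    \<comment> \<open>Applying the differential d to \<open>w = d u + f t\<close> modulo
      \<open>J\<close> gives \<open>d w = f d t\<close>; comparison with \<open>d w = f z\<close>
      allows \<open>f\<close> to be cancelled.\<close>
    have "z S - koszul_d x t S \<in> J" if S: "S \<subseteq> X" "card S = i" for S
    proof -
      have fin: "finite S" using S finite_subset_X by auto
      have "koszul_d x (\<lambda>S. w S - koszul_d x u S - f * t S) S \<in> J"
        using S Suc by (intro koszul_d_mem J t) (auto simp: fin)
      then have "koszul_d x w S - f * koszul_d x t S \<in> J"
        using koszul_d_koszul_d[OF fin, of x u] by (simp add: koszul_d_diff koszul_d_mult)
      from is_idealD(7)[OF J this dw[OF S]]
      have "f * (z S - koszul_d x t S) \<in> J"
        by (simp add: algebra_simps)
      moreover have "z S - koszul_d x t S \<in> C"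
        using z t S koszul_d_mem[OF ideal_C] by (intro diff_mem) auto
      ultimately show ?thesis using nzd by (simp add: nonzerodivisor_mod_def)
    qed
    then show ?thesis using t by blast
  qed
qed

text \<open>The piece of the long exact sequence of multiplication by \<open>f\<close> in which
  degree \<open>i\<close> modulo \<open>adjoin J f\<close> stands between degrees \<open>i\<close>
  and \<open>Suc i\<close> modulo \<open>J\<close>.\<close>

lemma koszul_exact_quotient:
  assumes J: "is_ideal J" and f: "f \<in> C" and nzd: "nonzerodivisor_mod f J"
    and ex: "koszul_exact i J" "koszul_exact (Suc i) J"
  shows "koszul_exact i (adjoin J f)"
  unfolding koszul_exact_def
proof (intro allI impI, elim conjE)
  let ?J = "adjoin J f"
  fix z assume z: "\<forall>S. z S \<in> C" "\<forall>S\<subseteq>X. card S = Suc i \<longrightarrow> koszul_d x z S \<in> ?J"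
  have "\<forall>S. \<exists>t. t \<in> C \<and> (S \<subseteq> X \<and> card S = Suc i \<longrightarrow> koszul_d x z S - f * t \<in> J)"
  proof
    fix S
    show "\<exists>t. t \<in> C \<and> (S \<subseteq> X \<and> card S = Suc i \<longrightarrow> koszul_d x z S - f * t \<in> J)"
    proof (cases "S \<subseteq> X \<and> card S = Suc i")
      case True
      then obtain a t where "koszul_d x z S = a + t * f" "a \<in> J" "t \<in> C"
        using z by (auto simp: adjoin_def)
      then show ?thesis by (intro exI[of _ t]) (simp add: mult.commute)
    qed (use zero_mem in blast)
  qed
  then obtain w where w: "\<And>S. w S \<in> C"
    "\<And>S. S \<subseteq> X \<Longrightarrow> card S = Suc i \<Longrightarrow> koszul_d x z S - f * w S \<in> J"
    by metis
  \<comment> \<open>\<open>w\<close> represents the image of \<open>z\<close> under the connecting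
    map; it is a cocycle because \<open>f\<close> can be cancelled.\<close>
  have dw: "koszul_d x w S \<in> J" if S: "S \<subseteq> X" "card S = Suc (Suc i)" for S
  proof -
    have fin: "finite S" using S finite_subset_X by auto
    have "koszul_d x (\<lambda>S. koszul_d x z S - f * w S) S \<in> J"
      using S by (intro koszul_d_mem J w) (auto simp: fin)
    then have "- (f * koszul_d x w S) \<in> J"
      using koszul_d_koszul_d[OF fin, of x z] by (simp add: koszul_d_diff koszul_d_mult)
    then have "f * koszul_d x w S \<in> J" using is_idealD(6)[OF J] by fastforce
    moreover have "koszul_d x w S \<in> C" using w S koszul_d_mem[OF ideal_C] by auto
    ultimately show ?thesis using nzd by (simp add: nonzerodivisor_mod_def)
  qed
  have "\<exists>u. (\<forall>S. u S \<in> C) \<and> (\<forall>S\<subseteq>X. card S = Suc i \<longrightarrow> w S - koszul_d x u S \<in> J)"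
    by (rule ex(2)[unfolded koszul_exact_def, rule_format]) (use w(1) dw in blast)
  then obtain u where u: "\<forall>S. u S \<in> C" "\<forall>S\<subseteq>X. card S = Suc i \<longrightarrow> w S - koszul_d x u S \<in> J"
    by blast
  \<comment> \<open>Subtracting \<open>f * u\<close>, which is zero modulo
    \<open>adjoin J f\<close>, turns \<open>z\<close> into a cocycle modulo
    \<open>J\<close>.\<close>
  have "koszul_d x (\<lambda>S. z S - f * u S) S \<in> J" if S: "S \<subseteq> X" "card S = Suc i" for S
  proof -
    have "(koszul_d x z S - f * w S) + f * (w S - koszul_d x u S) \<in> J"
      using w(2)[OF S] u(2) S f is_idealD(3,4)[OF J] by blast
    moreover have "koszul_d x (\<lambda>S. z S - f * u S) S =
        (koszul_d x z S - f * w S) + f * (w S - koszul_d x u S)"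
      unfolding koszul_d_diff koszul_d_mult by (simp add: right_diff_distrib)
    ultimately show ?thesis by simp
  qed
  moreover have "z S - f * u S \<in> C" for S using z u f by (intro diff_mem mult_mem) auto
  ultimately obtain y where y: "\<forall>S. y S \<in> C" "\<forall>S\<subseteq>X. card S = i \<longrightarrow> z S - f * u S - koszul_d x y S \<in> J"
    using ex(1)[unfolded koszul_exact_def, rule_format, of "\<lambda>S. z S - f * u S"] by blast
  have "z S - koszul_d x y S \<in> ?J" if "S \<subseteq> X" "card S = i" for S
    using adjoinI[of "z S - f * u S - koszul_d x y S" J "u S" f] y u that
    by (simp add: mult.commute algebra_simps)
  then show "\<exists>y. (\<forall>S. y S \<in> C) \<and> (\<forall>S\<subseteq>X. card S = i \<longrightarrow> z S - koszul_d x y S \<in> ?J)"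
    using y by blast
qed

lemma linear_forms_subset: "linear_forms \<subseteq> C"
  using x_mem by (auto simp: linear_forms_def intro!: sum_mem mult_mem)

text \<open>Induction on \<open>d\<close>, trading \<open>J\<close> for \<open>adjoin J f\<close>;
  this is why \<open>avoid\<close> is required of every ideal.\<close>

theorem koszul_depth:
  assumes avoid: "\<And>J. is_ideal J \<Longrightarrow> koszul_exact 0 J \<Longrightarrow> \<exists>f\<in>linear_forms. nonzerodivisor_mod f J"
    and "is_ideal J"
  shows "(\<forall>i<d. koszul_exact i J) \<longleftrightarrow> (\<exists>fs. length fs = d \<and> set fs \<subseteq> linear_forms \<and> regular_mod J fs)"
  using assms(2)
proof (induction d arbitrary: J)
  case 0
  then show ?case by simp
next
  case (Suc d)
  show ?case
  proof
    assume ex: "\<forall>i<Suc d. koszul_exact i J"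
    then obtain f where f: "f \<in> linear_forms" "nonzerodivisor_mod f J"
      using avoid[OF Suc.prems] by blast
    have fC: "f \<in> C" using f linear_forms_subset by blast
    have "\<forall>i<d. koszul_exact i (adjoin J f)"
      using koszul_exact_quotient[OF Suc.prems fC f(2)] ex by auto
    then obtain fs where "length fs = d" "set fs \<subseteq> linear_forms" "regular_mod (adjoin J f) fs"
      using Suc.IH[OF adjoin_ideal[OF Suc.prems fC]] by blast
    then show "\<exists>fs. length fs = Suc d \<and> set fs \<subseteq> linear_forms \<and> regular_mod J fs"
      using f by (intro exI[of _ "f # fs"]) auto
  next
    assume "\<exists>fs. length fs = Suc d \<and> set fs \<subseteq> linear_forms \<and> regular_mod J fs"
    then obtain f fs where fs: "length fs = d" "set fs \<subseteq> linear_forms" "f \<in> linear_forms"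
      "nonzerodivisor_mod f J" "regular_mod (adjoin J f) fs"
      by (auto simp: length_Suc_conv)
    have fC: "f \<in> C" using fs linear_forms_subset by blast
    have ex: "\<forall>i<d. koszul_exact i (adjoin J f)"
      using Suc.IH[OF adjoin_ideal[OF Suc.prems fC]] fs by blast
    show "\<forall>i<Suc d. koszul_exact i J"
    proof (intro allI impI)
      fix i assume "i < Suc d"
      then show "koszul_exact i J"
        using ex by (intro koszul_exact_lift[OF Suc.prems fs(3,4)]) auto
    qed
  qed
qed

end

section \<open>Associated primes and prime avoidance\<close>

context comm_subring
begin

definition is_prime :: "'a set \<Rightarrow> bool" where
  "is_prime P \<longleftrightarrow> is_ideal P \<and> 1 \<notin> P \<and> (\<forall>a\<in>C. \<forall>b\<in>C. a * b \<in> P \<longrightarrow> a \<in> P \<or> b \<in> P)"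

lemma is_primeD:
  assumes "is_prime P"
  shows "is_ideal P" "1 \<notin> P" "\<And>a b. a \<in> C \<Longrightarrow> b \<in> C \<Longrightarrow> a * b \<in> P \<Longrightarrow> a \<in> P \<or> b \<in> P"
  using assms by (auto simp: is_prime_def)

definition colon :: "'a set \<Rightarrow> 'a \<Rightarrow> 'a set" where
  "colon J g = {r \<in> C. r * g \<in> J}"

definition assoc_primes :: "'a set \<Rightarrow> 'a set set" where
  "assoc_primes J = {P. is_prime P \<and> (\<exists>g\<in>C. P = colon J g)}"

lemma colon_ideal: "is_ideal J \<Longrightarrow> g \<in> C \<Longrightarrow> is_ideal (colon J g)"
  unfolding is_ideal_def colon_def
  by (auto simp: zero_mem add_mem mult_mem distrib_right mult.assoc)

text \<open>A product of elements chosen from the ideals in \<open>A\<close> outside the prime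
  \<open>P\<close> stays outside \<open>P\<close>.\<close>

lemma exists_notin_prime:
  assumes "is_prime P" "finite A" "\<And>Q. Q \<in> A \<Longrightarrow> is_ideal Q \<and> \<not> Q \<subseteq> P"
  shows "\<exists>q\<in>C. q \<notin> P \<and> (\<forall>Q\<in>A. q \<in> Q)"
  using assms(2,3)
proof (induction A)
  case empty
  then show ?case using is_primeD(2)[OF assms(1)] one_mem by auto
next
  case (insert Q A)
  obtain q where q: "q \<in> C" "q \<notin> P" "\<forall>Q\<in>A. q \<in> Q"
    using insert.IH insert.prems by auto
  have Q: "is_ideal Q" using insert.prems by auto
  obtain s where s: "s \<in> Q" "s \<notin> P" using insert.prems by auto
  have sC: "s \<in> C" using s is_idealD(1)[OF Q] by auto
  have "q * s \<notin> P" using is_primeD(3)[OF assms(1) q(1) sC] q s by auto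
  moreover have "q * s \<in> Q" using is_idealD(4)[OF Q q(1) s(1)] .
  moreover have "q * s \<in> Q'" if "Q' \<in> A" for Q'
    using is_idealD(5)[OF _ sC, of Q'] insert.prems that q by auto
  ultimately show ?case using mult_mem[OF q(1) sC] by blast
qed

text \<open>A prime contained in another member of \<open>A\<close> may be dropped. In an antichain,
  an element that avoids all primes but \<open>P\<close> and happens to lie in \<open>P\<close> is
  corrected by an element of \<open>M\<close> that lies in all the other primes but not in
  \<open>P\<close>.\<close>

lemma prime_avoidance:
  assumes "is_ideal M" "finite A" "\<And>P. P \<in> A \<Longrightarrow> is_prime P \<and> \<not> M \<subseteq> P"
  shows "\<exists>f\<in>M. \<forall>P\<in>A. f \<notin> P"
  using assms(2,3)
proof (induction A rule: finite_psubset_induct)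
  case (psubset A)
  show ?case
  proof (cases "A = {}")
    case True
    then show ?thesis using is_idealD(2)[OF assms(1)] by auto
  next
    case False
    show ?thesis
    proof (cases "\<exists>P\<in>A. \<exists>Q\<in>A. Q \<subset> P")
      case True
      then obtain P Q where PQ: "P \<in> A" "Q \<in> A" "Q \<subset> P" by auto
      then have "\<exists>f\<in>M. \<forall>P\<in>A - {Q}. f \<notin> P"
        using psubset.prems by (intro psubset.IH) auto
      then show ?thesis using PQ by blast
    next
      case antichain: False
      obtain P where P: "P \<in> A" using False by auto
      then have "\<exists>f\<in>M. \<forall>P\<in>A - {P}. f \<notin> P"
        using psubset.prems by (intro psubset.IH) auto
      then obtain f where f: "f \<in> M" "\<forall>Q\<in>A - {P}. f \<notin> Q" by auto
      show ?thesis
      proof (cases "f \<in> P")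
        case False
        then show ?thesis using f by auto
      next
        case True
        have "\<exists>q\<in>C. q \<notin> P \<and> (\<forall>Q\<in>insert M (A - {P}). q \<in> Q)"
          using psubset.prems P psubset.hyps antichain assms(1)
          by (intro exists_notin_prime) (auto dest: is_primeD(1))
        then obtain q where q: "q \<notin> P" "q \<in> M" "\<And>Q. Q \<in> A - {P} \<Longrightarrow> q \<in> Q" by auto
        have "f + q \<notin> Q" if "Q \<in> A" for Q
        proof (cases "Q = P")
          case True
          then show ?thesis
            using is_idealD(7)[of P "f + q" f] \<open>f \<in> P\<close> q(1) psubset.prems[OF P] is_primeD(1) by auto
        next
          case False
          then show ?thesis
            using is_idealD(7)[of Q "f + q" q] q(3)[of Q] f(2) psubset.prems[OF that] is_primeD(1) that
            by auto
        qed
        then show ?thesis using is_idealD(3)[OF assms(1) f(1) q(2)] by auto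
      qed
    qed
  qed
qed

end

text \<open>The ascending chain condition as well-foundedness of reverse inclusion: it yields
  maximal members of families of ideals as well as Noetherian induction.\<close>

locale noetherian_subring = comm_subring C for C :: "'a::comm_ring_1 set" +
  assumes wf_ideals: "wf {(J', J). is_ideal J \<and> is_ideal J' \<and> J \<subset> J'}"
begin

text \<open>A maximal member among the annihilators of nonzero classes killed by \<open>r\<close> is
  prime, and it contains \<open>r\<close> by the choice of the family.\<close>

lemma zero_divisor_assoc_prime:
  assumes J: "is_ideal J" and r: "r \<in> C" "g \<in> C" "g \<notin> J" "r * g \<in> J"
  shows "\<exists>P\<in>assoc_primes J. r \<in> P"
proof -
  define Q where "Q = {colon J h | h. h \<in> C \<and> h \<notin> J \<and> r * h \<in> J}"
  have "colon J g \<in> Q" using r by (auto simp: Q_def)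
  then obtain P where P: "P \<in> Q"
    "\<And>I. (I, P) \<in> {(J', J). is_ideal J \<and> is_ideal J' \<and> J \<subset> J'} \<Longrightarrow> I \<notin> Q"
    by (rule wfE_min[OF wf_ideals]) blast
  then obtain h where h: "P = colon J h" "h \<in> C" "h \<notin> J" "r * h \<in> J"
    by (auto simp: Q_def)
  have idP: "is_ideal P" using h J by (simp add: colon_ideal)
  have "is_prime P"
    unfolding is_prime_def
  proof (intro conjI ballI impI idP)
    show "1 \<notin> P" using h by (simp add: colon_def)
  next
    fix a b assume ab: "a \<in> C" "b \<in> C" "a * b \<in> P"
    show "a \<in> P \<or> b \<in> P"
    proof (rule disjCI)
      assume "b \<notin> P"
      then have "b * h \<notin> J" using h ab by (simp add: colon_def)
      moreover have "r * (b * h) \<in> J"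
        using is_idealD(4)[OF J ab(2) h(4)] by (simp add: mult_ac)
      ultimately have "colon J (b * h) \<in> Q" using ab h by (auto simp: Q_def mult_mem)
      moreover have "P \<subseteq> colon J (b * h)"
        using is_idealD(4)[OF J ab(2)] by (auto simp: h(1) colon_def mult.left_commute[of _ b])
      ultimately have "P = colon J (b * h)"
        using P(2)[of "colon J (b * h)"] idP J ab h by (auto simp: colon_ideal mult_mem)
      moreover have "a \<in> colon J (b * h)"
        using ab by (simp add: h(1) colon_def mult_ac)
      ultimately show "a \<in> P" by simp
    qed
  qed
  then show ?thesis using h r by (auto simp: assoc_primes_def colon_def)
qed

text \<open>Noetherian induction: if \<open>colon J g\<close> is an associated prime of \<open>J\<close>, every other one is
  associated to \<open>adjoin J g\<close>.\<close>

lemma finite_assoc_primes: "is_ideal J \<Longrightarrow> finite (assoc_primes J)"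
proof (induction J rule: wf_induct_rule[OF wf_ideals])
  case (1 J)
  note J = 1(2)
  show ?case
  proof (cases "1 \<in> J")
    case True
    then have "colon J g = C" if "g \<in> C" for g
      using is_idealD(5)[OF J _ True] that by (auto simp: colon_def mult_mem)
    then have "assoc_primes J = {}"
      using one_mem by (auto simp: assoc_primes_def is_prime_def)
    then show ?thesis by simp
  next
    case False
    then obtain P where "P \<in> assoc_primes J"
      using zero_divisor_assoc_prime[OF J zero_mem one_mem] is_idealD(2)[OF J] by auto
    then obtain g where P: "is_prime P" "g \<in> C" "P = colon J g"
      by (auto simp: assoc_primes_def)
    have g: "g \<notin> J" using P one_mem by (auto simp: is_prime_def colon_def)
    let ?J = "adjoin J g"
    have J': "is_ideal ?J" by (rule adjoin_ideal[OF J P(2)])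
    have "J \<subset> ?J" using subset_adjoin adjoin_self[OF J] g by blast
    then have fin: "finite (assoc_primes ?J)" using 1 J' by auto
    have "assoc_primes J \<subseteq> insert P (assoc_primes ?J)"
    proof
      fix Q assume "Q \<in> assoc_primes J"
      then obtain h where Q: "is_prime Q" "h \<in> C" "Q = colon J h"
        by (auto simp: assoc_primes_def)
      show "Q \<in> insert P (assoc_primes ?J)"
      proof (cases "Q = colon ?J h")
        case True
        then show ?thesis using Q by (auto simp: assoc_primes_def)
      next
        case False
        then obtain r where r: "r \<in> C" "r \<notin> Q" "r * h \<in> ?J"
          using Q subset_adjoin[of J g] by (auto simp: colon_def)
        then obtain j a where a: "r * h = j + a * g" "j \<in> J" "a \<in> C"
          by (auto simp: adjoin_def)
        have rh: "r * h \<notin> J" using r Q by (auto simp: colon_def)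
        have "a \<notin> P"
        proof
          assume "a \<in> P"
          then have "j + a * g \<in> J" using P a is_idealD(3)[OF J] by (auto simp: colon_def)
          then show False using rh a by simp
        qed
        \<comment> \<open>The common class of \<open>r * h\<close> and \<open>a * g\<close> modulo
          \<open>J\<close> has annihilator \<open>Q\<close>, because \<open>r\<close> is outside the
          prime \<open>Q\<close>, and annihilator \<open>P\<close>, because \<open>a\<close> is
          outside the prime \<open>P\<close>.\<close>
        have "s \<in> Q \<longleftrightarrow> s \<in> P" if s: "s \<in> C" for s
        proof -
          have "s \<in> Q \<longleftrightarrow> s * r \<in> Q"
            using is_primeD(3)[OF Q(1) s r(1)] is_idealD(5)[OF is_primeD(1)[OF Q(1)] r(1)] r(2) by blast
          also have "\<dots> \<longleftrightarrow> s * (r * h) \<in> J"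
            using s r Q by (simp add: colon_def mult_mem mult.assoc)
          also have "\<dots> \<longleftrightarrow> s * a * g \<in> J"
          proof -
            have sj: "s * j \<in> J" using is_idealD(4)[OF J s a(2)] .
            have eq: "s * (r * h) = s * j + s * a * g" unfolding a(1) by (simp add: algebra_simps)
            show ?thesis
              unfolding eq using is_idealD(3)[OF J sj, of "s * a * g"] is_idealD(7)[OF J _ sj, of "s * j + s * a * g"]
              by auto
          qed
          also have "\<dots> \<longleftrightarrow> s * a \<in> P"
            using s a P by (simp add: colon_def mult_mem)
          also have "\<dots> \<longleftrightarrow> s \<in> P"
            using is_primeD(3)[OF P(1) s a(3)] is_idealD(5)[OF is_primeD(1)[OF P(1)] a(3)] \<open>a \<notin> P\<close> by blast
          finally show ?thesis .
        qed
        moreover have "Q \<subseteq> C" "P \<subseteq> C" using P Q by (auto simp: colon_def)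
        ultimately have "Q = P" by blast
        then show ?thesis by simp
      qed
    qed
    then show ?thesis using fin finite_subset by blast
  qed
qed

text \<open>If \<open>M\<close> were contained in an associated prime, it would annihilate a nonzero
  class. So an element of \<open>M\<close> avoids the finitely many associated primes, and these
  contain all zero divisors modulo \<open>J\<close>.\<close>

lemma exists_nonzerodivisor:
  assumes J: "is_ideal J" and M: "is_ideal M"
    and *: "\<And>g. g \<in> C \<Longrightarrow> (\<And>m. m \<in> M \<Longrightarrow> m * g \<in> J) \<Longrightarrow> g \<in> J"
  shows "\<exists>f\<in>M. nonzerodivisor_mod f J"
proof -
  have "\<exists>f\<in>M. \<forall>P\<in>assoc_primes J. f \<notin> P"
  proof (rule prime_avoidance[OF M finite_assoc_primes[OF J]])
    fix P assume "P \<in> assoc_primes J"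
    then obtain g where P: "is_prime P" "g \<in> C" "P = colon J g"
      by (auto simp: assoc_primes_def)
    have "\<not> M \<subseteq> P"
    proof
      assume "M \<subseteq> P"
      have "g \<in> J"
      proof (rule *)
        show "g \<in> C" by (rule P)
        fix m assume "m \<in> M"
        then show "m * g \<in> J" using \<open>M \<subseteq> P\<close> P by (auto simp: colon_def)
      qed
      then have "1 \<in> P" using P one_mem by (simp add: colon_def)
      then show False using P by (simp add: is_prime_def)
    qed
    then show "is_prime P \<and> \<not> M \<subseteq> P" using P by simp
  qed
  then obtain f where f: "f \<in> M" "\<forall>P\<in>assoc_primes J. f \<notin> P" by auto
  then have "nonzerodivisor_mod f J"
    unfolding nonzerodivisor_mod_def
  proof (intro ballI impI)
    fix g assume "g \<in> C" "f * g \<in> J"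
    then show "g \<in> J"
      using zero_divisor_assoc_prime[OF J is_idealD(1)[OF M f(1)], of g] f(2) by blast
  qed
  then show ?thesis using f by auto
qed

end

lemma (in koszul) linear_forms_ideal: "is_ideal linear_forms"
  unfolding is_ideal_def
proof (intro conjI ballI)
  show "linear_forms \<subseteq> C" by (rule linear_forms_subset)
  show "0 \<in> linear_forms"
    unfolding linear_forms_def by (auto intro!: exI[of _ "\<lambda>_. 0"] simp: zero_mem)
next
  fix a b assume "a \<in> linear_forms" "b \<in> linear_forms"
  then obtain r s where "a = (\<Sum>v\<in>X. r v * x v)" "b = (\<Sum>v\<in>X. s v * x v)" "\<forall>v\<in>X. r v \<in> C" "\<forall>v\<in>X. s v \<in> C"
    by (auto simp: linear_forms_def)
  then show "a + b \<in> linear_forms"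
    unfolding linear_forms_def
    by (auto intro!: exI[of _ "\<lambda>v. r v + s v"] simp: add_mem distrib_right sum.distrib)
next
  fix c a assume "a \<in> linear_forms" "c \<in> C"
  then obtain r where "a = (\<Sum>v\<in>X. r v * x v)" "\<forall>v\<in>X. r v \<in> C" "c \<in> C"
    by (auto simp: linear_forms_def)
  then show "c * a \<in> linear_forms"
    unfolding linear_forms_def
    by (auto intro!: exI[of _ "\<lambda>v. c * r v"] simp: mult_mem sum_distrib_left mult.assoc)
qed

lemma (in koszul) var_in_linear_forms:
  assumes "v \<in> X"
  shows "x v \<in> linear_forms"
proof -
  have "(\<Sum>w\<in>X. (if w = v then 1 else 0) * x w) = (\<Sum>w\<in>X. if w = v then x w else 0)"
    by (rule sum.cong) auto
  also have "\<dots> = x v" using assms finite_X by simp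
  finally show ?thesis
    unfolding linear_forms_def
    by (intro CollectI exI[of _ "\<lambda>w. if w = v then 1 else 0"]) (auto simp: zero_mem one_mem)
qed

locale noetherian_koszul = koszul + noetherian_subring
begin

theorem koszul_depth_noetherian:
  assumes "is_ideal J"
  shows "(\<forall>i<d. koszul_exact i J) \<longleftrightarrow> (\<exists>fs. length fs = d \<and> set fs \<subseteq> linear_forms \<and> regular_mod J fs)"
proof (rule koszul_depth[OF _ assms])
  fix J assume J: "is_ideal J" "koszul_exact 0 J"
  show "\<exists>f\<in>linear_forms. nonzerodivisor_mod f J"
  proof (rule exists_nonzerodivisor[OF J(1) linear_forms_ideal])
    fix g assume "g \<in> C" "\<And>m. m \<in> linear_forms \<Longrightarrow> m * g \<in> J"
    then show "g \<in> J"
      using J koszul_exact_0[OF J(1)] var_in_linear_forms by blast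
  qed
qed

end

section \<open>The Hilbert basis theorem\<close>

text \<open>There is a monotone subsequence; if it decreases, it is constant once it has reached its
  least value.\<close>

lemma nat_incseq_subseq:
  fixes f :: "nat \<Rightarrow> nat"
  shows "\<exists>s. strict_mono s \<and> incseq (\<lambda>k. f (s k))"
proof -
  obtain s where s: "strict_mono s" "monoseq (\<lambda>k. f (s k))"
    using seq_monosub[of f] by auto
  show ?thesis
  proof (cases "incseq (\<lambda>k. f (s k))")
    case True
    then show ?thesis using s by auto
  next
    case False
    then have dec: "decseq (\<lambda>k. f (s k))" using s(2) by (simp add: monoseq_iff)
    obtain k0 where k0: "\<And>k. f (s k0) \<le> f (s k)"
      using ex_has_least_nat[of "\<lambda>_. True" 0 "\<lambda>k. f (s k)"] by auto
    have "f (s (k0 + k)) = f (s k0)" for k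
      using k0[of "k0 + k"] decseqD[OF dec, of k0 "k0 + k"] by simp
    then have "incseq (\<lambda>k. f (s (k0 + k)))" by (simp add: incseq_def)
    moreover have "strict_mono (\<lambda>k. s (k0 + k))" using s(1) by (simp add: strict_mono_def)
    ultimately show ?thesis by (intro exI[of _ "\<lambda>k. s (k0 + k)"]) simp
  qed
qed

text \<open>Coordinates are treated one at a time: those already monotone stay so on a further
  subsequence.\<close>

lemma dickson:
  fixes e :: "nat \<Rightarrow> 'v \<Rightarrow> nat"
  assumes "finite V"
  shows "\<exists>r. strict_mono r \<and> (\<forall>v\<in>V. incseq (\<lambda>k. e (r k) v))"
  using assms
proof (induction V rule: finite_induct)
  case empty
  then show ?case by (auto intro: exI[of _ id] simp: strict_mono_def)
next
  case (insert v V)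
  then obtain r where r: "strict_mono r" "\<forall>v\<in>V. incseq (\<lambda>k. e (r k) v)" by auto
  obtain s where s: "strict_mono s" "incseq (\<lambda>k. e (r (s k)) v)"
    using nat_incseq_subseq[of "\<lambda>k. e (r k) v"] by auto
  have "incseq (\<lambda>k. e (r (s k)) w)" if "w \<in> V" for w
    using r(2) that s(1) by (auto simp: incseq_def strict_mono_less_eq)
  moreover have "strict_mono (\<lambda>k. r (s k))" using r(1) s(1) by (simp add: strict_mono_def)
  ultimately show ?case using s by (intro exI[of _ "\<lambda>k. r (s k)"]) auto
qed

section \<open>Polynomial rings and the lexicographic monomial order\<close>

definition polys :: "'v set \<Rightarrow> (('v \<Rightarrow>\<^sub>0 nat) \<Rightarrow>\<^sub>0 'k::comm_ring_1) set" where
  "polys V = {p. \<forall>m \<in> Poly_Mapping.keys p. Poly_Mapping.keys m \<subseteq> V}"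

lemma keys_add_nat: "Poly_Mapping.keys (a + b :: 'v \<Rightarrow>\<^sub>0 nat) = Poly_Mapping.keys a \<union> Poly_Mapping.keys b"
  by (auto simp: in_keys_iff lookup_add)

lemma keys_mult_subset:
  "m \<in> Poly_Mapping.keys (p * q) \<Longrightarrow>
    \<exists>a b. a \<in> Poly_Mapping.keys p \<and> b \<in> Poly_Mapping.keys q \<and> m = a + b"
  using keys_mult[of p q] by blast

lemma comm_subring_polys:
  "comm_subring (polys V :: (('v \<Rightarrow>\<^sub>0 nat) \<Rightarrow>\<^sub>0 'k::comm_ring_1) set)"
proof
  show "1 \<in> (polys V :: (('v \<Rightarrow>\<^sub>0 nat) \<Rightarrow>\<^sub>0 'k) set)" by (simp add: polys_def)
  fix p q :: "('v \<Rightarrow>\<^sub>0 nat) \<Rightarrow>\<^sub>0 'k" assume p: "p \<in> polys V" and q: "q \<in> polys V"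
  show "p + q \<in> polys V" using p q keys_add[of p q] by (auto simp: polys_def)
  show "p * q \<in> polys V"
    using p q by (fastforce simp: polys_def keys_add_nat dest!: keys_mult_subset)
next
  fix p :: "('v \<Rightarrow>\<^sub>0 nat) \<Rightarrow>\<^sub>0 'k" assume "p \<in> polys V"
  then show "- p \<in> polys V" by (auto simp: polys_def in_keys_iff)
qed

text \<open>The order on exponents compares values at the smallest index where they differ. With its
  compatibility with addition, this makes it a monomial order.\<close>

lemma poly_mapping_nat_nonneg: "(0 :: 'v::linorder \<Rightarrow>\<^sub>0 nat) \<le> d"
proof (rule ccontr)
  assume "\<not> ?thesis"
  then have "d < 0" by simp
  then show False by (simp add: less_poly_mapping.rep_eq less_fun_def)
qed

lemma poly_mapping_le_add_diff:
  fixes a b :: "'v \<Rightarrow>\<^sub>0 nat"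
  assumes "\<And>v. Poly_Mapping.lookup a v \<le> Poly_Mapping.lookup b v"
  shows "a + (b - a) = b"
  using assms by (intro poly_mapping_eqI) (simp add: lookup_add lookup_minus)

text \<open>Subtraction of exponents is truncated, so the equation says that the monomial of
  \<open>e i\<close> divides the one of \<open>e j\<close>.\<close>

lemma dickson_exponents:
  fixes e :: "nat \<Rightarrow> ('v \<Rightarrow>\<^sub>0 nat)"
  assumes "finite V" "\<And>k. Poly_Mapping.keys (e k) \<subseteq> V"
  shows "\<exists>i j. i < j \<and> e i + (e j - e i) = e j"
proof -
  obtain r where r: "strict_mono r" "\<forall>v\<in>V. incseq (\<lambda>k. Poly_Mapping.lookup (e (r k)) v)"
    using dickson[OF assms(1), of "\<lambda>k. Poly_Mapping.lookup (e k)"] by auto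
  have "Poly_Mapping.lookup (e (r 0)) v \<le> Poly_Mapping.lookup (e (r 1)) v" for v
  proof (cases "v \<in> V")
    case True
    then show ?thesis using r(2) incseqD[of "\<lambda>k. Poly_Mapping.lookup (e (r k)) v" 0 1] by auto
  next
    case False
    then have "v \<notin> Poly_Mapping.keys (e (r 0))" using assms(2) by blast
    then show ?thesis by (simp add: in_keys_iff)
  qed
  moreover have "r 0 < r 1" using r(1) by (simp add: strict_mono_def)
  ultimately show ?thesis using poly_mapping_le_add_diff by blast
qed

text \<open>In a descending chain, Dickson's lemma finds an exponent dividing a later one, hence not
  exceeding it. The finite set \<open>V\<close> matters: the single variables of increasing index
  can form an infinite descending chain.\<close>

lemma wf_exponents:
  assumes "finite V"
  shows "wf {(a, b :: 'v::linorder \<Rightarrow>\<^sub>0 nat). a < b \<and> Poly_Mapping.keys a \<subseteq> V \<and> Poly_Mapping.keys b \<subseteq> V}"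
  unfolding wf_iff_no_infinite_down_chain
proof
  assume "\<exists>f. \<forall>i. (f (Suc i), f i) \<in> {(a, b :: 'v \<Rightarrow>\<^sub>0 nat). a < b \<and> Poly_Mapping.keys a \<subseteq> V \<and> Poly_Mapping.keys b \<subseteq> V}"
  then obtain f :: "nat \<Rightarrow> 'v \<Rightarrow>\<^sub>0 nat" where f: "\<And>i. f (Suc i) < f i" "\<And>i. Poly_Mapping.keys (f i) \<subseteq> V"
    by auto
  obtain i j where ij: "i < j" "f i + (f j - f i) = f j"
    using dickson_exponents[of V f, OF assms f(2)] by auto
  have "f i \<le> f i + (f j - f i)"
    using add_left_mono[OF poly_mapping_nat_nonneg, of "f i" "f j - f i"] by simp
  moreover have "f j < f i"
    using ij(1) by (induction rule: strict_inc_induct) (use f(1) less_trans in blast)+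
  ultimately show False using ij(2) by simp
qed

definition lead :: "(('v::linorder \<Rightarrow>\<^sub>0 nat) \<Rightarrow>\<^sub>0 'k::zero) \<Rightarrow> 'v \<Rightarrow>\<^sub>0 nat" where
  "lead p = Max (Poly_Mapping.keys p)"

lemma lead_in_keys: "p \<noteq> 0 \<Longrightarrow> lead p \<in> Poly_Mapping.keys p"
  unfolding lead_def by (rule Max_in) (auto simp: poly_mapping_eq_iff fun_eq_iff in_keys_iff)

lemma le_lead: "m \<in> Poly_Mapping.keys p \<Longrightarrow> m \<le> lead p"
  unfolding lead_def by simp

lemma lookup_single_mult:
  fixes p :: "('v \<Rightarrow>\<^sub>0 nat) \<Rightarrow>\<^sub>0 'k::comm_ring_1"
  shows "Poly_Mapping.lookup (Poly_Mapping.single a c * p) (a + m) = c * Poly_Mapping.lookup p m"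
proof -
  have "prod_fun (\<lambda>k'. c when a = k') (Poly_Mapping.lookup p) (a + m) = c * Poly_Mapping.lookup p m"
    unfolding prod_fun_def by (simp add: when_mult mult_when)
  then show ?thesis by (simp add: times_poly_mapping.rep_eq single.rep_eq)
qed

text \<open>One step of polynomial division: \<open>c\<close> and \<open>e\<close> are chosen to
  cancel the leading term, and the remaining exponents are smaller because the order respects
  addition.\<close>

lemma lead_reduction:
  fixes p q :: "('v::linorder \<Rightarrow>\<^sub>0 nat) \<Rightarrow>\<^sub>0 'k::field"
  assumes p: "p \<noteq> 0" and q: "q \<noteq> 0" and e: "lead q + e = lead p"
    and c: "c = Poly_Mapping.lookup p (lead p) / Poly_Mapping.lookup q (lead q)"
    and nz: "p - Poly_Mapping.single e c * q \<noteq> 0"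
  shows "lead (p - Poly_Mapping.single e c * q) < lead p"
proof -
  let ?r = "p - Poly_Mapping.single e c * q"
  have "lead ?r \<le> lead p"
  proof -
    have "lead ?r \<in> Poly_Mapping.keys ?r" by (rule lead_in_keys[OF nz])
    then consider "lead ?r \<in> Poly_Mapping.keys p" | "lead ?r \<in> Poly_Mapping.keys (Poly_Mapping.single e c * q)"
      by (metis in_keys_iff lookup_minus diff_zero)
    then show ?thesis
    proof cases
      case 2
      then obtain b where b: "b \<in> Poly_Mapping.keys q" "lead ?r = e + b"
        using keys_mult_subset[OF 2] by (auto split: if_splits)
      then show ?thesis using add_left_mono[OF le_lead[OF b(1)], of e] e by (simp add: add.commute)
    qed (simp add: le_lead)
  qed
  moreover have "Poly_Mapping.lookup ?r (lead p) = 0"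
    using lookup_single_mult[of e c q "lead q"] lead_in_keys[OF q] e c
    by (simp add: lookup_minus add.commute in_keys_iff)
  then have "lead ?r \<noteq> lead p"
    using lead_in_keys[OF nz] by (auto simp: in_keys_iff)
  ultimately show ?thesis by simp
qed

text \<open>In a strictly ascending chain, pick elements of the successive differences with minimal
  leading exponent; by Dickson's lemma one of them reduces a later one.\<close>

theorem hilbert_basis:
  assumes V: "finite (V :: 'v::linorder set)"
  shows "noetherian_subring (polys V :: (('v \<Rightarrow>\<^sub>0 nat) \<Rightarrow>\<^sub>0 'k::field) set)"
proof -
  interpret comm_subring "polys V :: (('v \<Rightarrow>\<^sub>0 nat) \<Rightarrow>\<^sub>0 'k) set" by (rule comm_subring_polys)
  show ?thesis
  proof
    show "wf {(J', J). is_ideal J \<and> is_ideal J' \<and> J \<subset> J'}"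
      unfolding wf_iff_no_infinite_down_chain
    proof
      assume "\<exists>J. \<forall>i. (J (Suc i), J i) \<in> {(J', J). is_ideal J \<and> is_ideal J' \<and> J \<subset> J'}"
      then obtain J :: "nat \<Rightarrow> (('v \<Rightarrow>\<^sub>0 nat) \<Rightarrow>\<^sub>0 'k) set"
        where "\<forall>i. is_ideal (J i) \<and> is_ideal (J (Suc i)) \<and> J i \<subset> J (Suc i)" by auto
      then have J: "\<And>i. is_ideal (J i)" "\<And>i. J i \<subset> J (Suc i)" by blast+
      have "\<exists>p. p \<in> J (Suc k) - J k \<and> (\<forall>q\<in>J (Suc k) - J k. \<not> lead q < lead p)" for k
      proof -
        let ?R = "{(a, b :: 'v \<Rightarrow>\<^sub>0 nat). a < b \<and> Poly_Mapping.keys a \<subseteq> V \<and> Poly_Mapping.keys b \<subseteq> V}"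
        have lead_V: "Poly_Mapping.keys (lead q) \<subseteq> V" if "q \<in> J (Suc k) - J k" for q
        proof -
          have "q \<noteq> 0" using that is_idealD(2)[OF J(1)] by auto
          then show ?thesis
            using lead_in_keys[of q] is_idealD(1)[OF J(1)] that by (force simp: polys_def)
        qed
        obtain q where "q \<in> J (Suc k) - J k" using J(2) by blast
        then have "lead q \<in> lead ` (J (Suc k) - J k)" by simp
        then obtain l where "l \<in> lead ` (J (Suc k) - J k)"
          "\<And>y. (y, l) \<in> ?R \<Longrightarrow> y \<notin> lead ` (J (Suc k) - J k)"
          by (rule wfE_min[OF wf_exponents[OF V]]) blast
        then show ?thesis using lead_V by auto
      qed
      then obtain p where p: "\<And>k. p k \<in> J (Suc k)" "\<And>k. p k \<notin> J k"
        "\<And>k q. q \<in> J (Suc k) \<Longrightarrow> q \<notin> J k \<Longrightarrow> \<not> lead q < lead (p k)"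
        by (metis Diff_iff)
      have p0: "p k \<noteq> 0" for k using p(2)[of k] is_idealD(2)[OF J(1)] by auto
      have "Poly_Mapping.keys (lead (p k)) \<subseteq> V" for k
        using lead_in_keys[OF p0] is_idealD(1)[OF J(1) p(1)] by (force simp: polys_def)
      then obtain i j where ij: "i < j" "lead (p i) + (lead (p j) - lead (p i)) = lead (p j)"
        and V': "Poly_Mapping.keys (lead (p j)) \<subseteq> V"
        using dickson_exponents[OF V, of "\<lambda>k. lead (p k)"] by blast
      define e where "e = lead (p j) - lead (p i)"
      define c where "c = Poly_Mapping.lookup (p j) (lead (p j)) / Poly_Mapping.lookup (p i) (lead (p i))"
      let ?m = "Poly_Mapping.single e c"
      have "Poly_Mapping.keys e \<subseteq> V"
        using V' by (auto simp: e_def in_keys_iff lookup_minus)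
      then have m: "?m \<in> polys V" by (auto simp: polys_def)
      have mono: "J a \<subseteq> J b" if "a \<le> b" for a b
        using that by (induction rule: dec_induct) (use J(2) in auto)
      have pi: "?m * p i \<in> J j"
        using is_idealD(4)[OF J(1) m p(1)] mono[of "Suc i" j] ij by auto
      \<comment> \<open>The subtracted multiple lies in \<open>J j\<close> because
        \<open>i < j\<close>. So the remainder is still new in \<open>J (Suc j)\<close>, but its
        leading exponent is below the minimal one of \<open>p j\<close>.\<close>
      have notin: "p j - ?m * p i \<notin> J j"
        using is_idealD(3)[OF J(1) _ pi, of "p j - ?m * p i"] p(2)[of j] by auto
      moreover have "p j - ?m * p i \<in> J (Suc j)"
        using pi p(1)[of j] J(2)[of j] by (intro is_idealD(7)[OF J(1)]) auto
      moreover have "p j - ?m * p i \<noteq> 0" using notin is_idealD(2)[OF J(1)] by metis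
      then have "lead (p j - ?m * p i) < lead (p j)"
        using ij by (intro lead_reduction p0) (auto simp: e_def c_def)
      ultimately show False using p(3) by blast
    qed
  qed
qed

section \<open>Simplicial cohomology of links and deletions\<close>

text \<open>Signs are computed in \<open>S \<union> T\<close>, so that removing the fixed vertices \<open>T\<close> from every face
  of a complex needs no change of signs.\<close>

definition coboundary :: "'v::linorder set \<Rightarrow> ('v set \<Rightarrow> 'k::comm_ring_1) \<Rightarrow> 'v set \<Rightarrow> 'k" where
  "coboundary T \<phi> S = (\<Sum>v\<in>S. osign v (S \<union> T) * \<phi> (S - {v}))"

text \<open>The index counts vertices, so this is the vanishing of reduced cohomology in degree
  \<open>k - 1\<close>. For \<open>k = 0\<close> a coboundary is an empty sum, and cocycles have to
  vanish at the empty face.\<close>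

definition acyclic_at :: "'k::comm_ring_1 itself \<Rightarrow> 'v::linorder set \<Rightarrow> 'v set set \<Rightarrow> nat \<Rightarrow> bool" where
  "acyclic_at _ T \<Gamma> k \<longleftrightarrow> (\<forall>\<phi> :: 'v set \<Rightarrow> 'k. (\<forall>S\<in>\<Gamma>. card S = Suc k \<longrightarrow> coboundary T \<phi> S = 0) \<longrightarrow>
     (\<exists>\<psi>. \<forall>S\<in>\<Gamma>. card S = k \<longrightarrow> \<phi> S = coboundary T \<psi> S))"

lemma acyclic_atD:
  fixes \<phi> :: "'v::linorder set \<Rightarrow> 'k::comm_ring_1"
  assumes "acyclic_at TYPE('k) T \<Gamma> k" "\<And>S. S \<in> \<Gamma> \<Longrightarrow> card S = Suc k \<Longrightarrow> coboundary T \<phi> S = 0"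
  obtains \<psi> where "\<And>S. S \<in> \<Gamma> \<Longrightarrow> card S = k \<Longrightarrow> \<phi> S = coboundary T \<psi> S"
proof -
  have "\<exists>\<psi>. \<forall>S\<in>\<Gamma>. card S = k \<longrightarrow> \<phi> S = coboundary T \<psi> S"
    by (rule assms(1)[unfolded acyclic_at_def, rule_format]) (rule assms(2))
  then show ?thesis using that by blast
qed

lemma osign_union:
  assumes "finite S" "finite T" "S \<inter> T = {}"
  shows "osign v (S \<union> T) = osign v S * osign v T"
proof -
  have "{w \<in> S \<union> T. w < v} = {w \<in> S. w < v} \<union> {w \<in> T. w < v}" by auto
  moreover have "card ({w \<in> S. w < v} \<union> {w \<in> T. w < v}) = card {w \<in> S. w < v} + card {w \<in> T. w < v}"
    using assms by (intro card_Un_disjoint) auto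
  ultimately show ?thesis unfolding osign_def by (simp only: power_add)
qed

text \<open>The extra sign that \<open>T\<close> gives to \<open>v\<close> depends on
  \<open>v\<close> alone, so it is absorbed by rescaling the basis cochain at \<open>S\<close> by
  the product of these signs over \<open>S\<close>.\<close>

lemma coboundary_twist:
  fixes \<phi> :: "'v::linorder set \<Rightarrow> 'k::comm_ring_1"
  assumes "finite S" "finite T" "S \<inter> T = {}"
  shows "coboundary T (\<lambda>S. (\<Prod>v\<in>S. osign v T) * \<phi> S) S = (\<Prod>v\<in>S. osign v T) * coboundary {} \<phi> S"
  unfolding coboundary_def sum_distrib_left
proof (rule sum.cong)
  fix v assume v: "v \<in> S"
  have e: "(\<Prod>w\<in>S. osign w T) = (osign v T * (\<Prod>w\<in>S - {v}. osign w T) :: 'k)"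
    using v assms(1) by (rule prod.remove[rotated])
  show "osign v (S \<union> T) * ((\<Prod>v\<in>S - {v}. osign v T) * \<phi> (S - {v})) =
      (\<Prod>v\<in>S. osign v T) * (osign v (S \<union> {}) * \<phi> (S - {v}))"
    unfolding osign_union[OF assms] e by (simp add: mult_ac)
qed simp

lemma acyclic_at_twist:
  assumes T: "finite T" and \<Gamma>: "\<And>S. S \<in> \<Gamma> \<Longrightarrow> finite S \<and> S \<inter> T = {}"
  shows "acyclic_at TYPE('k::comm_ring_1) T \<Gamma> k \<longleftrightarrow> acyclic_at TYPE('k) {} \<Gamma> k"
proof -
  define e :: "'a set \<Rightarrow> 'k" where "e S = (\<Prod>v\<in>S. osign v T)" for S
  have e: "e S * e S = 1" for S by (simp add: e_def flip: prod.distrib)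
  then have e': "e S * (e S * a) = a" for S a by (simp flip: mult.assoc)
  have tw: "coboundary T (\<lambda>S. e S * \<phi> S) S = e S * coboundary {} \<phi> S" if "S \<in> \<Gamma>" for \<phi> S
    using coboundary_twist[of S T \<phi>] \<Gamma>[OF that] T by (simp add: e_def)
  have tw': "coboundary T \<phi> S = e S * coboundary {} (\<lambda>S. e S * \<phi> S) S" if "S \<in> \<Gamma>" for \<phi> S
    using tw[OF that, of "\<lambda>S. e S * \<phi> S"] by (simp add: e')
  show ?thesis
  proof
    assume ac: "acyclic_at TYPE('k) T \<Gamma> k"
    show "acyclic_at TYPE('k) {} \<Gamma> k"
      unfolding acyclic_at_def
    proof (intro allI impI)
      fix \<phi> :: "'a set \<Rightarrow> 'k" assume a: "\<forall>S\<in>\<Gamma>. card S = Suc k \<longrightarrow> coboundary {} \<phi> S = 0"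
      obtain \<psi> where \<psi>: "\<And>S. S \<in> \<Gamma> \<Longrightarrow> card S = k \<Longrightarrow> e S * \<phi> S = coboundary T \<psi> S"
        using a by (auto intro: acyclic_atD[OF ac, of "\<lambda>S. e S * \<phi> S"] simp: tw)
      have "\<phi> S = coboundary {} (\<lambda>S. e S * \<psi> S) S" if "S \<in> \<Gamma>" "card S = k" for S
        using arg_cong[OF \<psi>[OF that], of "\<lambda>a. e S * a"] that by (simp add: tw' e')
      then show "\<exists>\<psi>. \<forall>S\<in>\<Gamma>. card S = k \<longrightarrow> \<phi> S = coboundary {} \<psi> S" by blast
    qed
  next
    assume ac: "acyclic_at TYPE('k) {} \<Gamma> k"
    show "acyclic_at TYPE('k) T \<Gamma> k"
      unfolding acyclic_at_def
    proof (intro allI impI)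
      fix \<phi> :: "'a set \<Rightarrow> 'k" assume a: "\<forall>S\<in>\<Gamma>. card S = Suc k \<longrightarrow> coboundary T \<phi> S = 0"
      have "coboundary {} (\<lambda>S. e S * \<phi> S) S = 0" if "S \<in> \<Gamma>" "card S = Suc k" for S
        using e'[of S "coboundary {} (\<lambda>S. e S * \<phi> S) S"] a that by (simp flip: tw')
      then obtain \<psi> where \<psi>: "\<And>S. S \<in> \<Gamma> \<Longrightarrow> card S = k \<Longrightarrow> e S * \<phi> S = coboundary {} \<psi> S"
        using acyclic_atD[OF ac, of "\<lambda>S. e S * \<phi> S"] by blast
      have "\<phi> S = coboundary T (\<lambda>S. e S * \<psi> S) S" if "S \<in> \<Gamma>" "card S = k" for S
        using arg_cong[OF \<psi>[OF that], of "\<lambda>a. e S * a"] that by (simp add: tw e')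
      then show "\<exists>\<psi>. \<forall>S\<in>\<Gamma>. card S = k \<longrightarrow> \<phi> S = coboundary T \<psi> S" by blast
    qed
  qed
qed

lemma coboundary_cong:
  "(\<And>v. v \<in> S \<Longrightarrow> \<phi> (S - {v}) = \<psi> (S - {v})) \<Longrightarrow> coboundary T \<phi> S = coboundary T \<psi> S"
  unfolding coboundary_def by (rule sum.cong) auto

lemma coboundary_diff: "coboundary T (\<lambda>S. \<phi> S - \<psi> S) S = coboundary T \<phi> S - coboundary T \<psi> S"
  by (simp add: coboundary_def right_diff_distrib sum_subtractf)

lemma coboundary_uminus: "coboundary T (\<lambda>S. - \<phi> S) S = - coboundary T \<phi> S"
  by (simp add: coboundary_def sum_negf)

lemma coboundary_coboundary: "finite S \<Longrightarrow> coboundary {} (coboundary {} \<phi>) S = 0"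
  using koszul_d_koszul_d[of S "\<lambda>_. 1" \<phi>] by (simp add: coboundary_def koszul_d_def)

text \<open>At a face through \<open>v\<close> the coboundary has one term from the deletion and a
  remainder from the link; in the remainder signs are computed with \<open>v\<close> present, hence
  the twist by \<open>{v}\<close>.\<close>

lemma coboundary_insert:
  assumes "finite S" "v \<notin> S"
  shows "coboundary {} \<phi> (insert v S) = osign v (insert v S) * \<phi> S + coboundary {v} (\<lambda>R. \<phi> (insert v R)) S"
proof -
  have "(\<Sum>w\<in>S. osign w (insert v S) * \<phi> (insert v S - {w})) = coboundary {v} (\<lambda>R. \<phi> (insert v R)) S"
    unfolding coboundary_def
  proof (rule sum.cong)
    fix w assume "w \<in> S"
    then have "insert v S - {w} = insert v (S - {w})" using assms by auto
    then show "osign w (insert v S) * \<phi> (insert v S - {w}) = osign w (S \<union> {v}) * \<phi> (insert v (S - {w}))"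
      by simp
  qed simp
  then show ?thesis using assms by (simp add: coboundary_def)
qed

section \<open>Exact sequences relating a complex, a vertex deletion and a link\<close>

definition complex :: "'v set set \<Rightarrow> bool" where
  "complex \<Gamma> \<longleftrightarrow> (\<forall>S\<in>\<Gamma>. finite S \<and> (\<forall>R. R \<subseteq> S \<longrightarrow> R \<in> \<Gamma>))"

definition deletion :: "'v set set \<Rightarrow> 'v set \<Rightarrow> 'v set set" where
  "deletion \<Gamma> W = {S \<in> \<Gamma>. S \<inter> W = {}}"

lemma complex_deletion: "complex \<Gamma> \<Longrightarrow> complex (deletion \<Gamma> W)"
  unfolding complex_def deletion_def by blast

lemma complex_link: "complex \<Gamma> \<Longrightarrow> complex (link \<Gamma> F)"
  unfolding complex_def
proof (intro ballI conjI allI impI)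
  assume \<Gamma>: "\<forall>S\<in>\<Gamma>. finite S \<and> (\<forall>R\<subseteq>S. R \<in> \<Gamma>)"
  fix S assume S: "S \<in> link \<Gamma> F"
  then show "finite S" using \<Gamma> by (simp add: link_def)
  fix R assume R: "R \<subseteq> S"
  then have sub: "R \<union> F \<subseteq> S \<union> F" "R \<inter> F \<subseteq> S \<inter> F" by auto
  have "R \<in> \<Gamma>" "R \<union> F \<in> \<Gamma>" using \<Gamma> S R sub(1) unfolding link_def by blast+
  then show "R \<in> link \<Gamma> F" using S sub(2) by (auto simp: link_def)
qed

text \<open>In the exact sequence H^{k-1}(\<Gamma>) -> H^{k-1}(\<Gamma> - v) -> H^{k-1}(link v) the
  outer terms vanish: the obstruction to extending a cocycle over the faces through \<open>v\<close>
  is a cocycle on the link.\<close>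

lemma acyclic_at_deletion:
  assumes \<Gamma>: "complex \<Gamma>" and ac: "acyclic_at TYPE('k::comm_ring_1) {} \<Gamma> k" "acyclic_at TYPE('k) {} (link \<Gamma> {v}) k"
  shows "acyclic_at TYPE('k) {} (deletion \<Gamma> {v}) k"
  unfolding acyclic_at_def
proof (intro allI impI)
  fix \<phi> :: "'a set \<Rightarrow> 'k"
  assume "\<forall>S\<in>deletion \<Gamma> {v}. card S = Suc k \<longrightarrow> coboundary {} \<phi> S = 0"
  then have \<phi>: "\<And>S. S \<in> \<Gamma> \<Longrightarrow> v \<notin> S \<Longrightarrow> card S = Suc k \<Longrightarrow> coboundary {} \<phi> S = 0"
    by (simp add: deletion_def)
  have lk: "finite S" "v \<notin> S" "S \<in> \<Gamma>" "insert v S \<in> \<Gamma>" if "S \<in> link \<Gamma> {v}" for S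
    using that \<Gamma> by (auto simp: link_def complex_def)
  have ac': "acyclic_at TYPE('k) {v} (link \<Gamma> {v}) k"
    by (subst acyclic_at_twist) (use ac(2) lk in auto)
  define \<phi>0 where "\<phi>0 S = (if v \<in> S then 0 else \<phi> S)" for S
  \<comment> \<open>The obstruction: the coboundary of the extension by zero, seen as a cochain on
    the link.\<close>
  define \<eta> where "\<eta> S = coboundary {} \<phi>0 (insert v S)" for S
  have "coboundary {v} \<eta> S = 0" if S: "S \<in> link \<Gamma> {v}" "card S = Suc k" for S
  proof -
    note lk = lk[OF S(1)]
    have "coboundary {} \<phi>0 S = coboundary {} \<phi> S"
      using lk(2) by (intro coboundary_cong) (auto simp: \<phi>0_def)
    then have "coboundary {} \<phi>0 S = 0" using \<phi>[of S] lk S by simp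
    then have "coboundary {v} (\<lambda>R. coboundary {} \<phi>0 (insert v R)) S = coboundary {} (coboundary {} \<phi>0) (insert v S)"
      using lk coboundary_insert[of S v "coboundary {} \<phi>0"] by simp
    then show ?thesis using coboundary_coboundary[of "insert v S" \<phi>0] lk by (simp add: \<eta>_def[abs_def])
  qed
  then obtain \<psi> where \<psi>: "\<And>S. S \<in> link \<Gamma> {v} \<Longrightarrow> card S = k \<Longrightarrow> \<eta> S = coboundary {v} \<psi> S"
    using acyclic_atD[OF ac', of \<eta>] by blast
  \<comment> \<open>A primitive of the obstruction corrects the values on faces through
    \<open>v\<close>, so that the extension becomes a cocycle of \<Gamma>.\<close>
  define \<phi>1 where "\<phi>1 S = (if v \<in> S then - \<psi> (S - {v}) else \<phi> S)" for S
  have "coboundary {} \<phi>1 S = 0" if S: "S \<in> \<Gamma>" "card S = Suc k" for S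
  proof (cases "v \<in> S")
    case False
    then have "coboundary {} \<phi>1 S = coboundary {} \<phi> S"
      by (intro coboundary_cong) (auto simp: \<phi>1_def)
    then show ?thesis using \<phi> S False by simp
  next
    case True
    define R where "R = S - {v}"
    have R: "S = insert v R" "v \<notin> R" "R \<in> link \<Gamma> {v}" "card R = k"
      using True S \<Gamma> by (auto simp: R_def link_def complex_def insert_absorb)
    have fin: "finite R" using lk R by simp
    have "coboundary {v} (\<lambda>Q. \<phi>1 (insert v Q)) R = coboundary {v} (\<lambda>Q. - \<psi> Q) R"
      using R(2) by (intro coboundary_cong) (auto simp: \<phi>1_def)
    then have "coboundary {} \<phi>1 S = osign v S * \<phi> R - coboundary {v} \<psi> R"
      using coboundary_insert[OF fin R(2), of \<phi>1] R by (simp add: \<phi>1_def coboundary_uminus)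
    moreover have "coboundary {v} (\<lambda>Q. \<phi>0 (insert v Q)) R = 0"
      by (simp add: \<phi>0_def coboundary_def)
    then have "\<eta> R = osign v S * \<phi> R"
      using coboundary_insert[OF fin R(2), of \<phi>0] R by (simp add: \<phi>0_def \<eta>_def)
    ultimately show ?thesis using \<psi>[OF R(3,4)] by simp
  qed
  then obtain \<chi> where \<chi>: "\<And>S. S \<in> \<Gamma> \<Longrightarrow> card S = k \<Longrightarrow> \<phi>1 S = coboundary {} \<chi> S"
    using acyclic_atD[OF ac(1), of \<phi>1] by blast
  show "\<exists>\<psi>. \<forall>S\<in>deletion \<Gamma> {v}. card S = k \<longrightarrow> \<phi> S = coboundary {} \<psi> S"
  proof (intro exI ballI impI)
    fix S assume "S \<in> deletion \<Gamma> {v}" "card S = k"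
    then show "\<phi> S = coboundary {} \<chi> S" using \<chi>[of S] by (simp add: \<phi>1_def deletion_def)
  qed
qed

text \<open>The next stretch of the same sequence, H^{k-1}(\<Gamma> - v) -> H^{k-1}(link v) ->
  H^k(\<Gamma>); this is why \<Gamma> is used one degree higher.\<close>

lemma acyclic_at_link:
  assumes \<Gamma>: "complex \<Gamma>" and ac: "acyclic_at TYPE('k::comm_ring_1) {} \<Gamma> (Suc k)" "acyclic_at TYPE('k) {} (deletion \<Gamma> {v}) k"
  shows "acyclic_at TYPE('k) {} (link \<Gamma> {v}) k"
proof -
  have lk: "finite S" "v \<notin> S" "S \<in> \<Gamma>" "insert v S \<in> \<Gamma>" if "S \<in> link \<Gamma> {v}" for S
    using that \<Gamma> by (auto simp: link_def complex_def)
  have "acyclic_at TYPE('k) {v} (link \<Gamma> {v}) k"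
    unfolding acyclic_at_def
  proof (intro allI impI)
    fix \<eta> :: "'a set \<Rightarrow> 'k"
    assume \<eta>: "\<forall>S\<in>link \<Gamma> {v}. card S = Suc k \<longrightarrow> coboundary {v} \<eta> S = 0"
    define \<phi> where "\<phi> S = (if v \<in> S then \<eta> (S - {v}) else 0)" for S
    have "coboundary {} \<phi> S = 0" if S: "S \<in> \<Gamma>" "card S = Suc (Suc k)" for S
    proof (cases "v \<in> S")
      case False
      then show ?thesis by (simp add: coboundary_def \<phi>_def)
    next
      case True
      define R where "R = S - {v}"
      have R: "S = insert v R" "v \<notin> R" "R \<in> link \<Gamma> {v}" "card R = Suc k"
        using True S \<Gamma> by (auto simp: R_def link_def complex_def insert_absorb)
      have fin: "finite R" using lk R by simp
      have "coboundary {v} (\<lambda>Q. \<phi> (insert v Q)) R = coboundary {v} \<eta> R"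
        using R(2) by (intro coboundary_cong) (auto simp: \<phi>_def)
      then show ?thesis
        using coboundary_insert[OF fin R(2), of \<phi>] R \<eta> by (simp add: \<phi>_def)
    qed
    then obtain \<psi> where \<psi>: "\<And>S. S \<in> \<Gamma> \<Longrightarrow> card S = Suc k \<Longrightarrow> \<phi> S = coboundary {} \<psi> S"
      using acyclic_atD[OF ac(1), of \<phi>] by blast
    have "coboundary {} \<psi> S = 0" if "S \<in> deletion \<Gamma> {v}" "card S = Suc k" for S
      using \<psi>[of S] that by (simp add: deletion_def \<phi>_def)
    then obtain \<chi> where \<chi>: "\<And>S. S \<in> deletion \<Gamma> {v} \<Longrightarrow> card S = k \<Longrightarrow> \<psi> S = coboundary {} \<chi> S"
      using acyclic_atD[OF ac(2), of \<psi>] by blast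
    \<comment> \<open>Subtracting a coboundary makes the primitive vanish on the faces of size
      \<open>k\<close> avoiding \<open>v\<close>, so that only its values on faces through
      \<open>v\<close> contribute.\<close>
    define \<psi>1 where "\<psi>1 S = \<psi> S - coboundary {} \<chi> S" for S
    show "\<exists>\<psi>. \<forall>S\<in>link \<Gamma> {v}. card S = k \<longrightarrow> \<eta> S = coboundary {v} \<psi> S"
    proof (intro exI ballI impI)
      fix S assume S: "S \<in> link \<Gamma> {v}" "card S = k"
      note lk = lk[OF S(1)]
      have "\<eta> S = \<phi> (insert v S)" using lk by (simp add: \<phi>_def)
      also have "\<dots> = coboundary {} \<psi> (insert v S)" using \<psi> lk S by simp
      also have "\<dots> = coboundary {} \<psi>1 (insert v S)"
        using coboundary_coboundary[of "insert v S" \<chi>] lk by (simp add: \<psi>1_def[abs_def] coboundary_diff)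
      also have "\<dots> = coboundary {v} (\<lambda>R. \<psi>1 (insert v R)) S"
        using coboundary_insert[OF lk(1,2), of \<psi>1] \<chi>[of S] lk S by (simp add: \<psi>1_def deletion_def)
      finally show "\<eta> S = coboundary {v} (\<lambda>R. \<psi>1 (insert v R)) S" .
    qed
  qed
  then show ?thesis by (subst (asm) acyclic_at_twist) (use lk in auto)
qed

lemma deletion_insert: "deletion (deletion \<Gamma> W) {v} = deletion \<Gamma> (insert v W)"
  by (auto simp: deletion_def)

lemma link_insert:
  "complex \<Gamma> \<Longrightarrow> v \<notin> F \<Longrightarrow> v \<notin> W \<Longrightarrow> link (deletion (link \<Gamma> F) W) {v} = deletion (link \<Gamma> (insert v F)) W"
proof -
  assume \<Gamma>: "complex \<Gamma>" and vF: "v \<notin> F" "v \<notin> W"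
  have "S \<union> F \<in> \<Gamma>" "insert v S \<in> \<Gamma>" if "insert v (S \<union> F) \<in> \<Gamma>" for S
    using that \<Gamma> by (meson complex_def subset_insertI Un_upper1 insert_mono)+
  then show ?thesis
    using vF by (auto simp: deletion_def link_def)
qed

lemma link_empty [simp]: "link \<Gamma> {} = \<Gamma>"
  by (auto simp: link_def)

lemma deletion_empty [simp]: "deletion \<Gamma> {} = \<Gamma>"
  by (auto simp: deletion_def)

text \<open>Both directions pass through \<open>deletion (link \<Gamma> F) W\<close> for disjoint
  \<open>F\<close> and \<open>W\<close>. Moving a vertex between \<open>F\<close> and
  \<open>W\<close>, or trading it for one step in \<open>k\<close>, preserves
  \<open>k + card F + card W\<close>, so the bound \<open>d\<close> never changes. Subsets
  \<open>F\<close> that are not faces have empty, hence acyclic, links.\<close>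

theorem acyclic_links_iff_deletions:
  assumes \<Gamma>: "complex \<Gamma>" and X: "finite X"
  shows "(\<forall>F\<subseteq>X. \<forall>k. k + card F < d \<longrightarrow> acyclic_at TYPE('k::comm_ring_1) {} (link \<Gamma> F) k) \<longleftrightarrow>
    (\<forall>W\<subseteq>X. \<forall>k. k + card W < d \<longrightarrow> acyclic_at TYPE('k) {} (deletion \<Gamma> W) k)"
proof
  assume a: "\<forall>F\<subseteq>X. \<forall>k. k + card F < d \<longrightarrow> acyclic_at TYPE('k) {} (link \<Gamma> F) k"
  have "\<forall>F k. F \<subseteq> X \<longrightarrow> F \<inter> W = {} \<longrightarrow> k + card F + card W < d \<longrightarrow>
      acyclic_at TYPE('k) {} (deletion (link \<Gamma> F) W) k" if "finite W" "W \<subseteq> X" for W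
    using that
  proof (induction W)
    case empty
    then show ?case using a by simp
  next
    case (insert v W)
    show ?case
    proof (intro allI impI)
      fix F k assume F: "F \<subseteq> X" "F \<inter> insert v W = {}" "k + card F + card (insert v W) < d"
      have fin: "finite F" using F X finite_subset by auto
      have "acyclic_at TYPE('k) {} (deletion (link \<Gamma> F) W) k"
        using insert F by auto
      moreover have "acyclic_at TYPE('k) {} (deletion (link \<Gamma> (insert v F)) W) k"
        using insert F fin by auto
      ultimately show "acyclic_at TYPE('k) {} (deletion (link \<Gamma> F) (insert v W)) k"
        using acyclic_at_deletion[where 'k='k, of "deletion (link \<Gamma> F) W" k v] link_insert[OF \<Gamma>, of v F W] insert F \<Gamma>
        by (simp add: deletion_insert complex_deletion complex_link)
    qed
  qed
  from this[OF finite_subset[OF _ X]] 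
  show "\<forall>W\<subseteq>X. \<forall>k. k + card W < d \<longrightarrow> acyclic_at TYPE('k) {} (deletion \<Gamma> W) k"
    by (metis add.right_neutral card.empty empty_subsetI inf_bot_left link_empty)
next
  assume a: "\<forall>W\<subseteq>X. \<forall>k. k + card W < d \<longrightarrow> acyclic_at TYPE('k) {} (deletion \<Gamma> W) k"
  have "\<forall>W k. W \<subseteq> X \<longrightarrow> F \<inter> W = {} \<longrightarrow> k + card F + card W < d \<longrightarrow>
      acyclic_at TYPE('k) {} (deletion (link \<Gamma> F) W) k" if "finite F" "F \<subseteq> X" for F
    using that
  proof (induction F)
    case empty
    then show ?case using a by simp
  next
    case (insert v F)
    show ?case
    proof (intro allI impI)
      fix W k assume W: "W \<subseteq> X" "insert v F \<inter> W = {}" "k + card (insert v F) + card W < d"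
      have fin: "finite W" using W X finite_subset by auto
      have "acyclic_at TYPE('k) {} (deletion (link \<Gamma> F) W) (Suc k)"
        using insert W by auto
      moreover have "acyclic_at TYPE('k) {} (deletion (link \<Gamma> F) (insert v W)) k"
        using insert W fin by auto
      ultimately show "acyclic_at TYPE('k) {} (deletion (link \<Gamma> (insert v F)) W) k"
        using acyclic_at_link[where 'k='k, of "deletion (link \<Gamma> F) W" k v] link_insert[OF \<Gamma>, of v F W] insert W \<Gamma>
        by (simp add: deletion_insert complex_deletion complex_link)
    qed
  qed
  from this[OF finite_subset[OF _ X]] 
  show "\<forall>F\<subseteq>X. \<forall>k. k + card F < d \<longrightarrow> acyclic_at TYPE('k) {} (link \<Gamma> F) k"
    by (metis add.right_neutral card.empty empty_subsetI inf_bot_right deletion_empty)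
qed

section \<open>Duality between homology and cohomology\<close>

definition pm_scale :: "'k::field \<Rightarrow> ('b \<Rightarrow>\<^sub>0 'k) \<Rightarrow> ('b \<Rightarrow>\<^sub>0 'k)" where
  "pm_scale a c = Poly_Mapping.map ((*) a) c"

lemma lookup_pm_scale [simp]: "Poly_Mapping.lookup (pm_scale a c) F = a * Poly_Mapping.lookup c F"
  by (simp add: pm_scale_def map.rep_eq when_def)

lemma vector_space_pm_scale: "vector_space (pm_scale :: 'k::field \<Rightarrow> ('b \<Rightarrow>\<^sub>0 'k) \<Rightarrow> _)"
  by unfold_locales (auto intro!: poly_mapping_eqI simp: lookup_add algebra_simps)

lemma vector_space_field: "vector_space ((*) :: 'k::field \<Rightarrow> 'k \<Rightarrow> 'k)"
  by unfold_locales (auto simp: algebra_simps)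

lemma poly_mapping_sum_single:
  "(\<Sum>F\<in>Poly_Mapping.keys c. Poly_Mapping.single F (Poly_Mapping.lookup c F)) = c"
proof (rule poly_mapping_eqI)
  fix G
  have "(\<Sum>F\<in>Poly_Mapping.keys c. Poly_Mapping.lookup (Poly_Mapping.single F (Poly_Mapping.lookup c F)) G) =
     (\<Sum>F\<in>Poly_Mapping.keys c. if F = G then Poly_Mapping.lookup c F else 0)"
    by (rule sum.cong) (auto simp: lookup_single)
  also have "\<dots> = Poly_Mapping.lookup c G" by (simp add: in_keys_iff)
  finally show "Poly_Mapping.lookup (\<Sum>F\<in>Poly_Mapping.keys c. Poly_Mapping.single F (Poly_Mapping.lookup c F)) G
    = Poly_Mapping.lookup c G" by (simp add: lookup_sum)
qed

definition pairing :: "('b \<Rightarrow> 'k::field) \<Rightarrow> ('b \<Rightarrow>\<^sub>0 'k) \<Rightarrow> 'k" where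
  "pairing \<phi> c = (\<Sum>F\<in>Poly_Mapping.keys c. \<phi> F * Poly_Mapping.lookup c F)"

lemma pairing_add: "pairing \<phi> (c + d) = pairing \<phi> c + pairing \<phi> d"
  unfolding pairing_def
  by (rule setsum_keys_plus_distrib[of "\<lambda>F a. \<phi> F * a"]) (auto simp: distrib_left)

lemma pairing_0 [simp]: "pairing \<phi> 0 = 0"
  by (simp add: pairing_def)

lemma pairing_single [simp]: "pairing \<phi> (Poly_Mapping.single F a) = \<phi> F * a"
  by (simp add: pairing_def)

lemma pairing_sum: "pairing \<phi> (sum f A) = (\<Sum>a\<in>A. pairing \<phi> (f a))"
  by (induction A rule: infinite_finite_induct) (auto simp: pairing_add)

lemma pairing_scale: "pairing \<phi> (pm_scale a c) = a * pairing \<phi> c"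
proof (cases "a = 0")
  case True
  then have "pm_scale a c = 0" by (intro poly_mapping_eqI) simp
  then show ?thesis using True by simp
next
  case False
  then have "Poly_Mapping.keys (pm_scale a c) = Poly_Mapping.keys c" by (auto simp: in_keys_iff)
  then show ?thesis by (simp add: pairing_def sum_distrib_left mult_ac)
qed

lemma linear_pairing: "Vector_Spaces.linear pm_scale (*) (pairing \<phi>)"
  by (simp add: Vector_Spaces.linear_iff vector_space_pm_scale vector_space_field pairing_add pairing_scale)

text \<open>Chains have finite support, so single faces span them, and cochains, being arbitrary
  functions on faces, are exactly the linear functionals on chains.\<close>

lemma linear_functional_eq_pairing:
  assumes "Vector_Spaces.linear pm_scale (*) g"
  shows "g c = pairing (\<lambda>F. g (Poly_Mapping.single F 1)) c"
proof -
  interpret g: Vector_Spaces.linear pm_scale "(*)" g by (rule assms)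
  have s: "Poly_Mapping.single F a = pm_scale a (Poly_Mapping.single F 1)" for F a
    by (intro poly_mapping_eqI) (simp add: lookup_single when_def)
  have "g c = g (\<Sum>F\<in>Poly_Mapping.keys c. Poly_Mapping.single F (Poly_Mapping.lookup c F))"
    by (simp add: poly_mapping_sum_single)
  also have "\<dots> = (\<Sum>F\<in>Poly_Mapping.keys c. g (Poly_Mapping.single F (Poly_Mapping.lookup c F)))"
    by (rule g.sum)
  also have "\<dots> = pairing (\<lambda>F. g (Poly_Mapping.single F 1)) c"
    unfolding pairing_def by (rule sum.cong) (auto simp: s[of _ "Poly_Mapping.lookup c _"] g.scale mult.commute)
  finally show ?thesis .
qed

lemma simplicial_boundary_osign:
  "simplicial_boundary c = (\<Sum>F \<in> Poly_Mapping.keys c. \<Sum>v \<in> F.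
     Poly_Mapping.single (F - {v}) (osign v F * Poly_Mapping.lookup c F))"
  by (simp add: simplicial_boundary_def osign_def)

lemma pairing_boundary: "pairing \<phi> (simplicial_boundary c) = pairing (coboundary {} \<phi>) c"
  unfolding simplicial_boundary_osign pairing_sum pairing_single
  by (simp add: pairing_def coboundary_def sum_distrib_left sum_distrib_right mult_ac)

text \<open>Transports identities for the coboundary to the boundary.\<close>

lemma poly_mapping_eqI_pairing: "(\<And>\<phi>. pairing \<phi> c = pairing \<phi> d) \<Longrightarrow> c = d"
proof (rule poly_mapping_eqI)
  fix F assume a: "\<And>\<phi>. pairing \<phi> c = pairing \<phi> d"
  have "pairing (\<lambda>G. if G = F then 1 else 0) e = Poly_Mapping.lookup e F" for e :: "'a \<Rightarrow>\<^sub>0 'b"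
  proof -
    have "pairing (\<lambda>G. if G = F then 1 else 0) e = (\<Sum>G\<in>Poly_Mapping.keys e. if G = F then Poly_Mapping.lookup e G else 0)"
      unfolding pairing_def by (rule sum.cong) auto
    then show ?thesis by (simp add: in_keys_iff)
  qed
  then show "Poly_Mapping.lookup c F = Poly_Mapping.lookup d F" using a by metis
qed

lemma simplicial_boundary_add: "simplicial_boundary (c + d) = simplicial_boundary c + simplicial_boundary d"
  by (rule poly_mapping_eqI_pairing) (simp add: pairing_boundary pairing_add)

lemma simplicial_boundary_scale: "simplicial_boundary (pm_scale a c) = pm_scale a (simplicial_boundary c)"
  by (rule poly_mapping_eqI_pairing) (simp add: pairing_boundary pairing_scale)

lemma linear_simplicial_boundary: "Vector_Spaces.linear pm_scale pm_scale simplicial_boundary"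
  by (simp add: Vector_Spaces.linear_iff vector_space_pm_scale simplicial_boundary_add simplicial_boundary_scale)

lemma simplicial_boundary_boundary:
  assumes "c \<in> simplicial_chains \<Gamma> i"
  shows "simplicial_boundary (simplicial_boundary c) = 0"
proof (rule poly_mapping_eqI_pairing)
  fix \<phi>
  have "pairing (coboundary {} (coboundary {} \<phi>)) c = 0"
    unfolding pairing_def using assms
    by (intro sum.neutral) (auto simp: simplicial_chains_def coboundary_coboundary)
  then show "pairing \<phi> (simplicial_boundary (simplicial_boundary c)) = pairing \<phi> 0"
    by (simp add: pairing_boundary)
qed

lemma simplicial_boundary_in_chains:
  assumes \<Gamma>: "complex \<Gamma>" and c: "c \<in> simplicial_chains \<Gamma> (i + 1)"
  shows "simplicial_boundary c \<in> simplicial_chains \<Gamma> i"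
  unfolding simplicial_chains_def
proof (intro CollectI ballI)
  fix G assume "G \<in> Poly_Mapping.keys (simplicial_boundary c)"
  then have "Poly_Mapping.lookup (simplicial_boundary c) G \<noteq> 0" by (simp add: in_keys_iff)
  then obtain F where F: "F \<in> Poly_Mapping.keys c"
    "(\<Sum>v\<in>F. Poly_Mapping.lookup (Poly_Mapping.single (F - {v}) (osign v F * Poly_Mapping.lookup c F)) G) \<noteq> 0"
    unfolding simplicial_boundary_osign lookup_sum by (auto elim: sum.not_neutral_contains_not_neutral)
  then obtain v where v: "v \<in> F" "G = F - {v}"
    by (auto elim!: sum.not_neutral_contains_not_neutral simp: lookup_single when_def split: if_splits)
  have "F \<in> \<Gamma>" "finite F" "int (card F) = i + 2" using c F by (auto simp: simplicial_chains_def)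
  moreover from this have "Suc (card G) = card F" using v by (simp add: card_Suc_Diff1 del: card_Diff_insert)
  ultimately show "G \<in> \<Gamma> \<and> finite G \<and> int (card G) = i + 1"
    using v(2) \<Gamma> by (auto simp: complex_def)
qed

lemma subspace_simplicial_chains:
  "module.subspace pm_scale (simplicial_chains \<Gamma> i :: ('a set \<Rightarrow>\<^sub>0 'b::field) set)"
proof -
  interpret vector_space "pm_scale :: 'b \<Rightarrow> ('a set \<Rightarrow>\<^sub>0 'b) \<Rightarrow> _" by (rule vector_space_pm_scale)
  show ?thesis
    unfolding subspace_def
  proof (intro conjI ballI allI)
    fix x y :: "'a set \<Rightarrow>\<^sub>0 'b"
    assume "x \<in> simplicial_chains \<Gamma> i" "y \<in> simplicial_chains \<Gamma> i"
    then show "x + y \<in> simplicial_chains \<Gamma> i" using keys_add[of x y] by (auto simp: simplicial_chains_def)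
  qed (auto simp: simplicial_chains_def in_keys_iff)
qed

lemma reduced_homology_trivial_iff:
  assumes \<Gamma>: "complex \<Gamma>"
  shows "trivial_group (reduced_homology TYPE('k::field) \<Gamma> i) \<longleftrightarrow>
    (\<forall>c :: 'v::linorder set \<Rightarrow>\<^sub>0 'k. c \<in> simplicial_chains \<Gamma> i \<longrightarrow> simplicial_boundary c = 0 \<longrightarrow>
       c \<in> simplicial_boundary ` simplicial_chains \<Gamma> (i + 1))"
proof -
  let ?Z = "simplicial_cycle_group \<Gamma> i :: ('v set \<Rightarrow>\<^sub>0 'k) monoid"
  let ?B = "simplicial_boundary ` simplicial_chains \<Gamma> (i + 1) :: ('v set \<Rightarrow>\<^sub>0 'k) set"
  interpret vs: vector_space "pm_scale :: 'k \<Rightarrow> ('v set \<Rightarrow>\<^sub>0 'k) \<Rightarrow> _" by (rule vector_space_pm_scale)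
  interpret bd: Vector_Spaces.linear "pm_scale :: 'k \<Rightarrow> ('v set \<Rightarrow>\<^sub>0 'k) \<Rightarrow> _" pm_scale simplicial_boundary
    by (rule linear_simplicial_boundary)
  note ch = subspace_simplicial_chains[where 'a='v and 'b='k]
  note chD = vs.subspace_add[OF ch] vs.subspace_neg[OF ch] vs.subspace_0[OF ch]
  have Bsub: "vs.subspace ?B" by (rule bd.subspace_image[OF ch])
  note BD = vs.subspace_add[OF Bsub] vs.subspace_neg[OF Bsub] vs.subspace_0[OF Bsub]
  have comm: "comm_group ?Z"
  proof (rule comm_groupI)
    fix x assume "x \<in> carrier ?Z"
    then show "\<exists>y\<in>carrier ?Z. y \<otimes>\<^bsub>?Z\<^esub> x = \<one>\<^bsub>?Z\<^esub>"
      by (intro bexI[of _ "- x"]) (auto simp: simplicial_cycle_group_def chD bd.neg)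
  qed (auto simp: simplicial_cycle_group_def chD bd.add add_ac)
  interpret Z: comm_group ?Z by (rule comm)
  have invZ: "inv\<^bsub>?Z\<^esub> x = - x" if "x \<in> carrier ?Z" for x
    using that by (intro Z.inv_equality) (auto simp: simplicial_cycle_group_def chD bd.neg)
  have BZ: "?B \<subseteq> carrier ?Z"
    using simplicial_boundary_in_chains[OF \<Gamma>] simplicial_boundary_boundary
    by (auto simp: simplicial_cycle_group_def)
  have "subgroup ?B ?Z"
  proof (rule Z.subgroupI)
    fix a assume a: "a \<in> ?B"
    then show "inv\<^bsub>?Z\<^esub> a \<in> ?B" using invZ[of a] BZ BD(2)[of a] by auto
    fix b assume "b \<in> ?B"
    then show "a \<otimes>\<^bsub>?Z\<^esub> b \<in> ?B" using BD(1)[OF a] by (simp add: simplicial_cycle_group_def)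
  qed (use BZ BD(3) in auto)
  then have norm: "?B \<lhd> ?Z" by (rule Z.subgroup_imp_normal)
  interpret Q: group "?Z Mod ?B" by (rule normal.factorgroup_is_group[OF norm])
  have "trivial_group (?Z Mod ?B) \<longleftrightarrow> (\<lambda>x. ?B #>\<^bsub>?Z\<^esub> x) ` carrier ?Z \<subseteq> {?B}"
    unfolding Q.trivial_group_subset carrier_FactGroup one_FactGroup ..
  also have "\<dots> \<longleftrightarrow> (\<forall>x\<in>carrier ?Z. ?B #>\<^bsub>?Z\<^esub> x = ?B)"
    by (simp only: image_subset_iff singleton_iff)
  also have "\<dots> \<longleftrightarrow> (\<forall>x\<in>carrier ?Z. x \<in> ?B)"
    using Z.coset_join1[OF _ _ \<open>subgroup ?B ?Z\<close>] Z.coset_join2[OF _ \<open>subgroup ?B ?Z\<close>] by meson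
  finally show ?thesis
    by (auto simp: reduced_homology_def simplicial_cycle_group_def)
qed

text \<open>Covers the integers below -1 that the theorem admits: no face has negative size, so
  every chain is zero.\<close>

lemma reduced_homology_below_minus_one:
  assumes "complex \<Gamma>" "i < - 1"
  shows "trivial_group (reduced_homology TYPE('k::field) (\<Gamma> :: 'v::linorder set set) i)"
  unfolding reduced_homology_trivial_iff[OF assms(1)]
proof (intro allI impI)
  fix c :: "'v set \<Rightarrow>\<^sub>0 'k" assume "c \<in> simplicial_chains \<Gamma> i"
  then have "Poly_Mapping.keys c = {}" using assms(2) by (auto simp: simplicial_chains_def)
  then have "c = simplicial_boundary 0" by (simp add: simplicial_boundary_def poly_mapping_eq_iff fun_eq_iff in_keys_iff)
  then show "c \<in> simplicial_boundary ` simplicial_chains \<Gamma> (i + 1)"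
    by (auto simp: simplicial_chains_def)
qed

lemma pairing_chain_0:
  assumes "c \<in> simplicial_chains \<Gamma> (int k - 1)" "\<And>S. S \<in> \<Gamma> \<Longrightarrow> card S = k \<Longrightarrow> \<phi> S = 0"
  shows "pairing \<phi> c = 0"
  unfolding pairing_def using assms by (intro sum.neutral) (auto simp: simplicial_chains_def)

lemma single_in_chains:
  "complex \<Gamma> \<Longrightarrow> S \<in> \<Gamma> \<Longrightarrow> card S = k \<Longrightarrow> Poly_Mapping.single S a \<in> simplicial_chains \<Gamma> (int k - 1)"
  by (auto simp: simplicial_chains_def complex_def)

text \<open>If all cycles are boundaries, a cocycle vanishes on cycles and therefore factors through
  the boundary map. Conversely, a cycle that is no boundary is detected by a functional vanishing on
  boundaries, and this is a cocycle without primitive.\<close>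

theorem reduced_homology_iff_acyclic:
  assumes \<Gamma>: "complex (\<Gamma> :: 'v::linorder set set)"
  shows "trivial_group (reduced_homology TYPE('k::field) \<Gamma> (int k - 1)) \<longleftrightarrow> acyclic_at TYPE('k) {} \<Gamma> k"
proof -
  let ?s = "pm_scale :: 'k \<Rightarrow> ('v set \<Rightarrow>\<^sub>0 'k) \<Rightarrow> _"
  let ?C = "\<lambda>k. simplicial_chains \<Gamma> (int k - 1) :: ('v set \<Rightarrow>\<^sub>0 'k) set"
  have Suc_C: "simplicial_chains \<Gamma> (int k - 1 + 1) = ?C (Suc k)" by simp
  interpret vs: vector_space ?s by (rule vector_space_pm_scale)
  interpret vp: vector_space_pair ?s "(*) :: 'k \<Rightarrow> 'k \<Rightarrow> 'k"
    by (intro vector_space_pair.intro vector_space_pm_scale vector_space_field)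
  interpret vq: vector_space_pair ?s ?s
    by (intro vector_space_pair.intro vector_space_pm_scale)
  interpret bd: Vector_Spaces.linear ?s ?s simplicial_boundary
    by (rule linear_simplicial_boundary)
  note ch = subspace_simplicial_chains[where 'a='v and 'b='k]
  show ?thesis
    unfolding reduced_homology_trivial_iff[OF \<Gamma>] Suc_C
  proof
    assume ex: "\<forall>c. c \<in> ?C k \<longrightarrow> simplicial_boundary c = 0 \<longrightarrow> c \<in> simplicial_boundary ` ?C (Suc k)"
    show "acyclic_at TYPE('k) {} \<Gamma> k"
      unfolding acyclic_at_def
    proof (intro allI impI)
      fix \<phi> :: "'v set \<Rightarrow> 'k"
      assume \<phi>: "\<forall>S\<in>\<Gamma>. card S = Suc k \<longrightarrow> coboundary {} \<phi> S = 0"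
      have ker: "pairing \<phi> c = 0" if c: "c \<in> ?C k" "simplicial_boundary c = 0" for c
      proof -
        obtain e where "e \<in> ?C (Suc k)" "c = simplicial_boundary e" using ex c by blast
        then show ?thesis
          using pairing_chain_0[of e \<Gamma> "Suc k" "coboundary {} \<phi>"] \<phi> by (simp add: pairing_boundary)
      qed
      \<comment> \<open>A linear section of the boundary map over its image: subtracting
        \<open>h ?b\<close> from \<open>?c\<close> below leaves a cycle, so the value of \<phi> at
        \<open>?c\<close> depends only on the boundary.\<close>
      obtain h where h: "range h \<subseteq> ?C k" "Vector_Spaces.linear ?s ?s h"
        "\<forall>b\<in>simplicial_boundary ` ?C k. simplicial_boundary (h b) = b"
        using vq.linear_exists_right_inverse_on[OF linear_simplicial_boundary ch, of \<Gamma> "int k - 1"] by auto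
      have lin: "Vector_Spaces.linear ?s (*) (\<lambda>c. pairing \<phi> (h c))"
        using Vector_Spaces.linear_compose[OF h(2) linear_pairing[of \<phi>]] by (simp add: o_def)
      define \<psi> where "\<psi> F = pairing \<phi> (h (Poly_Mapping.single F 1))" for F
      have "\<phi> S = coboundary {} \<psi> S" if S: "S \<in> \<Gamma>" "card S = k" for S
      proof -
        let ?c = "Poly_Mapping.single S (1::'k)"
        have c: "?c \<in> ?C k" using single_in_chains[OF \<Gamma> S] .
        let ?b = "simplicial_boundary ?c"
        have "pairing \<phi> (?c - h ?b) = 0"
        proof (rule ker)
          show "?c - h ?b \<in> ?C k" using h(1) by (intro vs.subspace_diff[OF ch] c) blast
          show "simplicial_boundary (?c - h ?b) = 0" unfolding bd.diff h(3)[rule_format, OF imageI[OF c]] by simp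
        qed
        then have "pairing \<phi> ?c = pairing \<phi> (h ?b)"
          using pairing_add[of \<phi> "?c - h ?b" "h ?b"] by simp
        also have "\<dots> = pairing \<psi> ?b"
          using linear_functional_eq_pairing[OF lin, of ?b] by (simp add: \<psi>_def[abs_def])
        also have "\<dots> = coboundary {} \<psi> S" by (simp add: pairing_boundary)
        finally show ?thesis by simp
      qed
      then show "\<exists>\<psi>. \<forall>S\<in>\<Gamma>. card S = k \<longrightarrow> \<phi> S = coboundary {} \<psi> S" by blast
    qed
  next
    assume ac: "acyclic_at TYPE('k) {} \<Gamma> k"
    show "\<forall>c. c \<in> ?C k \<longrightarrow> simplicial_boundary c = 0 \<longrightarrow> c \<in> simplicial_boundary ` ?C (Suc k)"
    proof (intro allI impI, rule ccontr)
      fix z assume z: "z \<in> ?C k" "simplicial_boundary z = 0" "z \<notin> simplicial_boundary ` ?C (Suc k)"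
      let ?B = "simplicial_boundary ` ?C (Suc k)"
      have sub: "vs.subspace ?B" by (rule bd.subspace_image[OF ch])
      obtain B where B: "B \<subseteq> ?B" "vs.independent B" "?B \<subseteq> vs.span B"
        using vs.maximal_independent_subset by blast
      have "vs.span B \<subseteq> ?B" using vs.span_minimal[OF B(1) sub] .
      then have zB: "z \<notin> vs.span B" using z by blast
      then have "vs.independent (insert z B)" using B(2) by (rule vs.independent_insertI)
      \<comment> \<open>A basis of the boundaries, extended by \<open>z\<close>, admits a functional
        that is 1 at \<open>z\<close> and 0 on all boundaries.\<close>
      then obtain g where g: "Vector_Spaces.linear ?s (*) g" "\<And>x. x \<in> insert z B \<Longrightarrow> g x = (if x = z then 1 else 0)"
        using vp.linear_independent_extend[of "insert z B" "\<lambda>x. if x = z then 1 else 0"] by blast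
      have "z \<notin> B" using zB vs.span_base by blast
      then have "g b = 0" if "b \<in> B" for b using g(2)[of b] that by auto
      then have gB: "g b = 0" if "b \<in> ?B" for b
        using vp.linear_eq_0_on_span[OF g(1), of B b] B(3) that by blast
      define \<phi> where "\<phi> F = g (Poly_Mapping.single F 1)" for F
      have g\<phi>: "g c = pairing \<phi> c" for c
        unfolding \<phi>_def by (rule linear_functional_eq_pairing[OF g(1)])
      have "coboundary {} \<phi> S = 0" if "S \<in> \<Gamma>" "card S = Suc k" for S
      proof -
        have "coboundary {} \<phi> S = g (simplicial_boundary (Poly_Mapping.single S 1))"
          by (simp add: g\<phi> pairing_boundary)
        then show ?thesis using gB[OF imageI[OF single_in_chains[OF \<Gamma> that]]] by simp
      qed
      then obtain \<psi> where \<psi>: "\<And>S. S \<in> \<Gamma> \<Longrightarrow> card S = k \<Longrightarrow> \<phi> S = coboundary {} \<psi> S"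
        using acyclic_atD[OF ac, of \<phi>] by blast
      have "pairing \<phi> z = pairing (coboundary {} \<psi>) z"
        unfolding pairing_def using z(1) by (intro sum.cong) (auto simp: simplicial_chains_def \<psi>)
      also have "\<dots> = 0" using z(2) by (simp flip: pairing_boundary)
      finally show False using g(2)[of z] by (simp add: g\<phi>)
    qed
  qed
qed

section \<open>The multigraded Koszul complex of a face ring\<close>

lemma lookup_osign_mult:
  "Poly_Mapping.lookup (osign v S * p :: ('b \<Rightarrow>\<^sub>0 nat) \<Rightarrow>\<^sub>0 'k::comm_ring_1) m = osign v S * Poly_Mapping.lookup p m"
  unfolding osign_def by (cases "even (card {w \<in> S. w < v})") simp_all

lemma single_add_diff:
  fixes m :: "'b \<Rightarrow>\<^sub>0 nat"
  assumes "v \<in> Poly_Mapping.keys m"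
  shows "Poly_Mapping.single v 1 + (m - Poly_Mapping.single v 1) = m"
proof (rule poly_mapping_le_add_diff)
  fix w show "Poly_Mapping.lookup (Poly_Mapping.single v 1) w \<le> Poly_Mapping.lookup m w"
    using assms by (auto simp: lookup_single when_def in_keys_iff)
qed

lemma lookup_var_mult:
  "Poly_Mapping.lookup (var v * p :: 'k::field mpoly) m =
     (if v \<in> Poly_Mapping.keys m then Poly_Mapping.lookup p (m - Poly_Mapping.single v 1) else 0)"
proof (cases "v \<in> Poly_Mapping.keys m")
  case True
  then show ?thesis
    using lookup_single_mult[of "Poly_Mapping.single v 1" 1 p "m - Poly_Mapping.single v 1"]
    by (simp only: single_add_diff var_def) simp
next
  case False
  have "m \<notin> Poly_Mapping.keys (var v * p)"
  proof
    assume "m \<in> Poly_Mapping.keys (var v * p)"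
    then obtain a b where "a \<in> Poly_Mapping.keys (var v :: 'k mpoly)" "m = a + b"
      using keys_mult_subset by blast
    then show False using False by (auto simp: var_def keys_add_nat split: if_splits)
  qed
  then show ?thesis using False by (simp add: in_keys_iff)
qed

definition indicator_exp :: "'v set \<Rightarrow> 'v \<Rightarrow>\<^sub>0 nat" where
  "indicator_exp A = (\<Sum>v\<in>A. Poly_Mapping.single v 1)"

lemma lookup_indicator_exp: "finite A \<Longrightarrow> Poly_Mapping.lookup (indicator_exp A) v = (if v \<in> A then 1 else 0)"
  by (simp add: indicator_exp_def lookup_sum lookup_single when_def)

lemma keys_indicator_exp [simp]: "finite A \<Longrightarrow> Poly_Mapping.keys (indicator_exp A) = A"
  by (auto simp: in_keys_iff lookup_indicator_exp split: if_splits)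

lemma indicator_exp_diff_add:
  assumes "finite A" "A \<subseteq> Poly_Mapping.keys b"
  shows "b - indicator_exp A + indicator_exp A = b"
proof -
  have "indicator_exp A + (b - indicator_exp A) = b"
  proof (rule poly_mapping_le_add_diff)
    fix v show "Poly_Mapping.lookup (indicator_exp A) v \<le> Poly_Mapping.lookup b v"
      using assms by (auto simp: lookup_indicator_exp in_keys_iff)
  qed
  then show ?thesis by (simp add: add.commute)
qed

text \<open>The span of the monomials whose support is a non-face, so that membership is tested on
  single exponents. With \<open>Pow F\<close> as complex it is the prime ideal generated by the
  variables outside \<open>F\<close>.\<close>

definition face_ideal :: "nat set \<Rightarrow> nat set set \<Rightarrow> 'k::field mpoly set" where
  "face_ideal X \<Delta> = {p \<in> polys X. \<forall>m \<in> Poly_Mapping.keys p. Poly_Mapping.keys m \<notin> \<Delta>}"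

lemma var_in_polys: "v \<in> X \<Longrightarrow> var v \<in> polys X"
  by (simp add: var_def polys_def)

locale complex_on =
  fixes K :: "'k::field itself" and X :: "nat set" and \<Delta> :: "nat set set"
  assumes finite_vertices: "finite X" and complex: "complex \<Delta>" and faces: "F \<in> \<Delta> \<Longrightarrow> F \<subseteq> X"
begin

sublocale noetherian_koszul "polys X :: 'k mpoly set" X var
proof -
  interpret noetherian_subring "polys X :: 'k mpoly set" by (rule hilbert_basis[OF finite_vertices])
  show "noetherian_koszul (polys X :: 'k mpoly set) X var"
    by unfold_locales (auto simp: finite_vertices var_in_polys)
qed

text \<open>The basis cochain at \<open>S\<close> has degree \<open>-1\<^sub>S\<close>, so the monomial \<open>m\<close> at \<open>S\<close> lies in degree
  \<open>m - 1\<^sub>S\<close>; adding \<open>1\<^sub>X\<close> makes the exponent \<open>b = m + 1\<^bsub>X - S\<^esub>\<close> a natural number.\<close>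

lemma lookup_koszul_d:
  fixes z :: "nat set \<Rightarrow> 'k mpoly"
  assumes S: "S \<subseteq> X" and m: "Poly_Mapping.keys m \<subseteq> X"
    and b: "b = m + indicator_exp (X - S)" and T: "T = X - Poly_Mapping.keys b"
  shows "Poly_Mapping.lookup (koszul_d var z S) m =
    coboundary T (\<lambda>R. Poly_Mapping.lookup (z (R \<union> T)) (b - indicator_exp (X - (R \<union> T)))) (S - T)"
proof -
  \<comment> \<open>These are the vertices of degree -1: they lie in \<open>S\<close> and their
    variable does not divide \<open>m\<close>, so their terms in the differential vanish at
    \<open>m\<close>.\<close>
  have T': "T = S - Poly_Mapping.keys m"
    using S m finite_vertices by (auto simp: T b keys_add_nat)
  have fin: "finite S" using S by (rule finite_subset_X)
  have "Poly_Mapping.lookup (koszul_d var z S) m =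
    (\<Sum>v\<in>S. osign v S * (if v \<in> Poly_Mapping.keys m then Poly_Mapping.lookup (z (S - {v})) (m - Poly_Mapping.single v 1) else 0))"
    unfolding koszul_d_def lookup_sum mult.assoc lookup_osign_mult lookup_var_mult ..
  also have "\<dots> = (\<Sum>v\<in>S - T. osign v S * Poly_Mapping.lookup (z (S - {v})) (m - Poly_Mapping.single v 1))"
    using fin by (intro sum.mono_neutral_cong_right) (auto simp: T')
  also have "\<dots> = coboundary T (\<lambda>R. Poly_Mapping.lookup (z (R \<union> T)) (b - indicator_exp (X - (R \<union> T)))) (S - T)"
    unfolding coboundary_def
  proof (rule sum.cong)
    fix v assume v: "v \<in> S - T"
    have eq: "S - T \<union> T = S" "S - T - {v} \<union> T = S - {v}" using T' v by auto
    have "m - Poly_Mapping.single v 1 = b - indicator_exp (X - (S - {v}))"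
      using S v finite_vertices
      by (intro poly_mapping_eqI) (auto simp: b T' lookup_minus lookup_add lookup_single when_def lookup_indicator_exp)
    then show "osign v S * Poly_Mapping.lookup (z (S - {v})) (m - Poly_Mapping.single v 1) =
      osign v (S - T \<union> T) * Poly_Mapping.lookup (z (S - T - {v} \<union> T)) (b - indicator_exp (X - (S - T - {v} \<union> T)))"
      by (simp only: eq)
  qed simp
  finally show ?thesis .
qed

text \<open>Contraction with the cone vertex \<open>u\<close> is a homotopy from the identity to
  zero: the Koszul homotopy with all \<open>x v\<close> equal to 1.\<close>

lemma acyclic_at_cone:
  fixes \<Gamma> :: "nat set set"
  assumes \<Gamma>: "\<And>S. S \<in> \<Gamma> \<Longrightarrow> finite S \<and> insert u S \<in> \<Gamma>"
  shows "acyclic_at TYPE('k) {} \<Gamma> k"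
  unfolding acyclic_at_def
proof (intro allI impI)
  fix \<phi> :: "nat set \<Rightarrow> 'k" assume \<phi>: "\<forall>S\<in>\<Gamma>. card S = Suc k \<longrightarrow> coboundary {} \<phi> S = 0"
  have eq: "koszul_d (\<lambda>_. 1) f = coboundary {} f" for f :: "nat set \<Rightarrow> 'k"
    by (simp add: koszul_d_def coboundary_def fun_eq_iff)
  show "\<exists>\<psi>. \<forall>S\<in>\<Gamma>. card S = k \<longrightarrow> \<phi> S = coboundary {} \<psi> S"
  proof (intro exI ballI impI)
    fix S assume S: "S \<in> \<Gamma>" "card S = k"
    have "koszul_h u (coboundary {} \<phi>) S = 0"
      using \<phi> S \<Gamma>[OF S(1)] by (auto simp: koszul_h_def)
    then show "\<phi> S = coboundary {} (koszul_h u \<phi>) S"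
      using koszul_homotopy[of S "\<lambda>_. 1" u \<phi>] \<Gamma>[OF S(1)] by (simp add: eq)
  qed
qed

text \<open>If \<open>P\<close> is nonempty, the faces \<open>R\<close> with \<open>R \<union> P \<in> \<Delta>\<close> form a cone.\<close>

lemma acyclic_at_slice:
  assumes P: "P \<inter> T = {}" and T: "T \<subseteq> X"
    and ac: "acyclic_at TYPE('k) {} (deletion \<Delta> T) k"
  shows "acyclic_at TYPE('k) T {R. R \<inter> T = {} \<and> R \<union> P \<in> \<Delta>} k"
proof -
  let ?\<Gamma> = "{R. R \<inter> T = {} \<and> R \<union> P \<in> \<Delta>}"
  have fin: "finite R" if "R \<in> ?\<Gamma>" for R
    using that complex by (auto simp: complex_def)
  have "acyclic_at TYPE('k) {} ?\<Gamma> k"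
  proof (cases "P = {}")
    case True
    then show ?thesis using ac by (simp add: deletion_def conj_commute)
  next
    case False
    then obtain u where u: "u \<in> P" by auto
    show ?thesis
    proof (rule acyclic_at_cone)
      fix S assume S: "S \<in> ?\<Gamma>"
      have "insert u S \<union> P = S \<union> P" using u by auto
      then show "finite S \<and> insert u S \<in> ?\<Gamma>" using S fin u P by auto
    qed
  qed
  then show ?thesis
    using T finite_subset_X fin by (subst acyclic_at_twist) auto
qed

lemma face_idealI:
  assumes "p \<in> polys X"
    "\<And>m. Poly_Mapping.keys m \<in> \<Delta> \<Longrightarrow> Poly_Mapping.keys m \<subseteq> X \<Longrightarrow> Poly_Mapping.lookup p m = 0"
  shows "p \<in> face_ideal X \<Delta>"
  using assms faces by (auto simp: face_ideal_def in_keys_iff)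

lemma face_idealD: "p \<in> face_ideal X \<Delta> \<Longrightarrow> Poly_Mapping.keys m \<in> \<Delta> \<Longrightarrow> Poly_Mapping.lookup p m = 0"
  by (auto simp: face_ideal_def in_keys_iff)

text \<open>The cochain has finitely many homogeneous components; a primitive is chosen for each of
  them, and these are reassembled into polynomials. The parameter \<open>b\<close> is the degree
  shifted by 1 on \<open>X\<close>.\<close>

lemma koszul_exact_of_acyclic:
  assumes ac: "\<And>T. T \<subseteq> X \<Longrightarrow> card T \<le> i \<Longrightarrow> acyclic_at TYPE('k) {} (deletion \<Delta> T) (i - card T)"
  shows "koszul_exact i (face_ideal X \<Delta>)"
  unfolding koszul_exact_def
proof (intro allI impI, elim conjE)
  fix z :: "nat set \<Rightarrow> 'k mpoly"
  assume z: "\<forall>S. z S \<in> polys X" "\<forall>S\<subseteq>X. card S = Suc i \<longrightarrow> koszul_d var z S \<in> face_ideal X \<Delta>"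
  \<comment> \<open>\<open>T b\<close> collects the vertices of degree -1 and \<open>P b\<close>
    those of positive degree; a monomial of degree \<open>b\<close> at \<open>S\<close> has support
    \<open>(S - T b) \<union> P b\<close>.\<close>
  define T where "T b = X - Poly_Mapping.keys b" for b :: "nat \<Rightarrow>\<^sub>0 nat"
  define P where "P b = {v. Poly_Mapping.lookup b v \<ge> 2}" for b :: "nat \<Rightarrow>\<^sub>0 nat"
  define \<phi> where "\<phi> b R = Poly_Mapping.lookup (z (R \<union> T b)) (b - indicator_exp (X - (R \<union> T b)))" for b R
  define B where "B = (\<Union>S\<in>Pow X. (\<lambda>m. m + indicator_exp (X - S)) ` Poly_Mapping.keys (z S))"
  have finB: "finite B" using finite_vertices by (simp add: B_def)
  have B_X: "Poly_Mapping.keys b \<subseteq> X" if "b \<in> B" for b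
    using that z(1) finite_vertices by (fastforce simp: B_def polys_def keys_add_nat)
  have keys_m: "Poly_Mapping.keys m = (S - T b) \<union> P b"
    if "S \<subseteq> X" "Poly_Mapping.keys m \<subseteq> X" "b = m + indicator_exp (X - S)" for S m b
    using that finite_vertices
    by (auto simp: T_def P_def keys_add_nat lookup_add lookup_indicator_exp in_keys_iff split: if_splits)
  have "\<exists>\<psi>. \<forall>R. R \<inter> T b = {} \<longrightarrow> R \<union> P b \<in> \<Delta> \<longrightarrow> card R + card (T b) = i \<longrightarrow> \<phi> b R = coboundary (T b) \<psi> R"
    if b: "b \<in> B" for b
  proof (cases "card (T b) \<le> i")
    case False
    then show ?thesis by auto
  next
    case True
    let ?k = "i - card (T b)"
    let ?\<Gamma> = "{R. R \<inter> T b = {} \<and> R \<union> P b \<in> \<Delta>}"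
    have TX: "T b \<subseteq> X" by (auto simp: T_def)
    have finT: "finite (T b)" using finite_subset_X[OF TX] .
    have ac': "acyclic_at TYPE('k) (T b) ?\<Gamma> ?k"
      by (rule acyclic_at_slice[OF _ TX ac[OF TX True]]) (auto simp: T_def P_def in_keys_iff)
    have "coboundary (T b) (\<phi> b) R = 0" if R: "R \<in> ?\<Gamma>" "card R = Suc ?k" for R
    proof -
      define S where "S = R \<union> T b"
      have RX: "R \<subseteq> X" using R faces[of "R \<union> P b"] by auto
      have S: "S \<subseteq> X" "S - T b = R" using RX TX R by (auto simp: S_def)
      have cS: "card S = Suc i"
        using R finT finite_subset_X[OF RX] True by (simp add: S_def card_Un_disjoint)
      define m where "m = b - indicator_exp (X - S)"
      have bm: "b = m + indicator_exp (X - S)"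
        unfolding m_def by (rule indicator_exp_diff_add[symmetric]) (auto simp: S_def T_def finite_vertices)
      have mX: "Poly_Mapping.keys m \<subseteq> X" using B_X[OF b] bm by (simp add: keys_add_nat)
      have "Poly_Mapping.lookup (koszul_d var z S) m = coboundary (T b) (\<phi> b) R"
        using lookup_koszul_d[OF S(1) mX bm, of "T b" z] S by (simp add: T_def \<phi>_def[abs_def])
      moreover have "Poly_Mapping.keys m \<in> \<Delta>" using keys_m[OF S(1) mX bm] S R by simp
      ultimately show ?thesis
        using face_idealD[of "koszul_d var z S" m] z(2) S(1) cS by auto
    qed
    then obtain \<psi> where "\<And>R. R \<in> ?\<Gamma> \<Longrightarrow> card R = ?k \<Longrightarrow> \<phi> b R = coboundary (T b) \<psi> R"
      using acyclic_atD[OF ac', of "\<phi> b"] by blast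
    then show ?thesis by (intro exI[of _ \<psi>]) auto
  qed
  then obtain \<psi>0 where \<psi>0: "\<And>b R. b \<in> B \<Longrightarrow> R \<inter> T b = {} \<Longrightarrow> R \<union> P b \<in> \<Delta> \<Longrightarrow> card R + card (T b) = i \<Longrightarrow>
      \<phi> b R = coboundary (T b) (\<psi>0 b) R"
    by metis
  define \<psi> where "\<psi> b R = (if b \<in> B then \<psi>0 b R else 0)" for b R
  \<comment> \<open>Only degrees that can carry a monomial at \<open>S\<close> enter; for the others
    the truncated difference would give a monomial of a different degree.\<close>
  define y :: "nat set \<Rightarrow> 'k mpoly" where
    "y S = (\<Sum>b\<in>{b \<in> B. X - S \<subseteq> Poly_Mapping.keys b}. Poly_Mapping.single (b - indicator_exp (X - S)) (\<psi> b (S - T b)))" for S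
  have y: "y S \<in> polys X" for S
    unfolding y_def
  proof (rule sum_mem)
    fix b assume "b \<in> {b \<in> B. X - S \<subseteq> Poly_Mapping.keys b}"
    then have "Poly_Mapping.keys b \<subseteq> X" using B_X by auto
    moreover have "Poly_Mapping.keys (b - indicator_exp (X - S)) \<subseteq> Poly_Mapping.keys b"
      by (auto simp: in_keys_iff lookup_minus)
    ultimately show "Poly_Mapping.single (b - indicator_exp (X - S)) (\<psi> b (S - T b)) \<in> polys X"
      by (auto simp: polys_def)
  qed
  have lookup_y: "Poly_Mapping.lookup (y S) m = \<psi> b (S - T b)" if b: "b = m + indicator_exp (X - S)" for S m b
  proof -
    have iff: "c - indicator_exp (X - S) = m \<longleftrightarrow> c = b" if "X - S \<subseteq> Poly_Mapping.keys c" for c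
      using indicator_exp_diff_add[OF _ that] finite_vertices b by auto
    have "Poly_Mapping.lookup (y S) m = (\<Sum>c\<in>{b \<in> B. X - S \<subseteq> Poly_Mapping.keys b}. if c = b then \<psi> c (S - T c) else 0)"
      unfolding y_def lookup_sum using iff by (intro sum.cong) (auto simp: lookup_single when_def)
    also have "\<dots> = \<psi> b (S - T b)"
      using finB b finite_vertices by (simp add: \<psi>_def keys_add_nat)
    finally show ?thesis .
  qed
  have "z S - koszul_d var y S \<in> face_ideal X \<Delta>" if S: "S \<subseteq> X" "card S = i" for S
  proof (rule face_idealI)
    show "z S - koszul_d var y S \<in> polys X"
      using z(1) y koszul_d_mem[OF ideal_C S(1)] by (intro diff_mem) auto
    fix m :: "nat \<Rightarrow>\<^sub>0 nat" assume m: "Poly_Mapping.keys m \<in> \<Delta>" "Poly_Mapping.keys m \<subseteq> X"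
    define b where "b = m + indicator_exp (X - S)"
    define R where "R = S - T b"
    have TS: "T b \<subseteq> S" using S finite_vertices by (auto simp: T_def b_def keys_add_nat)
    have RT: "R \<union> T b = S" "R \<inter> T b = {}" using TS by (auto simp: R_def)
    have cR: "card R + card (T b) = i"
      using card_Un_disjoint[of R "T b"] RT finite_subset_X[OF S(1)] S TS finite_subset by auto
    have "Poly_Mapping.lookup (koszul_d var y S) m =
      coboundary (T b) (\<lambda>R. Poly_Mapping.lookup (y (R \<union> T b)) (b - indicator_exp (X - (R \<union> T b)))) R"
      unfolding R_def using lookup_koszul_d[OF S(1) m(2) b_def, of "T b" y] by (simp add: T_def)
    also have "\<dots> = coboundary (T b) (\<psi> b) R"
    proof (rule coboundary_cong)
      fix v assume "v \<in> R"
      let ?Q = "R - {v}"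
      have "b = b - indicator_exp (X - (?Q \<union> T b)) + indicator_exp (X - (?Q \<union> T b))"
        by (rule indicator_exp_diff_add[symmetric]) (auto simp: finite_vertices T_def)
      then have "Poly_Mapping.lookup (y (?Q \<union> T b)) (b - indicator_exp (X - (?Q \<union> T b))) = \<psi> b (?Q \<union> T b - T b)"
        by (rule lookup_y)
      also have "?Q \<union> T b - T b = ?Q" using RT by auto
      finally show "Poly_Mapping.lookup (y (?Q \<union> T b)) (b - indicator_exp (X - (?Q \<union> T b))) = \<psi> b ?Q" .
    qed
    also have "\<dots> = Poly_Mapping.lookup (z S) m"
    proof (cases "b \<in> B")
      case True
      have "R \<union> P b \<in> \<Delta>" using keys_m[OF S(1) m(2) b_def] m(1) by (simp add: R_def)
      then have "\<phi> b R = coboundary (T b) (\<psi>0 b) R" using \<psi>0[OF True RT(2)] cR by simp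
      moreover have "\<psi> b = \<psi>0 b" using True by (simp add: \<psi>_def fun_eq_iff)
      moreover have "b - indicator_exp (X - S) = m" by (simp add: b_def)
      ultimately show ?thesis by (simp add: \<phi>_def RT(1))
    next
      case False
      then have "m \<notin> Poly_Mapping.keys (z S)" using S by (auto simp: B_def b_def)
      then show ?thesis using False by (simp add: coboundary_def \<psi>_def in_keys_iff)
    qed
    finally show "Poly_Mapping.lookup (z S - koszul_d var y S) m = 0"
      by (simp add: lookup_minus)
  qed
  then show "\<exists>y. (\<forall>S. y S \<in> polys X) \<and> (\<forall>S\<subseteq>X. card S = i \<longrightarrow> z S - koszul_d var y S \<in> face_ideal X \<Delta>)"
    using y by blast
qed

text \<open>A cochain of the deletion is placed in the single strand of degree -1 on
  \<open>T\<close> and 0 on the rest of \<open>X\<close>; the coefficients of a Koszul primitive in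
  that strand form the desired primitive.\<close>

lemma acyclic_of_koszul_exact:
  assumes ex: "koszul_exact i (face_ideal X \<Delta>)" and TX: "T \<subseteq> X" and cT: "card T \<le> i"
  shows "acyclic_at TYPE('k) {} (deletion \<Delta> T) (i - card T)"
proof -
  let ?k = "i - card T"
  have finT: "finite T" using finite_subset_X[OF TX] .
  have del: "finite R" "R \<inter> T = {}" "R \<in> \<Delta>" "R \<subseteq> X" if "R \<in> deletion \<Delta> T" for R
    using that complex faces by (auto simp: deletion_def complex_def)
  define b where "b = (indicator_exp (X - T) :: nat \<Rightarrow>\<^sub>0 nat)"
  have Tb: "T = X - Poly_Mapping.keys b" using TX finite_vertices by (auto simp: b_def)
  have bR: "b - indicator_exp (X - (R \<union> T)) = indicator_exp R" if "R \<inter> T = {}" "R \<subseteq> X" for R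
    using that finite_vertices finite_subset_X[OF that(2)]
    by (intro poly_mapping_eqI) (auto simp: b_def lookup_minus lookup_indicator_exp)
  have "acyclic_at TYPE('k) T (deletion \<Delta> T) ?k"
    unfolding acyclic_at_def
  proof (intro allI impI)
    fix \<phi> :: "nat set \<Rightarrow> 'k" assume \<phi>: "\<forall>S\<in>deletion \<Delta> T. card S = Suc ?k \<longrightarrow> coboundary T \<phi> S = 0"
    \<comment> \<open>The squarefree monomial of \<open>S - T\<close>, placed at \<open>S\<close>,
      has degree -1 on \<open>T\<close> and 0 elsewhere.\<close>
    define z :: "nat set \<Rightarrow> 'k mpoly" where
      "z S = (if T \<subseteq> S \<and> S \<subseteq> X then Poly_Mapping.single (indicator_exp (S - T)) (\<phi> (S - T)) else 0)" for S
    have z: "z S \<in> polys X" for S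
      using finite_subset_X[of S] by (auto simp: z_def polys_def)
    have z_lookup: "Poly_Mapping.lookup (z (R \<union> T)) (c - indicator_exp (X - (R \<union> T))) = (if c = b then \<phi> R else 0)"
      if "R \<inter> T = {}" "R \<subseteq> X" "X - (R \<union> T) \<subseteq> Poly_Mapping.keys c" for R c
    proof -
      have R: "R \<union> T - T = R" using that by auto
      have b: "indicator_exp R + indicator_exp (X - (R \<union> T)) = b"
        unfolding bR[OF that(1,2), symmetric]
        by (rule indicator_exp_diff_add) (use finite_vertices Tb in auto)
      have "c - indicator_exp (X - (R \<union> T)) + indicator_exp (X - (R \<union> T)) = c"
        by (rule indicator_exp_diff_add) (use finite_vertices that(3) in auto)
      then have "c - indicator_exp (X - (R \<union> T)) = indicator_exp R \<longleftrightarrow> c = b"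
        unfolding b[symmetric] by (metis add_right_cancel)
      then show ?thesis using that TX by (auto simp: z_def R lookup_single when_def)
    qed
    have "koszul_d var z S \<in> face_ideal X \<Delta>" if S: "S \<subseteq> X" "card S = Suc i" for S
    proof (rule face_idealI)
      show "koszul_d var z S \<in> polys X" using z by (intro koszul_d_mem[OF ideal_C S(1)]) auto
      fix m :: "nat \<Rightarrow>\<^sub>0 nat" assume m: "Poly_Mapping.keys m \<in> \<Delta>" "Poly_Mapping.keys m \<subseteq> X"
      define c where "c = m + indicator_exp (X - S)"
      define U where "U = X - Poly_Mapping.keys c"
      have "Poly_Mapping.lookup (koszul_d var z S) m =
        coboundary U (\<lambda>R. Poly_Mapping.lookup (z (R \<union> U)) (c - indicator_exp (X - (R \<union> U)))) (S - U)"
        by (rule lookup_koszul_d[OF S(1) m(2) c_def U_def])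
      also have "\<dots> = 0"
      proof (cases "c = b")
        case True
        then have UT: "U = T" by (simp add: U_def Tb)
        have TS: "T \<subseteq> S"
          using S(1) finite_vertices unfolding UT[symmetric] U_def c_def by (auto simp: keys_add_nat)
        have m_eq: "m = indicator_exp (S - T)"
        proof -
          have eq: "S - T \<union> T = S" using TS by auto
          have "indicator_exp (S - T) = b - indicator_exp (X - S)"
          proof (rule bR[of "S - T", unfolded eq, symmetric])
            show "S - T \<subseteq> X" using S by auto
          qed auto
          also have "\<dots> = m" unfolding True[symmetric] c_def by simp
          finally show ?thesis ..
        qed
        have "S - T \<in> deletion \<Delta> T"
          using m(1) finite_subset_X[OF S(1)] by (auto simp: m_eq deletion_def)
        moreover have "card (S - T) = Suc ?k"
          using card_Diff_subset[OF finT TS] S cT by simp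
        ultimately have "coboundary T \<phi> (S - T) = 0" using \<phi> by simp
        moreover have "coboundary T (\<lambda>R. Poly_Mapping.lookup (z (R \<union> T)) (b - indicator_exp (X - (R \<union> T)))) (S - T)
            = coboundary T \<phi> (S - T)"
          using S(1) Tb by (intro coboundary_cong, subst z_lookup) auto
        ultimately show ?thesis using True UT by simp
      next
        case False
        show ?thesis
          unfolding coboundary_def
        proof (rule sum.neutral, rule ballI)
          fix v assume v: "v \<in> S - U"
          let ?S = "S - U - {v} \<union> U"
          have "Poly_Mapping.lookup (z ?S) (c - indicator_exp (X - ?S)) = 0"
          proof (cases "T \<subseteq> ?S \<and> ?S \<subseteq> X")
            case True
            have "X - (?S - T \<union> T) \<subseteq> Poly_Mapping.keys c" by (auto simp: U_def)
            moreover have "?S - T \<union> T = ?S" using True by auto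
            moreover have "(?S - T) \<inter> T = {}" "?S - T \<subseteq> X" using True by auto
            ultimately show ?thesis using z_lookup[of "?S - T" c] False by simp
          next
            case False
            then have "z ?S = 0" unfolding z_def by (rule if_not_P)
            then show ?thesis by simp
          qed
          then show "osign v (S - U \<union> U) * Poly_Mapping.lookup (z ?S) (c - indicator_exp (X - ?S)) = 0" by simp
        qed
      qed
      finally show "Poly_Mapping.lookup (koszul_d var z S) m = 0" .
    qed
    then have "\<exists>y. (\<forall>S. y S \<in> polys X) \<and> (\<forall>S\<subseteq>X. card S = i \<longrightarrow> z S - koszul_d var y S \<in> face_ideal X \<Delta>)"
      using z by (intro ex[unfolded koszul_exact_def, rule_format]) blast
    then obtain y where y: "\<forall>S. y S \<in> polys X" "\<forall>S\<subseteq>X. card S = i \<longrightarrow> z S - koszul_d var y S \<in> face_ideal X \<Delta>"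
      by blast
    define \<psi> where "\<psi> R = Poly_Mapping.lookup (y (R \<union> T)) (b - indicator_exp (X - (R \<union> T)))" for R
    have "\<phi> R = coboundary T \<psi> R" if R: "R \<in> deletion \<Delta> T" "card R = ?k" for R
    proof -
      note R' = del[OF R(1)]
      define S where "S = R \<union> T"
      have S: "S \<subseteq> X" "S - T = R" using R' TX by (auto simp: S_def)
      have cS: "card S = i" using R R' finT cT by (simp add: S_def card_Un_disjoint)
      have bm: "b = indicator_exp R + indicator_exp (X - S)"
        unfolding S_def bR[OF R'(2,4), symmetric]
        by (rule indicator_exp_diff_add[symmetric]) (use Tb finite_vertices in auto)
      have "Poly_Mapping.lookup (z S - koszul_d var y S) (indicator_exp R) = 0"
        using y(2) S cS R' by (intro face_idealD) auto
      moreover have "Poly_Mapping.lookup (koszul_d var y S) (indicator_exp R) = coboundary T \<psi> R"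
        using lookup_koszul_d[OF S(1) _ bm Tb, of y] R' S(2) by (simp add: \<psi>_def[abs_def])
      moreover have "Poly_Mapping.lookup (z S) (indicator_exp R) = \<phi> R"
        using S TX by (simp add: z_def) (simp add: S_def)
      ultimately show ?thesis by (simp add: lookup_minus)
    qed
    then show "\<exists>\<psi>. \<forall>S\<in>deletion \<Delta> T. card S = ?k \<longrightarrow> \<phi> S = coboundary T \<psi> S" by blast
  qed
  then show ?thesis using del finT by (subst (asm) acyclic_at_twist) auto
qed

text \<open>The strand of \<open>T\<close> contributes to degree \<open>i\<close> through faces of
  size \<open>i - card T\<close>; the substitution \<open>i = k + card T\<close> produces the bound
  used in the exchange of links and deletions.\<close>

theorem koszul_exact_iff_links:
  "(\<forall>i<d. koszul_exact i (face_ideal X \<Delta>)) \<longleftrightarrow>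
   (\<forall>F\<subseteq>X. \<forall>k. k + card F < d \<longrightarrow> acyclic_at TYPE('k) {} (link \<Delta> F) k)"
proof -
  have "(\<forall>i<d. koszul_exact i (face_ideal X \<Delta>)) \<longleftrightarrow>
    (\<forall>i<d. \<forall>T\<subseteq>X. card T \<le> i \<longrightarrow> acyclic_at TYPE('k) {} (deletion \<Delta> T) (i - card T))"
    using koszul_exact_of_acyclic acyclic_of_koszul_exact by meson
  also have "\<dots> \<longleftrightarrow> (\<forall>T\<subseteq>X. \<forall>k. k + card T < d \<longrightarrow> acyclic_at TYPE('k) {} (deletion \<Delta> T) k)"
  proof (intro iffI allI impI)
    fix T k assume a: "\<forall>i<d. \<forall>T\<subseteq>X. card T \<le> i \<longrightarrow> acyclic_at TYPE('k) {} (deletion \<Delta> T) (i - card T)"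
      and "T \<subseteq> X" "k + card T < d"
    then show "acyclic_at TYPE('k) {} (deletion \<Delta> T) k"
      using a[rule_format, of "k + card T" T] by simp
  qed (metis le_add_diff_inverse2)
  finally show ?thesis
    using acyclic_links_iff_deletions[OF complex finite_vertices, of d, where 'k='k] by blast
qed

end

section \<open>Quotient modules of a subring\<close>

context comm_subring
begin

text \<open>The same record as in \<open>polynomial_ring\<close>, so that the two agree by unfolding
  definitions.\<close>

abbreviation R :: "'a ring" where
  "R \<equiv> \<lparr>carrier = C, monoid.mult = (*), one = 1, ring.zero = 0, add = (+)\<rparr>"

lemma cring_R: "cring R"
proof (rule cringI)
  show "abelian_group R"
  proof (rule abelian_groupI)
    fix x assume "x \<in> carrier R"
    then show "\<exists>y\<in>carrier R. y \<oplus>\<^bsub>R\<^esub> x = \<zero>\<^bsub>R\<^esub>"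
      by (auto intro!: bexI[of _ "- x"] uminus_mem)
  qed (auto simp: add_mem zero_mem add_ac)
  show "comm_monoid R"
    by (rule comm_monoidI) (auto simp: mult_mem one_mem mult_ac)
qed (simp add: distrib_right)

lemma ideal_R_iff: "ideal J R \<longleftrightarrow> is_ideal J"
proof
  assume "ideal J R"
  then interpret ideal J R .
  show "is_ideal J"
    unfolding is_ideal_def
    using a_subset additive_subgroup.zero_closed[OF is_additive_subgroup]
      additive_subgroup.a_closed[OF is_additive_subgroup] I_l_closed by auto
next
  assume J: "is_ideal J"
  interpret cring R by (rule cring_R)
  have inv: "\<ominus>\<^bsub>R\<^esub> a = - a" if "a \<in> C" for a
    using minus_equality[of "- a" a] that uminus_mem by simp
  show "ideal J R"
  proof (rule idealI)
    show "ring R" by (rule ring_axioms)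
    show "subgroup J (add_monoid R)"
      by (rule add.subgroupI)
        (use is_idealD[OF J] inv in \<open>auto simp: a_inv_def[symmetric]\<close>)
  qed (use is_idealD[OF J] in auto)
qed

lemma primeideal_R_iff: "primeideal P R \<longleftrightarrow> is_prime P"
proof
  assume "primeideal P R"
  then interpret primeideal P R .
  have "1 \<notin> P" using one_imp_carrier I_notcarr by auto
  then show "is_prime P"
    unfolding is_prime_def using ideal_R_iff is_ideal I_prime by auto
next
  assume P: "is_prime P"
  show "primeideal P R"
    by (rule primeidealI) (use P one_mem in \<open>auto simp: is_prime_def ideal_R_iff cring_R\<close>)
qed

lemma coset_R: "I +>\<^bsub>R\<^esub> a = (\<lambda>j. j + a) ` I"
  by (auto simp: a_r_coset_def')

lemma coset_R_eq_iff:
  assumes I: "is_ideal I"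
  shows "I +>\<^bsub>R\<^esub> a = I +>\<^bsub>R\<^esub> b \<longleftrightarrow> a - b \<in> I"
proof
  assume "I +>\<^bsub>R\<^esub> a = I +>\<^bsub>R\<^esub> b"
  moreover have "a \<in> I +>\<^bsub>R\<^esub> a" using is_idealD(2)[OF I] by (force simp: coset_R)
  ultimately show "a - b \<in> I" by (auto simp: coset_R)
next
  assume ab: "a - b \<in> I"
  have "j + a = (j + (a - b)) + b" "j + b = (j - (a - b)) + a" for j by simp_all
  then show "I +>\<^bsub>R\<^esub> a = I +>\<^bsub>R\<^esub> b"
    unfolding coset_R using is_idealD(3)[OF I _ ab] is_idealD(7)[OF I _ ab] by blast
qed

lemma coset_R_zero: "is_ideal I \<Longrightarrow> I +>\<^bsub>R\<^esub> 0 = I"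
  by (auto simp: coset_R)

lemma carrier_quotient_R: "carrier (R Quot I) = (\<lambda>a. I +>\<^bsub>R\<^esub> a) ` C"
  by (auto simp: FactRing_def A_RCOSETS_def')

lemma quotient_module_simps:
  "carrier (quotient_module R I) = (\<lambda>a. I +>\<^bsub>R\<^esub> a) ` C"
  "\<zero>\<^bsub>quotient_module R I\<^esub> = I"
  "A \<oplus>\<^bsub>quotient_module R I\<^esub> B = A \<oplus>\<^bsub>R Quot I\<^esub> B"
  "r \<odot>\<^bsub>quotient_module R I\<^esub> A = (I +>\<^bsub>R\<^esub> r) \<otimes>\<^bsub>R Quot I\<^esub> A"
  unfolding carrier_quotient_R[symmetric]
  by (simp_all add: quotient_module_def ring.defs module.defs FactRing_def)

lemma smult_coset:
  assumes "is_ideal I" "r \<in> C" "a \<in> C"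
  shows "r \<odot>\<^bsub>quotient_module R I\<^esub> (I +>\<^bsub>R\<^esub> a) = I +>\<^bsub>R\<^esub> (r * a)"
proof -
  interpret ideal I R using assms ideal_R_iff by simp
  show ?thesis
    using rcoset_mult_add[of r a] assms by (simp add: quotient_module_simps FactRing_def)
qed

lemma abelian_monoid_quotient:
  assumes "is_ideal I"
  shows "abelian_monoid (quotient_module R I)"
proof -
  interpret ideal I R using assms ideal_R_iff by simp
  interpret Q: ring "R Quot I" by (rule quotient_is_ring)
  have eq: "carrier (quotient_module R I) = carrier (R Quot I)" "\<zero>\<^bsub>quotient_module R I\<^esub> = \<zero>\<^bsub>R Quot I\<^esub>"
    by (simp_all add: quotient_module_simps carrier_quotient_R) (simp add: FactRing_def)
  show ?thesis
    by (rule abelian_monoidI) (simp_all add: eq quotient_module_simps(3) Q.a_ac)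
qed

lemma add_coset:
  assumes "is_ideal I" "a \<in> C" "b \<in> C"
  shows "(I +>\<^bsub>R\<^esub> a) \<oplus>\<^bsub>R Quot I\<^esub> (I +>\<^bsub>R\<^esub> b) = I +>\<^bsub>R\<^esub> (a + b)"
proof -
  interpret ideal I R using assms ideal_R_iff by simp
  show ?thesis using ring_hom_add[OF rcos_ring_hom, of a b] assms by simp
qed

lemma finsum_quotient:
  assumes I: "is_ideal I" and A: "finite A" "g \<in> A \<rightarrow> C"
  shows "finsum (quotient_module R I) (\<lambda>j. I +>\<^bsub>R\<^esub> g j) A = I +>\<^bsub>R\<^esub> sum g A"
proof -
  interpret N: abelian_monoid "quotient_module R I" by (rule abelian_monoid_quotient[OF I])
  show ?thesis
    using A
  proof (induction A rule: finite_induct)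
    case empty
    show ?case using N.finsum_empty coset_R_zero[OF I] by (simp add: quotient_module_simps)
  next
    case (insert a A)
    then have "finsum (quotient_module R I) (\<lambda>j. I +>\<^bsub>R\<^esub> g j) (insert a A) =
      (I +>\<^bsub>R\<^esub> g a) \<oplus>\<^bsub>quotient_module R I\<^esub> (I +>\<^bsub>R\<^esub> sum g A)"
      by (subst N.finsum_insert) (auto simp: quotient_module_simps Pi_iff)
    also have "\<dots> = I +>\<^bsub>R\<^esub> sum g (insert a A)"
      unfolding quotient_module_simps(3) using insert sum_mem[of A g]
      by (subst add_coset[OF I]) auto
    finally show ?case .
  qed
qed

lemma foldl_adjoin_ideal: "is_ideal I \<Longrightarrow> set fs \<subseteq> C \<Longrightarrow> is_ideal (foldl adjoin I fs)"
  by (induction fs arbitrary: I) (auto intro: adjoin_ideal)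

text \<open>Puts the iterated ideal into the shape of \<open>list_smult\<close>. The induction
  appends at the end, since \<open>foldl\<close> adjoins the last element of the list last.\<close>

lemma foldl_adjoin:
  assumes "set fs \<subseteq> C"
  shows "foldl adjoin I fs = {a + (\<Sum>j<length fs. fs ! j * g j) | a g. a \<in> I \<and> g \<in> {..<length fs} \<rightarrow> C}"
  using assms
proof (induction fs rule: rev_induct)
  case Nil
  then show ?case by auto
next
  case (snoc f fs)
  then have IH: "foldl adjoin I fs = {a + (\<Sum>j<length fs. fs ! j * g j) | a g. a \<in> I \<and> g \<in> {..<length fs} \<rightarrow> C}"
    by simp
  have s: "(\<Sum>j<length (fs @ [f]). (fs @ [f]) ! j * g j) = (\<Sum>j<length fs. fs ! j * g j) + g (length fs) * f" for g
    by (simp add: nth_append mult.commute)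
  show ?case
  proof (intro equalityI subsetI)
    fix b assume "b \<in> foldl adjoin I (fs @ [f])"
    then obtain a g r where b: "b = a + (\<Sum>j<length fs. fs ! j * g j) + r * f" "a \<in> I" "g \<in> {..<length fs} \<rightarrow> C" "r \<in> C"
      unfolding foldl_append foldl_Cons foldl_Nil IH by (auto simp: adjoin_def)
    define h where "h = g(length fs := r)"
    have "(\<Sum>j<length fs. fs ! j * h j) = (\<Sum>j<length fs. fs ! j * g j)"
      by (rule sum.cong) (auto simp: h_def)
    then have "b = a + (\<Sum>j<length (fs @ [f]). (fs @ [f]) ! j * h j)"
      unfolding s b by (simp add: h_def add.assoc)
    moreover have "h \<in> {..<length (fs @ [f])} \<rightarrow> C"
      using b by (auto simp: h_def Pi_iff less_Suc_eq)
    ultimately show "b \<in> {a + (\<Sum>j<length (fs @ [f]). (fs @ [f]) ! j * g j) | a g. a \<in> I \<and> g \<in> {..<length (fs @ [f])} \<rightarrow> C}"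
      using b(2) by blast
  next
    fix b assume "b \<in> {a + (\<Sum>j<length (fs @ [f]). (fs @ [f]) ! j * g j) | a g. a \<in> I \<and> g \<in> {..<length (fs @ [f])} \<rightarrow> C}"
    then obtain a g where b: "b = (a + (\<Sum>j<length fs. fs ! j * g j)) + g (length fs) * f" "a \<in> I"
      "g \<in> {..<length (fs @ [f])} \<rightarrow> C"
      unfolding s by (auto simp: add.assoc)
    have "g \<in> {..<length fs} \<rightarrow> C" using b(3) by auto
    then have "a + (\<Sum>j<length fs. fs ! j * g j) \<in> foldl adjoin I fs"
      unfolding IH using b(2) by blast
    moreover have "g (length fs) \<in> C" using b(3) by auto
    ultimately show "b \<in> foldl adjoin I (fs @ [f])"
      unfolding b(1) by (simp add: adjoinI)
  qed
qed

lemma list_smult_quotient: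
  assumes I: "is_ideal I" and fs: "set fs \<subseteq> C"
  shows "list_smult fs (quotient_module R I) = (\<lambda>a. I +>\<^bsub>R\<^esub> a) ` foldl adjoin I fs"
proof -
  interpret N: abelian_monoid "quotient_module R I" by (rule abelian_monoid_quotient[OF I])
  let ?N = "quotient_module R I"
  have sum: "(\<Oplus>\<^bsub>?N\<^esub>j\<in>{..<length fs}. (fs ! j) \<odot>\<^bsub>?N\<^esub> x j) = I +>\<^bsub>R\<^esub> (\<Sum>j<length fs. fs ! j * g j)"
    if x: "\<And>j. j < length fs \<Longrightarrow> g j \<in> C \<and> x j = I +>\<^bsub>R\<^esub> g j" for x g
  proof -
    have mem: "fs ! j * g j \<in> C" if "j < length fs" for j
      using x[OF that] that fs by (intro mult_mem) auto
    have "(\<Oplus>\<^bsub>?N\<^esub>j\<in>{..<length fs}. (fs ! j) \<odot>\<^bsub>?N\<^esub> x j) = (\<Oplus>\<^bsub>?N\<^esub>j\<in>{..<length fs}. I +>\<^bsub>R\<^esub> (fs ! j * g j))"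
    proof (rule N.finsum_cong')
      fix j assume "j \<in> {..<length fs}"
      then have "g j \<in> C" "x j = I +>\<^bsub>R\<^esub> g j" "fs ! j \<in> C" using x[of j] fs by auto
      then show "(fs ! j) \<odot>\<^bsub>?N\<^esub> x j = I +>\<^bsub>R\<^esub> (fs ! j * g j)"
        using smult_coset[OF I] by simp
    qed (use mem in \<open>auto simp: quotient_module_simps\<close>)
    also have "\<dots> = I +>\<^bsub>R\<^esub> (\<Sum>j<length fs. fs ! j * g j)"
      using mem by (intro finsum_quotient[OF I]) auto
    finally show ?thesis .
  qed
  show ?thesis
  proof (intro equalityI subsetI)
    fix A assume "A \<in> list_smult fs ?N"
    then obtain x where x: "A = (\<Oplus>\<^bsub>?N\<^esub>j\<in>{..<length fs}. (fs ! j) \<odot>\<^bsub>?N\<^esub> x j)"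
      "x \<in> {..<length fs} \<rightarrow> (\<lambda>a. I +>\<^bsub>R\<^esub> a) ` C"
      unfolding list_smult_def quotient_module_simps(1) by blast
    then have "\<forall>j. \<exists>a. j < length fs \<longrightarrow> a \<in> C \<and> x j = I +>\<^bsub>R\<^esub> a" by (auto simp: Pi_iff)
    then obtain g where g: "\<And>j. j < length fs \<Longrightarrow> g j \<in> C \<and> x j = I +>\<^bsub>R\<^esub> g j" by metis
    have "A = I +>\<^bsub>R\<^esub> (0 + (\<Sum>j<length fs. fs ! j * g j))"
      unfolding x(1) by (simp add: sum[OF g])
    moreover have "0 + (\<Sum>j<length fs. fs ! j * g j) \<in> foldl adjoin I fs"
      unfolding foldl_adjoin[OF fs] using is_idealD(2)[OF I] g by blast
    ultimately show "A \<in> (\<lambda>a. I +>\<^bsub>R\<^esub> a) ` foldl adjoin I fs" by blast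
  next
    fix A assume "A \<in> (\<lambda>a. I +>\<^bsub>R\<^esub> a) ` foldl adjoin I fs"
    then obtain a g where A: "A = I +>\<^bsub>R\<^esub> (a + (\<Sum>j<length fs. fs ! j * g j))" "a \<in> I" "g \<in> {..<length fs} \<rightarrow> C"
      unfolding foldl_adjoin[OF fs] by blast
    have "A = I +>\<^bsub>R\<^esub> (\<Sum>j<length fs. fs ! j * g j)"
      unfolding A(1) coset_R_eq_iff[OF I] using A(2) by simp
    also have "\<dots> = (\<Oplus>\<^bsub>?N\<^esub>j\<in>{..<length fs}. (fs ! j) \<odot>\<^bsub>?N\<^esub> (I +>\<^bsub>R\<^esub> g j))"
      using A(3) by (intro sum[symmetric]) auto
    finally show "A \<in> list_smult fs ?N"
      unfolding list_smult_def using A(3)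
      by (intro CollectI exI[of _ "\<lambda>j. I +>\<^bsub>R\<^esub> g j"]) (auto simp: quotient_module_simps)
  qed
qed

lemma subset_foldl_adjoin: "I \<subseteq> foldl adjoin I fs"
proof (induction fs arbitrary: I)
  case (Cons f fs)
  show ?case using subset_trans[OF subset_adjoin Cons.IH] by simp
qed simp

lemma coset_in_image_iff:
  assumes "is_ideal I" "is_ideal J" "I \<subseteq> J"
  shows "I +>\<^bsub>R\<^esub> a \<in> (\<lambda>a. I +>\<^bsub>R\<^esub> a) ` J \<longleftrightarrow> a \<in> J"
proof
  assume "I +>\<^bsub>R\<^esub> a \<in> (\<lambda>a. I +>\<^bsub>R\<^esub> a) ` J"
  then obtain b where b: "b \<in> J" "a - b \<in> I" using coset_R_eq_iff[OF assms(1)] by auto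
  then have "b + (a - b) \<in> J" using is_idealD(3)[OF assms(2)] assms(3) by blast
  then show "a \<in> J" by simp
qed auto

lemma regular_mod_iff:
  "regular_mod I fs \<longleftrightarrow> (\<forall>i<length fs. nonzerodivisor_mod (fs ! i) (foldl adjoin I (take i fs)))"
proof (induction fs arbitrary: I)
  case (Cons f fs)
  show ?case by (simp add: Cons All_less_Suc2)
qed simp

text \<open>The submodule generated by an initial segment is the image of an ideal containing
  \<open>I\<close>, so a coset belongs to it exactly if its representatives belong to that
  ideal.\<close>

lemma regular_sequence_quotient:
  assumes I: "is_ideal I" and fs: "set fs \<subseteq> C"
  shows "regular_sequence (quotient_module R I) fs \<longleftrightarrow> regular_mod I fs \<and> foldl adjoin I fs \<noteq> C"
proof -
  let ?J = "\<lambda>i. foldl adjoin I (take i fs)"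
  let ?N = "quotient_module R I"
  have J: "is_ideal (?J i)" for i
    using set_take_subset[of i fs] fs by (intro foldl_adjoin_ideal[OF I]) blast
  have iff: "I +>\<^bsub>R\<^esub> a \<in> list_smult (take i fs) ?N \<longleftrightarrow> a \<in> ?J i" for a i
    using list_smult_quotient[OF I, of "take i fs"] set_take_subset[of i fs] fs
      coset_in_image_iff[OF I J subset_foldl_adjoin] by auto
  have "(\<forall>x\<in>carrier ?N. (fs ! i) \<odot>\<^bsub>?N\<^esub> x \<in> list_smult (take i fs) ?N \<longrightarrow> x \<in> list_smult (take i fs) ?N) \<longleftrightarrow>
    nonzerodivisor_mod (fs ! i) (?J i)" if "i < length fs" for i
  proof -
    have "fs ! i \<in> C" using that fs by auto
    then show ?thesis
      by (simp add: quotient_module_simps(1) nonzerodivisor_mod_def smult_coset[OF I] iff)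
  qed
  moreover have "list_smult fs ?N = carrier ?N \<longleftrightarrow> foldl adjoin I fs = C"
  proof
    assume a: "list_smult fs ?N = carrier ?N"
    have "a \<in> ?J (length fs)" if "a \<in> C" for a
      using iff[of a "length fs"] a that by (simp add: quotient_module_simps(1))
    then show "foldl adjoin I fs = C" using J[of "length fs"] is_idealD(1) by auto
  qed (simp add: list_smult_quotient[OF I fs] quotient_module_simps(1))
  ultimately show ?thesis
    unfolding regular_sequence_def regular_mod_iff by auto
qed

lemma associated_primes_quotient:
  assumes I: "is_ideal I"
  shows "associated_primes R (quotient_module R I) = assoc_primes I"
proof -
  have "{r \<in> carrier R. r \<odot>\<^bsub>quotient_module R I\<^esub> (I +>\<^bsub>R\<^esub> g) = \<zero>\<^bsub>quotient_module R I\<^esub>} = colon I g"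
    if "g \<in> C" for g
    unfolding colon_def using that coset_R_eq_iff[OF I, of _ 0]
    by (intro Collect_cong)
      (simp add: smult_coset[OF I] quotient_module_simps(2) coset_R_zero[OF I] cong: conj_cong)
  then show ?thesis
    unfolding associated_primes_def assoc_primes_def primeideal_R_iff quotient_module_simps(1) by auto
qed

lemma primeideal_image:
  assumes I: "is_ideal I" and Q: "is_prime Q" "I \<subseteq> Q"
  shows "primeideal ((\<lambda>a. I +>\<^bsub>R\<^esub> a) ` Q) (R Quot I)"
proof -
  have idQ: "is_ideal Q" using Q(1) by (rule is_primeD)
  note mem = coset_in_image_iff[OF I idQ Q(2)]
  interpret cring R by (rule cring_R)
  interpret ideal I R using I ideal_R_iff by simp
  show ?thesis
  proof (rule primeidealI)
    show "ideal ((\<lambda>a. I +>\<^bsub>R\<^esub> a) ` Q) (R Quot I)"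
      using ring_ideal_imp_quot_ideal[of I Q] I idQ by (simp add: ideal_R_iff)
    show "cring (R Quot I)" by (rule quotient_is_cring[OF cring_R])
    show "carrier (R Quot I) \<noteq> (\<lambda>a. I +>\<^bsub>R\<^esub> a) ` Q"
      using mem[of 1] is_primeD(2)[OF Q(1)] one_mem by (auto simp: carrier_quotient_R)
    fix a b
    assume "a \<in> carrier (R Quot I)" "b \<in> carrier (R Quot I)" and ab: "a \<otimes>\<^bsub>R Quot I\<^esub> b \<in> (\<lambda>a. I +>\<^bsub>R\<^esub> a) ` Q"
    then obtain a' b' where a': "a = I +>\<^bsub>R\<^esub> a'" "b = I +>\<^bsub>R\<^esub> b'" "a' \<in> C" "b' \<in> C"
      by (auto simp: carrier_quotient_R)
    then have "a' * b' \<in> Q"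
      using ab rcoset_mult_add[of a' b'] mem by (simp add: FactRing_def)
    then show "a \<in> (\<lambda>a. I +>\<^bsub>R\<^esub> a) ` Q \<or> b \<in> (\<lambda>a. I +>\<^bsub>R\<^esub> a) ` Q"
      using is_primeD(3)[OF Q(1) a'(3,4)] a' by blast
  qed
qed

text \<open>With \<open>primeideal_image\<close>, the correspondence between primes of the quotient
  and primes containing \<open>I\<close>; the last equation keeps strict inclusions strict under
  preimages.\<close>

lemma prime_vimage:
  assumes I: "is_ideal I" and P: "primeideal P (R Quot I)"
  shows "is_prime {a \<in> C. I +>\<^bsub>R\<^esub> a \<in> P}" "I \<subseteq> {a \<in> C. I +>\<^bsub>R\<^esub> a \<in> P}"
    "P = (\<lambda>a. I +>\<^bsub>R\<^esub> a) ` {a \<in> C. I +>\<^bsub>R\<^esub> a \<in> P}"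
proof -
  interpret ideal I R using I ideal_R_iff by simp
  interpret P: primeideal P "R Quot I" by (rule P)
  show "is_prime {a \<in> C. I +>\<^bsub>R\<^esub> a \<in> P}"
    using ring_hom_ring.primeideal_vimage[OF rcos_ring_hom_ring cring_R P]
    by (simp add: primeideal_R_iff)
  have "\<zero>\<^bsub>R Quot I\<^esub> \<in> P" by (rule additive_subgroup.zero_closed[OF P.is_additive_subgroup])
  then have "I \<in> P" by (simp add: FactRing_def)
  moreover have "I +>\<^bsub>R\<^esub> a = I" if "a \<in> I" for a
    using coset_R_eq_iff[OF I, of a 0] coset_R_zero[OF I] that by simp
  ultimately show "I \<subseteq> {a \<in> C. I +>\<^bsub>R\<^esub> a \<in> P}" using is_idealD(1)[OF I] by auto
  show "P = (\<lambda>a. I +>\<^bsub>R\<^esub> a) ` {a \<in> C. I +>\<^bsub>R\<^esub> a \<in> P}"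
    using P.a_subset by (auto simp: carrier_quotient_R)
qed

lemma genideal_R:
  assumes "is_ideal J" "S \<subseteq> J" "\<And>I. is_ideal I \<Longrightarrow> S \<subseteq> I \<Longrightarrow> J \<subseteq> I"
  shows "genideal R S = J"
  unfolding genideal_def ideal_R_iff using assms by blast

end

section \<open>Associated primes of face rings\<close>

lemma complex_Pow: "finite F \<Longrightarrow> complex (Pow F)"
  by (auto simp: complex_def intro: finite_subset)

lemma lookup_sum_single:
  "finite A \<Longrightarrow> Poly_Mapping.lookup (\<Sum>m\<in>A. Poly_Mapping.single m (f m)) k = (if k \<in> A then f k else 0)"
  by (simp add: lookup_sum lookup_single when_def)

lemma restrict_poly_mapping:
  fixes p :: "'a \<Rightarrow>\<^sub>0 'b::comm_monoid_add"
  shows "\<exists>q. \<forall>m. Poly_Mapping.lookup q m = (if Q m then Poly_Mapping.lookup p m else 0)"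
proof -
  have "Poly_Mapping.lookup (\<Sum>m\<in>{m \<in> Poly_Mapping.keys p. Q m}. Poly_Mapping.single m (Poly_Mapping.lookup p m)) k =
    (if Q k then Poly_Mapping.lookup p k else 0)" for k
    by (subst lookup_sum_single) (auto simp: in_keys_iff)
  then show ?thesis by blast
qed

lemma keys_single_mult:
  fixes p :: "('v \<Rightarrow>\<^sub>0 nat) \<Rightarrow>\<^sub>0 'k::comm_ring_1"
  shows "Poly_Mapping.keys (Poly_Mapping.single e 1 * p) = (+) e ` Poly_Mapping.keys p"
proof (intro equalityI subsetI)
  fix m assume "m \<in> Poly_Mapping.keys (Poly_Mapping.single e 1 * p)"
  then show "m \<in> (+) e ` Poly_Mapping.keys p"
    using keys_mult_subset[of m "Poly_Mapping.single e 1" p] by auto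
next
  fix m assume "m \<in> (+) e ` Poly_Mapping.keys p"
  then show "m \<in> Poly_Mapping.keys (Poly_Mapping.single e 1 * p)"
    using lookup_single_mult[of e 1 p] by (auto simp: in_keys_iff)
qed

lemma prod_var: "finite F \<Longrightarrow> (\<Prod>i\<in>F. var i) = (Poly_Mapping.single (indicator_exp F) 1 :: 'k::field mpoly)"
proof (induction F rule: finite_induct)
  case (insert i F)
  then show ?case by (simp add: var_def mult_single indicator_exp_def)
qed (simp add: indicator_exp_def)

lemma (in comm_subring) prime_prod:
  assumes "is_prime P" "finite A" "\<And>a. a \<in> A \<Longrightarrow> f a \<in> C" "prod f A \<in> P"
  shows "\<exists>a\<in>A. f a \<in> P"
  using assms(2-4)
proof (induction A rule: finite_induct)
  case empty
  then show ?case using is_primeD(2)[OF assms(1)] by simp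
next
  case (insert a A)
  have "prod f A \<in> C" using insert.prems(1) insert.hyps(1)
    by (induction A rule: infinite_finite_induct) (auto intro: one_mem mult_mem)
  then show ?case using insert is_primeD(3)[OF assms(1), of "f a" "prod f A"] by auto
qed

context complex_on
begin

lemma face_ideal_ideal:
  assumes "complex \<Gamma>"
  shows "is_ideal (face_ideal X \<Gamma> :: 'k mpoly set)"
  unfolding is_ideal_def
proof (intro conjI ballI)
  show "face_ideal X \<Gamma> \<subseteq> polys X" by (auto simp: face_ideal_def)
  show "(0 :: 'k mpoly) \<in> face_ideal X \<Gamma>" by (auto simp: face_ideal_def zero_mem)
next
  fix p q :: "'k mpoly" assume "p \<in> face_ideal X \<Gamma>" "q \<in> face_ideal X \<Gamma>"
  then show "p + q \<in> face_ideal X \<Gamma>"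
    using keys_add[of p q] by (auto simp: face_ideal_def add_mem)
next
  fix r p :: "'k mpoly" assume r: "r \<in> polys X" and p: "p \<in> face_ideal X \<Gamma>"
  have "Poly_Mapping.keys m \<notin> \<Gamma>" if m: "m \<in> Poly_Mapping.keys (r * p)" for m
  proof -
    obtain a b where "b \<in> Poly_Mapping.keys p" "m = a + b" using keys_mult_subset[OF m] by blast
    then show ?thesis using p assms by (auto simp: face_ideal_def complex_def keys_add_nat)
  qed
  then show "r * p \<in> face_ideal X \<Gamma>" using r p by (auto simp: face_ideal_def mult_mem)
qed

text \<open>Each term of a polynomial is treated alone, as a multiple of a squarefree monomial in
  \<open>I\<close>. Applies to the minimal non-faces and to the variables outside a facet.\<close>

lemma face_ideal_subset:
  assumes I: "is_ideal I"
    and gen: "\<And>m :: nat \<Rightarrow>\<^sub>0 nat. Poly_Mapping.keys m \<subseteq> X \<Longrightarrow> Poly_Mapping.keys m \<notin> \<Gamma> \<Longrightarrow>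
      \<exists>G \<subseteq> Poly_Mapping.keys m. (\<Prod>i\<in>G. var i) \<in> I"
  shows "(face_ideal X \<Gamma> :: 'k mpoly set) \<subseteq> I"
proof
  fix p :: "'k mpoly" assume p: "p \<in> face_ideal X \<Gamma>"
  have "Poly_Mapping.single m (Poly_Mapping.lookup p m) \<in> I" if m: "m \<in> Poly_Mapping.keys p" for m
  proof -
    have mX: "Poly_Mapping.keys m \<subseteq> X" "Poly_Mapping.keys m \<notin> \<Gamma>"
      using p m by (auto simp: face_ideal_def polys_def)
    obtain G where G: "G \<subseteq> Poly_Mapping.keys m" "(\<Prod>i\<in>G. var i) \<in> I" using gen[OF mX] by blast
    have fin: "finite G" by (rule finite_subset[OF G(1)]) simp
    let ?e = "m - indicator_exp G"
    have "Poly_Mapping.keys ?e \<subseteq> X" using mX by (auto simp: in_keys_iff lookup_minus)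
    then have "Poly_Mapping.single ?e (Poly_Mapping.lookup p m) \<in> polys X" by (auto simp: polys_def)
    from is_idealD(4)[OF I this G(2)] show ?thesis
      unfolding prod_var[OF fin] mult_single indicator_exp_diff_add[OF fin G(1)] by simp
  qed
  then have "(\<Sum>m\<in>Poly_Mapping.keys p. Poly_Mapping.single m (Poly_Mapping.lookup p m)) \<in> I"
    by (rule ideal_sum_mem[OF I])
  then show "p \<in> I" by (simp add: poly_mapping_sum_single)
qed

lemma prod_var_in_face_ideal:
  "G \<subseteq> X \<Longrightarrow> (\<Prod>i\<in>G. var i :: 'k mpoly) \<in> face_ideal X \<Gamma> \<longleftrightarrow> G \<notin> \<Gamma>"
  using finite_subset_X[of G] by (simp add: prod_var face_ideal_def polys_def)

lemma exists_minimal_nonface: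
  assumes "finite M" "M \<subseteq> X" "M \<notin> \<Delta>"
  shows "\<exists>G \<subseteq> M. G \<in> minimal_nonfaces X \<Delta>"
  using assms
proof (induction M rule: finite_psubset_induct)
  case (psubset M)
  show ?case
  proof (cases "\<forall>G. G \<subset> M \<longrightarrow> G \<in> \<Delta>")
    case True
    then show ?thesis using psubset.prems by (auto simp: minimal_nonfaces_def)
  next
    case False
    then obtain G where G: "G \<subset> M" "G \<notin> \<Delta>" by blast
    then obtain H where "H \<subseteq> G" "H \<in> minimal_nonfaces X \<Delta>"
      using psubset.IH[of G] psubset.prems by blast
    then show ?thesis using G by blast
  qed
qed

text \<open>A monomial whose support is a non-face is divisible by the product over a minimal one.
  For the void complex the only minimal non-face is empty, with product 1, and the ideal is the
  whole ring.\<close>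

lemma genideal_minimal_nonfaces:
  "genideal R ((\<lambda>F. \<Prod>i\<in>F. var i) ` minimal_nonfaces X \<Delta>) = (face_ideal X \<Delta> :: 'k mpoly set)"
proof (rule genideal_R)
  show "is_ideal (face_ideal X \<Delta> :: 'k mpoly set)" by (rule face_ideal_ideal[OF complex])
  show "(\<lambda>F. \<Prod>i\<in>F. var i) ` minimal_nonfaces X \<Delta> \<subseteq> (face_ideal X \<Delta> :: 'k mpoly set)"
    using prod_var_in_face_ideal by (auto simp: minimal_nonfaces_def)
  fix I :: "'k mpoly set"
  assume I: "is_ideal I" and gen: "(\<lambda>F. \<Prod>i\<in>F. var i) ` minimal_nonfaces X \<Delta> \<subseteq> I"
  show "face_ideal X \<Delta> \<subseteq> I"
  proof (rule face_ideal_subset[OF I])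
    fix m :: "nat \<Rightarrow>\<^sub>0 nat" assume "Poly_Mapping.keys m \<subseteq> X" "Poly_Mapping.keys m \<notin> \<Delta>"
    then obtain G where "G \<subseteq> Poly_Mapping.keys m" "G \<in> minimal_nonfaces X \<Delta>"
      using exists_minimal_nonface[of "Poly_Mapping.keys m"] by auto
    then show "\<exists>G\<subseteq>Poly_Mapping.keys m. (\<Prod>i\<in>G. var i) \<in> I" using gen by blast
  qed
qed

lemma linear_forms_minimal: "is_ideal I \<Longrightarrow> var ` X \<subseteq> I \<Longrightarrow> linear_forms \<subseteq> (I :: 'k mpoly set)"
  by (auto simp: linear_forms_def intro!: ideal_sum_mem is_idealD(4)[of I])

lemma genideal_vars: "genideal R (var ` X) = (linear_forms :: 'k mpoly set)"
  using linear_forms_ideal var_in_linear_forms linear_forms_minimal by (intro genideal_R) auto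

lemma linear_forms_subset_face_ideal: "linear_forms \<subseteq> (face_ideal X {{}} :: 'k mpoly set)"
proof (rule linear_forms_minimal)
  show "is_ideal (face_ideal X {{}} :: 'k mpoly set)"
    by (rule face_ideal_ideal) (simp add: complex_def)
  show "var ` X \<subseteq> (face_ideal X {{}} :: 'k mpoly set)"
  proof
    fix p :: "'k mpoly" assume "p \<in> var ` X"
    then obtain v where v: "v \<in> X" "p = var v" by blast
    have "Poly_Mapping.single v (1::nat) \<noteq> 0" by (metis keys_single keys_zero insert_not_empty zero_neq_one)
    moreover have "(var v :: 'k mpoly) \<in> polys X" by (rule var_in_polys[OF v(1)])
    ultimately show "p \<in> face_ideal X {{}}"
      by (simp add: face_ideal_def v(2) var_def)
  qed
qed

text \<open>Discards the monomials with a variable outside \<open>F\<close>. Together with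
  \<open>polys_face_ideal_0\<close> this identifies the quotient by
  \<open>face_ideal X (Pow F)\<close> with \<open>polys F\<close>.\<close>

lemma polys_restrict:
  assumes "p \<in> polys X" "F \<subseteq> X"
  obtains q where "q \<in> polys F" "p - q \<in> (face_ideal X (Pow F) :: 'k mpoly set)"
proof -
  obtain q where q: "\<And>m. Poly_Mapping.lookup q m = (if Poly_Mapping.keys m \<subseteq> F then Poly_Mapping.lookup p m else 0)"
    using restrict_poly_mapping[of "\<lambda>m. Poly_Mapping.keys m \<subseteq> F" p] by auto
  have "q \<in> polys F" by (auto simp: polys_def in_keys_iff[of _ q] q split: if_splits)
  moreover have "p - q \<in> face_ideal X (Pow F)"
    using assms by (auto simp: face_ideal_def polys_def in_keys_iff[of _ p] in_keys_iff[of _ "p - q"]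
      lookup_minus q subset_iff split: if_splits)
  ultimately show ?thesis by (rule that)
qed

lemma polys_mono: "F \<subseteq> X \<Longrightarrow> polys F \<subseteq> (polys X :: 'k mpoly set)"
  by (auto simp: polys_def)

lemma polys_face_ideal_0:
  "p \<in> polys F \<Longrightarrow> p \<in> (face_ideal X (Pow F) :: 'k mpoly set) \<Longrightarrow> p = 0"
  by (intro poly_mapping_eqI) (auto simp: face_ideal_def polys_def in_keys_iff)

lemma face_ideal_Pow_prime:
  assumes F: "F \<subseteq> X"
  shows "is_prime (face_ideal X (Pow F) :: 'k mpoly set)"
proof -
  let ?P = "face_ideal X (Pow F) :: 'k mpoly set"
  have P: "is_ideal ?P" by (rule face_ideal_ideal[OF complex_Pow[OF finite_subset_X[OF F]]])
  interpret F: comm_subring "polys F :: 'k mpoly set" by (rule comm_subring_polys)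
  show ?thesis
    unfolding is_prime_def
  proof (intro conjI ballI impI P)
    show "1 \<notin> ?P" by (simp add: face_ideal_def)
    fix a b :: "'k mpoly" assume ab: "a \<in> polys X" "b \<in> polys X" "a * b \<in> ?P"
    obtain a' where a': "a' \<in> polys F" "a - a' \<in> ?P" by (rule polys_restrict[OF ab(1) F])
    obtain b' where b': "b' \<in> polys F" "b - b' \<in> ?P" by (rule polys_restrict[OF ab(2) F])
    have "a' * b' = a * b - ((a - a') * b + a' * (b - b'))" by (simp add: algebra_simps)
    also have "\<dots> \<in> ?P"
      using is_idealD(5)[OF P ab(2) a'(2)] is_idealD(4)[OF P _ b'(2), of a'] polys_mono[OF F] a'(1)
      by (intro is_idealD(7)[OF P] is_idealD(3)[OF P] ab(3)) auto
    \<comment> \<open>The product of the representatives lies in \<open>polys F\<close>, which meets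
      the ideal only in 0; polynomials over a field have no zero divisors.\<close>
    finally have "a' * b' = 0" using F.mult_mem[OF a'(1) b'(1)] polys_face_ideal_0 by blast
    then show "a \<in> ?P \<or> b \<in> ?P" using a'(2) b'(2) by auto
  qed
qed

definition facets :: "nat set set" where
  "facets = {F \<in> \<Delta>. \<forall>G\<in>\<Delta>. F \<subseteq> G \<longrightarrow> G = F}"

lemma finite_faces: "finite \<Delta>"
  using finite_vertices faces by (intro finite_subset[of \<Delta> "Pow X"]) auto

lemma face_subset_facet:
  assumes "F \<in> \<Delta>"
  shows "\<exists>G\<in>facets. F \<subseteq> G"
proof -
  have "\<exists>G\<in>{G \<in> \<Delta>. F \<subseteq> G}. \<forall>H\<in>{G \<in> \<Delta>. F \<subseteq> G}. G \<le> H \<longrightarrow> G = H"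
    using finite_faces assms by (intro finite_has_maximal) auto
  then show ?thesis by (fastforce simp: facets_def)
qed

text \<open>By maximality of \<open>F\<close>, a monomial times the product over \<open>F\<close>
  has a face as support only if its variables already lie in \<open>F\<close>.\<close>

lemma facet_colon:
  assumes "F \<in> facets"
  shows "colon (face_ideal X \<Delta>) (\<Prod>i\<in>F. var i) = (face_ideal X (Pow F) :: 'k mpoly set)"
proof -
  have F: "F \<in> \<Delta>" "F \<subseteq> X" using assms faces by (auto simp: facets_def)
  have fin: "finite F" using finite_subset_X[OF F(2)] .
  have face: "F \<union> G \<in> \<Delta> \<longleftrightarrow> G \<subseteq> F" for G
    using assms by (auto simp: facets_def Un_absorb2)
  have "r * Poly_Mapping.single (indicator_exp F) 1 \<in> face_ideal X \<Delta> \<longleftrightarrow> r \<in> face_ideal X (Pow F)"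
    if r: "r \<in> polys X" for r :: "'k mpoly"
  proof -
    have "r * Poly_Mapping.single (indicator_exp F) 1 \<in> polys X"
      using r F fin by (intro mult_mem) (auto simp: polys_def)
    then show ?thesis
      using r fin by (simp add: face_ideal_def mult.commute[of r] keys_single_mult keys_add_nat face)
  qed
  then show ?thesis using fin by (auto simp: colon_def prod_var face_ideal_def[of X "Pow F"])
qed

text \<open>Facets give associated primes by \<open>facet_colon\<close>. Conversely, the annihilator
  of \<open>g\<close> lies in the prime of any facet containing the support of a monomial of
  \<open>g\<close>, and such a facet is recovered as the set of variables outside
  \<open>P\<close>.\<close>

theorem assoc_primes_face_ideal:
  "assoc_primes (face_ideal X \<Delta>) = (\<lambda>F. face_ideal X (Pow F) :: 'k mpoly set) ` facets"
proof (intro equalityI subsetI)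
  fix P :: "'k mpoly set" assume "P \<in> (\<lambda>F. face_ideal X (Pow F)) ` facets"
  then obtain F where F: "F \<in> facets" "P = face_ideal X (Pow F)" by auto
  then have FX: "F \<subseteq> X" using faces by (auto simp: facets_def)
  have "(\<Prod>i\<in>F. var i) \<in> (polys X :: 'k mpoly set)"
    using finite_subset_X[OF FX] FX by (simp add: prod_var polys_def)
  then show "P \<in> assoc_primes (face_ideal X \<Delta>)"
    using facet_colon[OF F(1)] face_ideal_Pow_prime[OF FX] F(2) by (auto simp: assoc_primes_def)
next
  fix P :: "'k mpoly set" assume "P \<in> assoc_primes (face_ideal X \<Delta>)"
  then obtain g where P: "is_prime P" "g \<in> polys X" "P = colon (face_ideal X \<Delta>) g"
    by (auto simp: assoc_primes_def)
  have IP: "face_ideal X \<Delta> \<subseteq> P"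
    using P is_idealD(1,5)[OF face_ideal_ideal[OF complex]] by (auto simp: colon_def)
  have "1 \<notin> P" by (rule is_primeD(2)[OF P(1)])
  then have "g \<notin> face_ideal X \<Delta>" using P one_mem by (auto simp: colon_def)
  then obtain m where m: "m \<in> Poly_Mapping.keys g" "Poly_Mapping.keys m \<in> \<Delta>"
    using P(2) by (auto simp: face_ideal_def)
  then obtain F where F: "F \<in> facets" "Poly_Mapping.keys m \<subseteq> F" using face_subset_facet by blast
  have F': "F \<in> \<Delta>" "F \<subseteq> X" using F faces by (auto simp: facets_def)
  have "g \<notin> face_ideal X (Pow F)" using m F by (auto simp: face_ideal_def)
  have PF: "P \<subseteq> face_ideal X (Pow F)"
  proof
    fix r assume "r \<in> P"
    then have r: "r \<in> polys X" "r * g \<in> face_ideal X \<Delta>" using P by (auto simp: colon_def)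
    then have "r * g \<in> face_ideal X (Pow F)"
      using complex F'(1) by (auto simp: face_ideal_def complex_def)
    then show "r \<in> face_ideal X (Pow F)"
      using is_primeD(3)[OF face_ideal_Pow_prime[OF F'(2)] r(1) P(2)] \<open>g \<notin> face_ideal X (Pow F)\<close> by blast
  qed
  \<comment> \<open>A face, since otherwise the product of its variables would lie in the face ideal
    and hence in \<open>P\<close>; it contains the facet \<open>F\<close>, so it equals
    \<open>F\<close>.\<close>
  define W where "W = {v \<in> X. var v \<notin> P}"
  have "W \<in> \<Delta>"
  proof (rule ccontr)
    assume "W \<notin> \<Delta>"
    then have "(\<Prod>v\<in>W. var v) \<in> P" using IP prod_var_in_face_ideal[of W \<Delta>] by (auto simp: W_def)
    then show False
      using prime_prod[OF P(1), of W var] finite_vertices var_in_polys by (auto simp: W_def)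
  qed
  moreover have "F \<subseteq> W"
  proof
    fix v assume v: "v \<in> F"
    then have "(var v :: 'k mpoly) \<notin> face_ideal X (Pow F)" by (simp add: face_ideal_def var_def)
    then show "v \<in> W" using v PF F' by (auto simp: W_def)
  qed
  ultimately have W: "W = F" using F(1) by (auto simp: facets_def)
  have "face_ideal X (Pow F) \<subseteq> P"
  proof (rule face_ideal_subset[OF is_primeD(1)[OF P(1)]])
    fix m :: "nat \<Rightarrow>\<^sub>0 nat" assume "Poly_Mapping.keys m \<subseteq> X" "Poly_Mapping.keys m \<notin> Pow F"
    then obtain v where "v \<in> Poly_Mapping.keys m" "v \<in> X" "v \<notin> F" by blast
    then show "\<exists>G\<subseteq>Poly_Mapping.keys m. (\<Prod>i\<in>G. var i) \<in> P"
      using W by (intro exI[of _ "{v}"]) (auto simp: W_def)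
  qed
  then show "P \<in> (\<lambda>F. face_ideal X (Pow F)) ` facets" using PF F(1) by blast
qed

end

section \<open>Krull dimension of face rings\<close>

lemma (in vector_space) dependent_family:
  assumes A: "finite A" and B: "finite B" "v ` A \<subseteq> span B" "card B < card A"
  shows "\<exists>c. (\<exists>a\<in>A. c a \<noteq> 0) \<and> (\<Sum>a\<in>A. scale (c a) (v a)) = 0"
proof (cases "inj_on v A")
  case True
  have "dependent (v ` A)"
    using independent_span_bound[OF B(1) _ B(2)] card_image[OF True] B(3) by auto
  then obtain u where u: "\<exists>b\<in>v ` A. u b \<noteq> 0" "(\<Sum>b\<in>v ` A. scale (u b) b) = 0"
    using dependent_finite[of "v ` A"] A by auto
  then show ?thesis
    using sum.reindex[OF True, of "\<lambda>b. scale (u b) b"] by (intro exI[of _ "u \<circ> v"]) auto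
next
  case False
  then obtain a b where ab: "a \<in> A" "b \<in> A" "a \<noteq> b" "v a = v b" by (auto simp: inj_on_def)
  \<comment> \<open>A repeated vector counts only once in the image set, so the relation between its
    two occurrences is supplied directly.\<close>
  define c where "c x = (if x = a then 1 else if x = b then - 1 else 0 :: 'a)" for x
  have "(\<Sum>x\<in>A. scale (c x) (v x)) = (\<Sum>x\<in>{a, b}. scale (c x) (v x))"
    using A ab by (intro sum.mono_neutral_right) (auto simp: c_def)
  also have "\<dots> = 0" using ab by (simp add: c_def)
  finally show ?thesis using ab(1) by (intro exI[of _ c]) (auto simp: c_def)
qed

definition box_polys :: "'v set \<Rightarrow> nat \<Rightarrow> (('v \<Rightarrow>\<^sub>0 nat) \<Rightarrow>\<^sub>0 'k::comm_ring_1) set" where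
  "box_polys F L = {p \<in> polys F. \<forall>e\<in>Poly_Mapping.keys p. \<forall>v. Poly_Mapping.lookup e v \<le> L}"

lemma box_polys_mult: "p \<in> box_polys F L \<Longrightarrow> q \<in> box_polys F M \<Longrightarrow> p * q \<in> box_polys F (L + M)"
  using comm_subring.mult_mem[OF comm_subring_polys, of p F q]
  by (fastforce simp: box_polys_def lookup_add add_mono dest!: keys_mult_subset)

lemma box_polys_one: "1 \<in> box_polys F L"
  using comm_subring.one_mem[OF comm_subring_polys, of F] by (simp add: box_polys_def)

lemma box_polys_mono: "p \<in> box_polys F L \<Longrightarrow> L \<le> M \<Longrightarrow> p \<in> box_polys F M"
  by (auto simp: box_polys_def intro: order_trans[of _ L M])

lemma box_polys_power: "p \<in> box_polys F L \<Longrightarrow> p ^ k \<in> box_polys F (k * L)"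
  by (induction k) (auto simp: box_polys_one box_polys_mult)

lemma box_polys_prod:
  assumes "finite A" "\<And>i. i \<in> A \<Longrightarrow> f i \<in> box_polys F (L i)"
  shows "prod f A \<in> box_polys F (sum L A)"
  using assms by (induction A rule: finite_induct) (auto simp: box_polys_one box_polys_mult)

lemma exists_box:
  assumes "p \<in> polys F"
  shows "\<exists>L. p \<in> box_polys F L"
proof -
  let ?S = "\<Union>e\<in>Poly_Mapping.keys p. Poly_Mapping.range e"
  have "Poly_Mapping.lookup e v \<le> Max (insert 0 ?S)" if "e \<in> Poly_Mapping.keys p" for e v
  proof (cases "v \<in> Poly_Mapping.keys e")
    case True
    then show ?thesis using that by (intro Max_ge) (auto intro: in_keys_lookup_in_range)
  qed (simp add: in_keys_iff)
  then show ?thesis using assms unfolding box_polys_def by blast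
qed

definition box_monomials :: "'v set \<Rightarrow> nat \<Rightarrow> (('v \<Rightarrow>\<^sub>0 nat) \<Rightarrow>\<^sub>0 'k::comm_ring_1) set" where
  "box_monomials F L = (\<lambda>e. Poly_Mapping.single e 1) `
     {e. Poly_Mapping.keys e \<subseteq> F \<and> (\<forall>v. Poly_Mapping.lookup e v \<le> L)}"

lemma box_monomials:
  assumes F: "finite F"
  shows "finite (box_monomials F L :: (('v \<Rightarrow>\<^sub>0 nat) \<Rightarrow>\<^sub>0 'k::comm_ring_1) set)"
    "card (box_monomials F L :: (('v \<Rightarrow>\<^sub>0 nat) \<Rightarrow>\<^sub>0 'k) set) \<le> Suc L ^ card F"
proof -
  let ?E = "{e :: 'v \<Rightarrow>\<^sub>0 nat. Poly_Mapping.keys e \<subseteq> F \<and> (\<forall>v. Poly_Mapping.lookup e v \<le> L)}"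
  let ?r = "\<lambda>e. restrict (Poly_Mapping.lookup e) F"
  have inj: "inj_on ?r ?E"
  proof (rule inj_onI, rule poly_mapping_eqI)
    fix e e' :: "'v \<Rightarrow>\<^sub>0 nat" and v assume e: "e \<in> ?E" "e' \<in> ?E" "?r e = ?r e'"
    show "Poly_Mapping.lookup e v = Poly_Mapping.lookup e' v"
    proof (cases "v \<in> F")
      case True
      then show ?thesis using fun_cong[OF e(3), of v] by simp
    next
      case False
      then have "v \<notin> Poly_Mapping.keys e" "v \<notin> Poly_Mapping.keys e'" using e by auto
      then show ?thesis by (simp add: in_keys_iff)
    qed
  qed
  have sub: "?r ` ?E \<subseteq> F \<rightarrow>\<^sub>E {..L}" by auto
  have fin: "finite (F \<rightarrow>\<^sub>E {..L})" using F by (intro finite_PiE) auto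
  have E: "finite ?E" using finite_imageD[OF finite_subset[OF sub fin] inj] .
  have "card ?E \<le> card (F \<rightarrow>\<^sub>E {..L})" by (rule card_inj_on_le[OF inj sub fin])
  also have "\<dots> = Suc L ^ card F" using F by (simp add: card_PiE)
  finally show "finite (box_monomials F L :: (('v \<Rightarrow>\<^sub>0 nat) \<Rightarrow>\<^sub>0 'k) set)"
    "card (box_monomials F L :: (('v \<Rightarrow>\<^sub>0 nat) \<Rightarrow>\<^sub>0 'k) set) \<le> Suc L ^ card F"
    unfolding box_monomials_def using E card_image_le[OF E, of "\<lambda>e. Poly_Mapping.single e (1::'k)"] by auto
qed

lemma pm_scale_conv_mult: "pm_scale a p = Poly_Mapping.single 0 a * (p :: ('v \<Rightarrow>\<^sub>0 nat) \<Rightarrow>\<^sub>0 'k::field)"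
  unfolding pm_scale_def by (rule mult_map_scale_conv_mult)

lemma box_polys_span:
  assumes "p \<in> box_polys F L"
  shows "p \<in> module.span pm_scale (box_monomials F L :: (('v \<Rightarrow>\<^sub>0 nat) \<Rightarrow>\<^sub>0 'k::field) set)"
proof -
  interpret vector_space "pm_scale :: 'k \<Rightarrow> (('v \<Rightarrow>\<^sub>0 nat) \<Rightarrow>\<^sub>0 'k) \<Rightarrow> _" by (rule vector_space_pm_scale)
  have "(\<Sum>e\<in>Poly_Mapping.keys p. Poly_Mapping.single e (Poly_Mapping.lookup p e)) \<in> span (box_monomials F L)"
  proof (rule span_sum)
    fix e assume "e \<in> Poly_Mapping.keys p"
    then have "Poly_Mapping.single e 1 \<in> (box_monomials F L :: (('v \<Rightarrow>\<^sub>0 nat) \<Rightarrow>\<^sub>0 'k) set)"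
      using assms by (auto simp: box_polys_def polys_def box_monomials_def)
    from span_scale[OF span_base[OF this], of "Poly_Mapping.lookup p e"]
    show "Poly_Mapping.single e (Poly_Mapping.lookup p e) \<in> span (box_monomials F L)"
      by (simp add: pm_scale_conv_mult mult_single)
  qed
  then show ?thesis by (simp add: poly_mapping_sum_single)
qed

text \<open>The right side counts exponent tuples bounded by \<open>N\<close> for \<open>m\<close>
  polynomials of degree at most \<open>D\<close> in each variable; the left side counts the
  monomials in \<open>s\<close> variables that can occur in the corresponding products.\<close>

lemma exponent_count:
  fixes D m s :: nat
  assumes "s < m"
  shows "\<exists>N. Suc (m * (N * D)) ^ s < Suc N ^ m"
proof -
  \<comment> \<open>The base on the left is at most \<open>c (N + 1)\<close>, so the left side is at
    most \<open>c ^ s (N + 1) ^ s\<close>; taking \<open>N = c ^ s\<close> pushes it below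
    \<open>(N + 1) ^ (s + 1)\<close>.\<close>
  let ?c = "Suc (m * D)"
  let ?N = "?c ^ s"
  have "Suc (m * (?N * D)) \<le> ?c * Suc ?N" by (simp add: algebra_simps)
  then have "Suc (m * (?N * D)) ^ s \<le> ?c ^ s * Suc ?N ^ s"
    by (metis power_mono power_mult_distrib zero_le)
  also have "\<dots> < Suc ?N * Suc ?N ^ s" by (intro mult_strict_right_mono) auto
  also have "\<dots> = Suc ?N ^ Suc s" by simp
  also have "\<dots> \<le> Suc ?N ^ m" using assms by (intro power_increasing) auto
  finally show ?thesis by blast
qed

text \<open>There are more products of powers than monomials to express them, which forces a linear
  relation. Exponents are extensional, so they are determined by their values below
  \<open>m\<close>.\<close>

lemma algebraically_dependent:
  fixes f :: "nat \<Rightarrow> ('v \<Rightarrow>\<^sub>0 nat) \<Rightarrow>\<^sub>0 'k::field"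
  assumes F: "finite F" and f: "\<And>i. i < m \<Longrightarrow> f i \<in> polys F" and m: "card F < m"
  shows "\<exists>A c. finite A \<and> A \<noteq> {} \<and> A \<subseteq> extensional {..<m} \<and> (\<forall>a\<in>A. c a \<noteq> 0) \<and>
    (\<Sum>a\<in>A. Poly_Mapping.single 0 (c a) * (\<Prod>i<m. f i ^ a i)) = 0"
proof -
  interpret vector_space "pm_scale :: 'k \<Rightarrow> (('v \<Rightarrow>\<^sub>0 nat) \<Rightarrow>\<^sub>0 'k) \<Rightarrow> _" by (rule vector_space_pm_scale)
  have "\<forall>i. \<exists>L. i < m \<longrightarrow> f i \<in> box_polys F L" using exists_box f by blast
  then obtain L where L: "\<And>i. i < m \<Longrightarrow> f i \<in> box_polys F (L i)" by metis
  define D where "D = Max (insert 0 (L ` {..<m}))"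
  have D: "f i \<in> box_polys F D" if "i < m" for i
    using L[OF that] by (rule box_polys_mono) (use that in \<open>auto simp: D_def\<close>)
  obtain N where N: "Suc (m * (N * D)) ^ card F < Suc N ^ m" using exponent_count[OF m] by blast
  let ?E = "{..<m} \<rightarrow>\<^sub>E {..N}"
  let ?B = "box_monomials F (m * (N * D)) :: (('v \<Rightarrow>\<^sub>0 nat) \<Rightarrow>\<^sub>0 'k) set"
  have E: "finite ?E" "card ?E = Suc N ^ m" by (auto intro!: finite_PiE simp: card_PiE)
  have "(\<Prod>i<m. f i ^ a i) \<in> span ?B" if a: "a \<in> ?E" for a
  proof (rule box_polys_span)
    have "f i ^ a i \<in> box_polys F (N * D)" if "i < m" for i
      using box_polys_power[OF D[OF that], of "a i"]
      by (rule box_polys_mono) (use a that in \<open>auto simp: PiE_iff\<close>)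
    then show "(\<Prod>i<m. f i ^ a i) \<in> box_polys F (m * (N * D))"
      using box_polys_prod[of "{..<m}" "\<lambda>i. f i ^ a i" F "\<lambda>_. N * D"] by simp
  qed
  then obtain c where c: "\<exists>a\<in>?E. c a \<noteq> 0" "(\<Sum>a\<in>?E. pm_scale (c a) (\<Prod>i<m. f i ^ a i)) = 0"
    using dependent_family[OF E(1) box_monomials(1)[OF F], of "\<lambda>a. \<Prod>i<m. f i ^ a i" "m * (N * D)"]
      box_monomials(2)[OF F, of "m * (N * D)", where 'k='k] N E(2) by (auto simp: image_subset_iff)
  let ?A = "{a \<in> ?E. c a \<noteq> 0}"
  have "(\<Sum>a\<in>?A. Poly_Mapping.single 0 (c a) * (\<Prod>i<m. f i ^ a i)) =
    (\<Sum>a\<in>?E. pm_scale (c a) (\<Prod>i<m. f i ^ a i))"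
    unfolding pm_scale_conv_mult using E(1) by (intro sum.mono_neutral_left) auto
  moreover have "finite ?A" using E(1) by simp
  moreover have "?A \<noteq> {}" using c(1) by blast
  moreover have "?A \<subseteq> extensional {..<m}" by (auto simp: PiE_def)
  ultimately show ?thesis using c(2) by (intro exI[of _ ?A] exI[of _ c]) simp
qed

section \<open>Algebraic relations along chains of primes\<close>

lemma (in comm_subring) power_mem: "a \<in> C \<Longrightarrow> a ^ k \<in> C"
  by (induction k) (auto intro: one_mem mult_mem)

lemma (in comm_subring) prod_mem: "(\<And>i. i \<in> A \<Longrightarrow> f i \<in> C) \<Longrightarrow> prod f A \<in> C"
  by (induction A rule: infinite_finite_induct) (auto intro: one_mem mult_mem)

lemma (in comm_subring) prime_power: "is_prime P \<Longrightarrow> a \<in> C \<Longrightarrow> a ^ k \<in> P \<Longrightarrow> a \<in> P"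
proof (induction k)
  case (Suc k)
  then show ?case using is_primeD(3)[of P a "a ^ k"] power_mem by auto
qed (use is_primeD(2) in simp)

text \<open>The argument of Coquand and Lombardi: walking up the chain strips the powers of \<open>f 0, f 1, \<dots>\<close>
  from the lexicographically smallest monomial of the relation, until its coefficient is left.\<close>

lemma (in comm_subring) prime_chain_no_relation:
  assumes "finite A" "A \<noteq> {}"
    and "\<And>a b. a \<in> A \<Longrightarrow> b \<in> A \<Longrightarrow> (\<And>i. i < m \<Longrightarrow> e a i = e b i) \<Longrightarrow> a = b"
    and "\<And>i. i \<le> m \<Longrightarrow> is_prime (Q i)" "\<And>i. i < m \<Longrightarrow> Q i \<subseteq> Q (Suc i)"
    and "\<And>i. i < m \<Longrightarrow> f i \<in> Q (Suc i)" "\<And>i. i < m \<Longrightarrow> f i \<notin> Q i"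
    and "\<And>a. a \<in> A \<Longrightarrow> u a \<in> C" "\<And>a. a \<in> A \<Longrightarrow> u a \<notin> Q m"
  shows "(\<Sum>a\<in>A. u a * (\<Prod>i<m. f i ^ e a i)) \<notin> Q 0"
  using assms
proof (induction m arbitrary: A e Q f)
  case 0
  then obtain a where a: "a \<in> A" by auto
  then have "A = {a}" using "0.prems"(3) by auto
  then show ?case using "0.prems"(9)[OF a] by simp
next
  case (Suc m)
  note prems = Suc.prems
  \<comment> \<open>The least power of \<open>f 0\<close> in the relation; \<open>A0\<close>
    collects the terms attaining it.\<close>
  define k where "k = Min ((\<lambda>a. e a 0) ` A)"
  define A0 where "A0 = {a \<in> A. e a 0 = k}"
  have kmin: "k \<le> e a 0" if "a \<in> A" for a using that prems(1) by (simp add: k_def)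
  have A0: "finite A0" "A0 \<subseteq> A" using prems(1) by (auto simp: A0_def)
  have "k \<in> (\<lambda>a. e a 0) ` A" unfolding k_def using prems(1,2) by (intro Min_in) auto
  then have "A0 \<noteq> {}" by (auto simp: A0_def)
  have fC: "f i \<in> C" if "i < Suc m" for i
    using prems(6)[OF that] is_primeD(1)[OF prems(4)[of "Suc i"]] that is_idealD(1) by auto
  let ?g = "\<lambda>a. \<Prod>i<m. f (Suc i) ^ e a (Suc i)"
  have gC: "?g a \<in> C" for a using fC by (intro prod_mem power_mem) auto
  define S0 where "S0 = (\<Sum>a\<in>A0. u a * ?g a)"
  \<comment> \<open>Outside \<open>A0\<close> the exponent exceeds \<open>k\<close>, so the
    truncated difference is exact and a further factor \<open>f 0\<close>, an element of
    \<open>Q (Suc 0)\<close>, can be split off.\<close>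
  define S1 where "S1 = (\<Sum>a\<in>A - A0. u a * (f 0 ^ (e a 0 - Suc k) * ?g a))"
  have SC: "S0 \<in> C" "S1 \<in> C"
    unfolding S0_def S1_def using prems(8) A0(2) gC fC by (intro sum_mem mult_mem power_mem; auto)+
  have "S0 \<notin> Q (Suc 0)"
    unfolding S0_def
  proof (rule Suc.IH[of A0 "\<lambda>a i. e a (Suc i)" "\<lambda>i. Q (Suc i)" "\<lambda>i. f (Suc i)"])
    fix a b assume ab: "a \<in> A0" "b \<in> A0" "\<And>i. i < m \<Longrightarrow> e a (Suc i) = e b (Suc i)"
    show "a = b"
    proof (rule prems(3))
      fix i assume "i < Suc m"
      then show "e a i = e b i" using ab by (cases i) (auto simp: A0_def)
    qed (use ab A0 in auto)
  qed (use A0 \<open>A0 \<noteq> {}\<close> prems in auto)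
  show ?case
  proof
    assume "(\<Sum>a\<in>A. u a * (\<Prod>i<Suc m. f i ^ e a i)) \<in> Q 0"
    also have "(\<Sum>a\<in>A. u a * (\<Prod>i<Suc m. f i ^ e a i)) = f 0 ^ k * (S0 + f 0 * S1)"
    proof -
      have 0: "(\<Sum>a\<in>A0. u a * (f 0 ^ e a 0 * ?g a)) = f 0 ^ k * S0"
        unfolding S0_def sum_distrib_left by (rule sum.cong) (auto simp: A0_def mult_ac)
      have 1: "(\<Sum>a\<in>A - A0. u a * (f 0 ^ e a 0 * ?g a)) = f 0 ^ k * (f 0 * S1)"
        unfolding S1_def sum_distrib_left
      proof (rule sum.cong)
        fix a assume "a \<in> A - A0"
        then have "e a 0 = k + (1 + (e a 0 - Suc k))" using kmin[of a] by (auto simp: A0_def)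
        then have "f 0 ^ e a 0 = f 0 ^ k * (f 0 * f 0 ^ (e a 0 - Suc k))"
          by (metis power_add power_one_right)
        then show "u a * (f 0 ^ e a 0 * ?g a) = f 0 ^ k * (f 0 * (u a * (f 0 ^ (e a 0 - Suc k) * ?g a)))"
          by (simp only: mult_ac)
      qed simp
      have "(\<Sum>a\<in>A. u a * (\<Prod>i<Suc m. f i ^ e a i)) = (\<Sum>a\<in>A. u a * (f 0 ^ e a 0 * ?g a))"
        by (simp only: prod.lessThan_Suc_shift)
      also have "\<dots> = (\<Sum>a\<in>A - A0. u a * (f 0 ^ e a 0 * ?g a)) + (\<Sum>a\<in>A0. u a * (f 0 ^ e a 0 * ?g a))"
        using sum.subset_diff[OF A0(2) prems(1)] .
      finally show ?thesis unfolding 0 1 by (simp add: distrib_left)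
    qed
    finally have *: "f 0 ^ k * (S0 + f 0 * S1) \<in> Q 0" .
    have P0: "is_prime (Q 0)" and P1: "is_prime (Q (Suc 0))" using prems(4) by auto
    have "f 0 ^ k \<notin> Q 0" using prime_power[OF P0 fC[of 0]] prems(7)[of 0] by auto
    then have "S0 + f 0 * S1 \<in> Q 0"
      using is_primeD(3)[OF P0 _ _ *] power_mem[OF fC[of 0]] fC[of 0] SC by (auto simp: add_mem mult_mem)
    then have "S0 + f 0 * S1 \<in> Q (Suc 0)" using prems(5)[of 0] by auto
    moreover have "f 0 * S1 \<in> Q (Suc 0)"
      using is_idealD(5)[OF is_primeD(1)[OF P1] SC(2) prems(6)[of 0]] by simp
    ultimately have "S0 \<in> Q (Suc 0)"
      using is_idealD(7)[OF is_primeD(1)[OF P1], of "S0 + f 0 * S1" "f 0 * S1"] by simp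
    then show False using \<open>S0 \<notin> Q (Suc 0)\<close> by simp
  qed
qed

context complex_on
begin

lemma constant_notin_prime:
  assumes P: "is_prime (P :: 'k mpoly set)" and c: "c \<noteq> 0"
  shows "Poly_Mapping.single 0 c \<notin> P" "Poly_Mapping.single 0 c \<in> polys X"
proof -
  have mem: "Poly_Mapping.single 0 c \<in> polys X" for c :: 'k by (simp add: polys_def)
  have "Poly_Mapping.single 0 (inverse c) * Poly_Mapping.single 0 c = (1 :: 'k mpoly)"
    using c by (simp add: mult_single)
  then show "Poly_Mapping.single 0 c \<notin> P"
    using is_idealD(4)[OF is_primeD(1)[OF P] mem[of "inverse c"], of "Poly_Mapping.single 0 c"] is_primeD(2)[OF P]
    by auto
  show "Poly_Mapping.single 0 c \<in> polys X" by (rule mem)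
qed

text \<open>Witnesses of the strict inclusions can be chosen in \<open>polys F\<close>, as the whole
  chain contains \<open>face_ideal X (Pow F)\<close>. More than \<open>card F\<close> of them would
  satisfy a relation with nonzero constant coefficients, and these are outside every prime.\<close>

lemma prime_chain_length:
  assumes F: "F \<subseteq> X" and Q: "\<And>i. i \<le> m \<Longrightarrow> is_prime (Q i)" "\<And>i. i < m \<Longrightarrow> Q i \<subset> Q (Suc i)"
    "(face_ideal X (Pow F) :: 'k mpoly set) \<subseteq> Q 0"
  shows "m \<le> card F"
proof (rule ccontr)
  assume m: "\<not> m \<le> card F"
  have Q0: "face_ideal X (Pow F) \<subseteq> Q i" if "i \<le> m" for i
    using that
  proof (induction i)
    case (Suc i)
    then show ?case using Q(2)[of i] by auto
  qed (rule Q(3))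
  have "\<exists>f. i < m \<longrightarrow> f \<in> polys F \<and> f \<in> Q (Suc i) \<and> f \<notin> Q i" for i
  proof (cases "i < m")
    case True
    then have Q1: "is_prime (Q (Suc i))" "is_prime (Q i)" using Q(1) by auto
    obtain g where g: "g \<in> Q (Suc i)" "g \<notin> Q i" using Q(2)[OF True] by auto
    have "g \<in> polys X" using is_idealD(1)[OF is_primeD(1)[OF Q1(1)] g(1)] .
    then obtain f where f: "f \<in> polys F" "g - f \<in> face_ideal X (Pow F)" by (rule polys_restrict[OF _ F])
    have "g - f \<in> Q (Suc i)" "g - f \<in> Q i" using f(2) Q0[of i] Q0[of "Suc i"] True by auto
    then show ?thesis
      using is_idealD(7)[OF is_primeD(1)[OF Q1(1)] g(1), of "g - f"]
        is_idealD(3)[OF is_primeD(1)[OF Q1(2)], of f "g - f"] f g by auto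
  qed simp
  then obtain f where f: "\<And>i. i < m \<Longrightarrow> f i \<in> polys F \<and> f i \<in> Q (Suc i) \<and> f i \<notin> Q i" by metis
  obtain A and c :: "(nat \<Rightarrow> nat) \<Rightarrow> 'k" where A: "finite A" "A \<noteq> {}" "A \<subseteq> extensional {..<m}" "\<forall>a\<in>A. c a \<noteq> 0"
    "(\<Sum>a\<in>A. Poly_Mapping.single 0 (c a) * (\<Prod>i<m. f i ^ a i)) = 0"
    using algebraically_dependent[OF finite_subset_X[OF F], of m f] f m by auto
  have "(\<Sum>a\<in>A. Poly_Mapping.single 0 (c a) * (\<Prod>i<m. f i ^ a i)) \<notin> Q 0"
  proof (rule prime_chain_no_relation[where e = "\<lambda>a. a"])
    fix a b assume "a \<in> A" "b \<in> A" "\<And>i. i < m \<Longrightarrow> a i = b i"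
    then show "a = b" using A(3) by (intro extensionalityI[of a "{..<m}" b]) auto
  next
    fix a assume "a \<in> A"
    then show "Poly_Mapping.single 0 (c a) \<in> polys X" "Poly_Mapping.single 0 (c a) \<notin> Q m"
      using A(4) constant_notin_prime[OF Q(1)[of m]] by auto
  next
    fix i assume i: "i < m"
    then show "Q i \<subseteq> Q (Suc i)" using Q(2) by blast
    show "f i \<in> Q (Suc i)" "f i \<notin> Q i" using f[OF i] by auto
  qed (use A Q(1) in simp_all)
  then show False using A(5) is_idealD(2)[OF is_primeD(1)[OF Q(1)]] by auto
qed

theorem krull_dim_face:
  assumes F: "F \<subseteq> X"
  shows "krull_dim (R Quot (face_ideal X (Pow F) :: 'k mpoly set)) = enat (card F)"
proof (rule antisym)
  let ?I = "face_ideal X (Pow F) :: 'k mpoly set"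
  have I: "is_ideal ?I" by (rule is_primeD(1)[OF face_ideal_Pow_prime[OF F]])
  show "krull_dim (R Quot ?I) \<le> enat (card F)"
    unfolding krull_dim_def
  proof (rule Sup_least, clarify)
    fix r P assume P: "\<forall>i\<le>r. primeideal (P i) (R Quot ?I)" "\<forall>i<r. P i \<subset> P (Suc i)"
    define Q where "Q i = {a \<in> polys X. ?I +>\<^bsub>R\<^esub> a \<in> P i}" for i
    note vim = prime_vimage[OF I, of "P _", folded Q_def]
    have "r \<le> card F"
    proof (rule prime_chain_length[OF F])
      show "is_prime (Q i)" if "i \<le> r" for i using vim(1) P that by auto
      show "?I \<subseteq> Q 0" using vim(2)[of 0] P by auto
      fix i assume i: "i < r"
      have "Q i \<subseteq> Q (Suc i)" using P(2) i by (auto simp: Q_def)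
      moreover have "Q i \<noteq> Q (Suc i)" using vim(3)[of i] vim(3)[of "Suc i"] P i by fastforce
      ultimately show "Q i \<subset> Q (Suc i)" by blast
    qed
    then show "enat r \<le> enat (card F)" by simp
  qed
  obtain xs where xs: "set xs = F" "distinct xs"
    using finite_distinct_list[OF finite_subset_X[OF F]] by blast
  \<comment> \<open>Removing the vertices of \<open>F\<close> one at a time adds a variable to the
    prime at each step, which gives a chain of length \<open>card F\<close>.\<close>
  define G where "G i = set (drop i xs)" for i
  define Q where "Q i = (face_ideal X (Pow (G i)) :: 'k mpoly set)" for i
  have GF: "G i \<subseteq> F" for i using set_drop_subset[of i xs] xs by (simp add: G_def)
  have Q: "is_prime (Q i)" "?I \<subseteq> Q i" for i
  proof -
    show "is_prime (Q i)" using face_ideal_Pow_prime[of "G i"] GF[of i] F by (auto simp: Q_def)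
    show "?I \<subseteq> Q i" using GF[of i] unfolding Q_def face_ideal_def by blast
  qed
  have "Q i \<subset> Q (Suc i)" if "i < card F" for i
  proof -
    have i: "i < length xs" using that xs distinct_card by metis
    have "drop i xs = xs ! i # drop (Suc i) xs" using i by (rule Cons_nth_drop_Suc[symmetric])
    then have G: "G i = insert (xs ! i) (G (Suc i))" "xs ! i \<notin> G (Suc i)"
      using distinct_drop[OF xs(2), of i] by (auto simp: G_def)
    have "var (xs ! i) \<in> Q (Suc i)" "var (xs ! i) \<notin> Q i"
      using G GF[of i] F var_in_polys[of "xs ! i" X] by (auto simp: Q_def face_ideal_def var_def)
    moreover have "Q i \<subseteq> Q (Suc i)" using G by (auto simp: Q_def face_ideal_def)
    ultimately show ?thesis by blast
  qed
  then have "(\<lambda>a. ?I +>\<^bsub>R\<^esub> a) ` Q i \<subset> (\<lambda>a. ?I +>\<^bsub>R\<^esub> a) ` Q (Suc i)" if i: "i < card F" for i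
  proof -
    assume sub: "\<And>i. i < card F \<Longrightarrow> Q i \<subset> Q (Suc i)"
    obtain a where a: "a \<in> Q (Suc i)" "a \<notin> Q i" using sub[OF i] by blast
    have "?I +>\<^bsub>R\<^esub> a \<notin> (\<lambda>a. ?I +>\<^bsub>R\<^esub> a) ` Q i"
      using coset_in_image_iff[OF I is_primeD(1)[OF Q(1)] Q(2)] a(2) by blast
    moreover have "?I +>\<^bsub>R\<^esub> a \<in> (\<lambda>a. ?I +>\<^bsub>R\<^esub> a) ` Q (Suc i)" using a(1) by (rule imageI)
    ultimately show ?thesis using image_mono[of "Q i" "Q (Suc i)"] sub[OF i] by blast
  qed
  moreover have "\<forall>i\<le>card F. primeideal ((\<lambda>a. ?I +>\<^bsub>R\<^esub> a) ` Q i) (R Quot ?I)"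
    using primeideal_image[OF I Q] by blast
  ultimately show "enat (card F) \<le> krull_dim (R Quot ?I)"
    unfolding krull_dim_def
    by (intro Sup_upper CollectI exI[of _ "card F"]
        conjI[OF refl exI[of _ "\<lambda>i. (\<lambda>a. ?I +>\<^bsub>R\<^esub> a) ` Q i"]]) simp
qed

end

section \<open>The depth of face rings\<close>

context complex_on
begin

abbreviation SR_ring :: "('k mpoly, 'k mpoly set) module" where
  "SR_ring \<equiv> quotient_module R (face_ideal X \<Delta>)"

lemma indim_SR_ring: "indim R SR_ring = (INF F\<in>facets. enat (card F))"
proof -
  have "F \<subseteq> X" if "F \<in> facets" for F using that faces by (auto simp: facets_def)
  then show ?thesis
    unfolding indim_def associated_primes_quotient[OF face_ideal_ideal[OF complex]]
      assoc_primes_face_ideal image_image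
    using krull_dim_face by (intro INF_cong) auto
qed

text \<open>As \<open>{}\<close> is a face, the face ideal and the members of \<open>fs\<close> have
  no constant terms. The ideal they generate is therefore proper, which makes the nonvanishing
  condition automatic.\<close>

lemma regular_sequence_SR_ring:
  assumes "{} \<in> \<Delta>" and fs: "set fs \<subseteq> linear_forms"
  shows "regular_sequence SR_ring fs \<longleftrightarrow> regular_mod (face_ideal X \<Delta>) fs"
proof -
  let ?M = "face_ideal X {{}} :: 'k mpoly set"
  have M: "is_ideal ?M" by (rule face_ideal_ideal) (simp add: complex_def)
  have IM: "face_ideal X \<Delta> \<subseteq> ?M" using assms(1) by (auto simp: face_ideal_def)
  have "foldl adjoin I fs \<subseteq> ?M" if "I \<subseteq> ?M" "set fs \<subseteq> ?M" for I fs
    using that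
  proof (induction fs arbitrary: I)
    case (Cons f fs)
    have "adjoin I f \<subseteq> ?M"
      using Cons.prems is_idealD(3,4)[OF M] unfolding adjoin_def by auto
    then show ?case using Cons by simp
  qed simp
  from this[OF IM] have "foldl adjoin (face_ideal X \<Delta>) fs \<subseteq> ?M"
    using fs linear_forms_subset_face_ideal by blast
  moreover have "1 \<notin> ?M" by (simp add: face_ideal_def)
  ultimately have "foldl adjoin (face_ideal X \<Delta>) fs \<noteq> polys X" using one_mem by blast
  then show ?thesis
    using regular_sequence_quotient[OF face_ideal_ideal[OF complex], of fs] fs linear_forms_subset by blast
qed

definition links_acyclic :: "nat \<Rightarrow> bool" where
  "links_acyclic d \<longleftrightarrow> (\<forall>F\<subseteq>X. \<forall>k. k + card F < d \<longrightarrow> acyclic_at TYPE('k) {} (link \<Delta> F) k)"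

lemma exists_regular_sequence_iff:
  assumes "{} \<in> \<Delta>"
  shows "(\<exists>fs. length fs = d \<and> set fs \<subseteq> linear_forms \<and> regular_sequence SR_ring fs) \<longleftrightarrow> links_acyclic d"
  unfolding links_acyclic_def koszul_exact_iff_links[symmetric]
    koszul_depth_noetherian[OF face_ideal_ideal[OF complex]]
  using regular_sequence_SR_ring[OF assms] by blast

text \<open>The link of a facet is \<open>{{}}\<close>, and the value 1 at the empty face is a
  cocycle but not an empty sum. This bounds the depth by the size of the facet.\<close>

lemma links_not_acyclic:
  assumes "F \<in> facets"
  shows "\<not> links_acyclic (Suc (card F))"
proof
  assume a: "links_acyclic (Suc (card F))"
  have F: "F \<in> \<Delta>" "F \<subseteq> X" using assms faces by (auto simp: facets_def)
  have "{} \<in> \<Delta>" using F complex by (auto simp: complex_def)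
  have lk: "link \<Delta> F = {{}}"
    using assms F \<open>{} \<in> \<Delta>\<close> by (fastforce simp: facets_def link_def)
  have ac: "acyclic_at TYPE('k) {} {{} :: nat set} 0" using a[unfolded links_acyclic_def, rule_format, of F 0] F(2) lk by simp
  obtain \<psi> :: "nat set \<Rightarrow> 'k" where "\<And>S. S \<in> {{}} \<Longrightarrow> card S = 0 \<Longrightarrow> 1 = coboundary {} \<psi> S"
    using acyclic_atD[OF ac, of "\<lambda>_. 1"] by auto
  from this[of "{}"] show False by (simp add: coboundary_def)
qed

lemma depth_SR_ring_iff:
  assumes "\<Delta> \<noteq> {}"
  obtains d where "indim R SR_ring = enat d"
    "depth linear_forms SR_ring = enat d \<longleftrightarrow> links_acyclic d"
proof -
  obtain G where "G \<in> \<Delta>" using assms by auto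
  then have ne: "{} \<in> \<Delta>" "facets \<noteq> {}" using complex face_subset_facet[of G] by (auto simp: complex_def)
  obtain F where F: "F \<in> facets" "\<And>G. G \<in> facets \<Longrightarrow> card F \<le> card G"
    using ne(2) ex_has_least_nat[of "\<lambda>F. F \<in> facets" _ card] by blast
  let ?d = "card F"
  let ?S = "{enat (length fs) | fs. set fs \<subseteq> linear_forms \<and> regular_sequence SR_ring fs}"
  have "indim R SR_ring = enat ?d"
    unfolding indim_SR_ring using F by (intro antisym INF_lower INF_greatest) auto
  moreover have bound: "length fs \<le> ?d" if "set fs \<subseteq> linear_forms" "regular_sequence SR_ring fs" for fs
  proof (rule ccontr)
    assume "\<not> length fs \<le> ?d"
    moreover have "links_acyclic (length fs)" using exists_regular_sequence_iff[OF ne(1)] that by blast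
    \<comment> \<open>The condition is antitone: a larger bound implies every smaller one.\<close>
    ultimately have "links_acyclic (Suc ?d)" by (auto simp: links_acyclic_def)
    then show False using links_not_acyclic[OF F(1)] by simp
  qed
  have "depth linear_forms SR_ring = enat ?d \<longleftrightarrow> links_acyclic ?d"
  proof
    assume "links_acyclic ?d"
    then obtain fs where fs: "length fs = ?d" "set fs \<subseteq> linear_forms" "regular_sequence SR_ring fs"
      using exists_regular_sequence_iff[OF ne(1)] by blast
    show "depth linear_forms SR_ring = enat ?d"
      unfolding depth_def
    proof (rule antisym)
      show "Sup ?S \<le> enat ?d" using bound by (intro Sup_least) auto
      show "enat ?d \<le> Sup ?S" using fs by (intro Sup_upper CollectI exI[of _ fs]) auto
    qed
  next
    assume depth: "depth linear_forms SR_ring = enat ?d"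
    show "links_acyclic ?d"
    proof (rule ccontr)
      assume "\<not> links_acyclic ?d"
      \<comment> \<open>\<open>links_acyclic 0\<close> is vacuous, so \<open>?d\<close> is positive
        and \<open>?d - 1\<close> is really smaller.\<close>
      then have d: "?d \<noteq> 0" by (auto simp: links_acyclic_def)
      have "length fs \<le> ?d - 1" if "set fs \<subseteq> linear_forms" "regular_sequence SR_ring fs" for fs
      proof -
        have "length fs \<noteq> ?d" using exists_regular_sequence_iff[OF ne(1), of ?d] \<open>\<not> links_acyclic ?d\<close> that by blast
        then show ?thesis using bound[OF that] by simp
      qed
      then have "Sup ?S \<le> enat (?d - 1)" by (intro Sup_least) auto
      then show False using depth d by (simp add: depth_def)
    qed
  qed
  ultimately show ?thesis using that by blast
qed

text \<open>Matches \<open>i\<close> with \<open>k = i + 1\<close>. In degrees below -1 there are no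
  nonzero chains, and sets outside \<Delta> have empty links, so the differing ranges of
  \<open>i\<close> and \<open>F\<close> do not matter.\<close>

lemma links_acyclic_iff_homology:
  "links_acyclic d \<longleftrightarrow> (\<forall>F\<in>\<Delta>. \<forall>i::int. i < int d - 1 - int (card F) \<longrightarrow>
     trivial_group (reduced_homology TYPE('k) (link \<Delta> F) i))"
proof
  assume a: "links_acyclic d"
  show "\<forall>F\<in>\<Delta>. \<forall>i::int. i < int d - 1 - int (card F) \<longrightarrow>
     trivial_group (reduced_homology TYPE('k) (link \<Delta> F) i)"
  proof (intro ballI allI impI)
    fix F i assume F: "F \<in> \<Delta>" and i: "i < int d - 1 - int (card F)"
    have cl: "complex (link \<Delta> F)" by (rule complex_link[OF complex])
    show "trivial_group (reduced_homology TYPE('k) (link \<Delta> F) i)"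
    proof (cases "i < - 1")
      case True
      then show ?thesis by (rule reduced_homology_below_minus_one[OF cl])
    next
      case False
      then have "i = int (nat (i + 1)) - 1" by simp
      moreover have "acyclic_at TYPE('k) {} (link \<Delta> F) (nat (i + 1))"
        using a i False faces[OF F] by (auto simp: links_acyclic_def)
      ultimately show ?thesis using reduced_homology_iff_acyclic[OF cl, of "nat (i + 1)"] by metis
    qed
  qed
next
  assume a: "\<forall>F\<in>\<Delta>. \<forall>i::int. i < int d - 1 - int (card F) \<longrightarrow>
     trivial_group (reduced_homology TYPE('k) (link \<Delta> F) i)"
  show "links_acyclic d"
    unfolding links_acyclic_def
  proof (intro allI impI)
    fix F :: "nat set" and k assume k: "k + card F < d"
    show "acyclic_at TYPE('k) {} (link \<Delta> F) k"
    proof (cases "F \<in> \<Delta>")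
      case True
      then have "trivial_group (reduced_homology TYPE('k) (link \<Delta> F) (int k - 1))"
        using a k by auto
      then show ?thesis using reduced_homology_iff_acyclic[OF complex_link[OF complex]] by blast
    next
      case False
      then have "link \<Delta> F = {}" using complex by (auto simp: link_def complex_def)
      then show ?thesis by (simp add: acyclic_at_def)
    qed
  qed
qed

lemma SR_ring_zero_iff: "carrier SR_ring = {\<zero>\<^bsub>SR_ring\<^esub>} \<longleftrightarrow> \<Delta> = {}"
proof -
  have I: "is_ideal (face_ideal X \<Delta> :: 'k mpoly set)" by (rule face_ideal_ideal[OF complex])
  have "carrier SR_ring = {\<zero>\<^bsub>SR_ring\<^esub>} \<longleftrightarrow> (\<forall>a\<in>polys X. face_ideal X \<Delta> +>\<^bsub>R\<^esub> a = (face_ideal X \<Delta> :: 'k mpoly set))"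
    unfolding quotient_module_simps using one_mem by blast
  also have "\<dots> \<longleftrightarrow> (\<forall>a\<in>polys X. a \<in> (face_ideal X \<Delta> :: 'k mpoly set))"
    using coset_R_eq_iff[OF I, of _ 0] coset_R_zero[OF I] by simp
  also have "\<dots> \<longleftrightarrow> \<Delta> = {}"
  proof
    assume "\<forall>a\<in>polys X. a \<in> (face_ideal X \<Delta> :: 'k mpoly set)"
    then have "(1 :: 'k mpoly) \<in> face_ideal X \<Delta>" using one_mem by blast
    then show "\<Delta> = {}" using complex by (auto simp: face_ideal_def complex_def)
  qed (simp add: face_ideal_def)
  finally show ?thesis .
qed

end

theorem theorem1p8:
  fixes n :: nat and \<Delta> :: "nat set set"
  assumes "simplicial_complex_on {1..n} \<Delta>"
  shows "initially_cohen_macaulay TYPE('k::field) n \<Delta> \<longleftrightarrow>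
    (\<forall>F \<in> \<Delta>. \<forall>i::int.
       ereal (real_of_int i) < indim_complex TYPE('k) n \<Delta> - ereal (real (card F)) \<longrightarrow>
       trivial_group (reduced_homology TYPE('k) (link \<Delta> F) i))"
proof -
  define X where "X = {1..n}"
  interpret complex_on "TYPE('k)" X \<Delta>
    using assms by unfold_locales (auto simp: X_def simplicial_complex_on_def complex_def intro: finite_subset)
  have R: "polynomial_ring TYPE('k) n = R"
    by (simp only: polynomial_ring_def polys_def X_def)
  have N: "stanley_reisner_ring TYPE('k) n \<Delta> = SR_ring"
    unfolding stanley_reisner_ring_def stanley_reisner_ideal_def R X_def[symmetric]
    by (simp only: genideal_minimal_nonfaces)
  have M: "irrelevant_ideal TYPE('k) n = linear_forms"
    unfolding irrelevant_ideal_def R X_def[symmetric] by (rule genideal_vars)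
  show ?thesis
  proof (cases "\<Delta> = {}")
    \<comment> \<open>The void complex has a zero ring and no faces, so both sides hold.\<close>
    case True
    then show ?thesis
      unfolding initially_cohen_macaulay_def N using SR_ring_zero_iff by simp
  next
    case False
    then obtain d where d: "indim R SR_ring = enat d"
      "depth linear_forms SR_ring = enat d \<longleftrightarrow> links_acyclic d"
      by (rule depth_SR_ring_iff)
    \<comment> \<open>As the initial dimension is finite, the subtraction in the extended reals is
      the ordinary one, and the bound becomes an inequality of integers.\<close>
    have ineq: "ereal (real_of_int i) < indim_complex TYPE('k) n \<Delta> - ereal (real (card F)) \<longleftrightarrow>
        i < int d - 1 - int (card F)" for i :: int and F :: "nat set"
    proof -
      have "indim_complex TYPE('k) n \<Delta> - ereal (real (card F)) = ereal (real_of_int (int d - 1 - int (card F)))"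
        by (simp add: indim_complex_def R N d(1) one_ereal_def)
      then show ?thesis by (simp only: less_ereal.simps of_int_less_iff)
    qed
    have "initially_cohen_macaulay TYPE('k) n \<Delta> \<longleftrightarrow> links_acyclic d"
      using False SR_ring_zero_iff d by (simp add: initially_cohen_macaulay_def R N M)
    then show ?thesis unfolding links_acyclic_iff_homology ineq .
  qed
qed

end
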